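(* Let $\varphi:(M^m,g)\to(N^n,h)$ be an isometric immersion of Riemannian manifolds which is a hypersurface, i.e. $m=n-1$, and assume that its tension field satisfies $\overline\nabla^\perp_X\tau(\varphi)=0$ for all vector fields $X\in\mathfrak X(M)$. (1) If $\varphi$ is not harmonic, then $\varphi$ is biharmonic if and only if $$\rho^h(\xi)=\|B_\varphi\|^2\,\xi,$$ where $\rho^h$ is the Ricci transform of $(N,h)$ and $\xi$ is a unit normal vector field along $\varphi$. (2) In particular, if $(N,h)$ is an Einstein manifold, i.e. $\rho^h=c\,\mathrm{Id}$ for some constant $c$, and $\varphi$ is not harmonic, then $\varphi$ is biharmonic if and only if $\|B_\varphi\|^2=c$.
   Context: Manifolds are connected. Let $\nabla,\nabla^h$ be the Levi-Civita connections of $(M,g)$ and $(N,h)$, $\overline\nabla$ the induced connection on $\varphi^{-1}TN$, and $\overline\nabla^\perp$ the normal connection on the normal bundle $T^\perp M$. The second fundamental form is $B_\varphi(X,Y)=\overline\nabla_X(d\varphi(Y))-d\varphi(\nabla_XY)$ and the tension field is $\tau(\varphi)=\sum_{i=1}^mB_\varphi(e_i,e_i)$ for a local orthonormal frame field $\{e_i\}$ of $(M,g)$; $\|B_\varphi\|^2=\sum_{j,k=1}^m h(B_\varphi(e_j,e_k),B_\varphi(e_j,e_k))$. The curvature tensor is $R^h(U,V)W=\nabla^h_U\nabla^h_VW-\nabla^h_V\nabla^h_UW-\nabla^h_{[U,V]}W$. The Ricci transform is $\rho^h(u)=\sum_{i=1}^nR^h(u,e_i')e_i'$ for $u\in T_yN$,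 with $\{e_i'\}$ an orthonormal basis of $T_yN$. The bitension field is $\tau_2(\varphi)=\overline\Delta\tau(\varphi)-\sum_{i=1}^mR^h(\tau(\varphi),d\varphi(e_i))d\varphi(e_i)$, where $\overline\Delta V=-\sum_{i=1}^m\{\overline\nabla_{e_i}\overline\nabla_{e_i}V-\overline\nabla_{\nabla_{e_i}e_i}V\}$. The map $\varphi$ is harmonic if $\tau(\varphi)=0$ and biharmonic if $\tau_2(\varphi)=0$. *)

theory Defs
  imports "HOL-Analysis.Analysis"
begin

section \<open>Smooth functions between Euclidean spaces\<close>

text \<open>Only used for open \<open>S\<close>, so that \<open>at x\<close> and \<open>at x within S\<close> agree.\<close>

primrec Ck_on :: "nat \<Rightarrow> 'e::euclidean_space set \<Rightarrow> ('e \<Rightarrow> 'v::real_normed_vector) \<Rightarrow> bool" where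
  "Ck_on 0 S = (\<lambda>f. continuous_on S f)"
| "Ck_on (Suc k) S = (\<lambda>f. (\<forall>x\<in>S. f differentiable (at x)) \<and>
                            (\<forall>v. Ck_on k S (\<lambda>x. frechet_derivative f (at x) v)))"

definition smooth_on :: "'e::euclidean_space set \<Rightarrow> ('e \<Rightarrow> 'v::real_normed_vector) \<Rightarrow> bool" where
  "smooth_on S f \<longleftrightarrow> (\<forall>k. Ck_on k S f)"


section \<open>Smooth manifolds\<close>

text \<open>
  A chart is a pair of its domain and its coordinate map. The model space is a Euclidean space
  \<open>'e\<close>, so the dimension of the manifold is \<open>DIM('e)\<close>. A tangent vector at \<open>p\<close> is the family of its
  coordinate representations, one in \<open>'e\<close> for every chart around \<open>p\<close>, related by the derivatives of
  the transition maps; the entries of the family at all other charts are \<open>0\<close>, so that equality of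
  tangent vectors is equality of families.
\<close>

type_synonym ('a, 'e) chart = "'a set \<times> ('a \<Rightarrow> 'e)"
type_synonym ('a, 'e) tvec = "('a, 'e) chart \<Rightarrow> 'e"
type_synonym ('a, 'e) vfield = "'a \<Rightarrow> ('a, 'e) tvec"

text \<open>
  The type of Riemannian structures, without axioms; see \<open>riemannian_manifold\<close> below. The atlas need
  not be maximal.
\<close>

record ('a, 'e) riem =
  rtop :: "'a topology"
  ratlas :: "('a, 'e) chart set"
  rmetric :: "'a \<Rightarrow> ('a, 'e) tvec \<Rightarrow> ('a, 'e) tvec \<Rightarrow> real"

abbreviation points :: "('a, 'e) riem \<Rightarrow> 'a set" where
  "points M \<equiv> topspace (rtop M)"

definition charts_at :: "('a, 'e) riem \<Rightarrow> 'a \<Rightarrow> ('a, 'e) chart set" where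
  "charts_at M p = {c \<in> ratlas M. p \<in> fst c}"

definition chart_inv :: "('a, 'e) chart \<Rightarrow> 'e \<Rightarrow> 'a" where
  "chart_inv c = inv_into (fst c) (snd c)"

definition is_chart :: "'a topology \<Rightarrow> ('a, 'e::euclidean_space) chart \<Rightarrow> bool" where
  "is_chart X c \<longleftrightarrow> openin X (fst c) \<and> open (snd c ` fst c) \<and>
     homeomorphic_map (subtopology X (fst c)) (top_of_set (snd c ` fst c)) (snd c)"

definition smooth_manifold :: "('a, 'e::euclidean_space) riem \<Rightarrow> bool" where
  "smooth_manifold M \<longleftrightarrow>
     Hausdorff_space (rtop M) \<and> second_countable (rtop M) \<and> connected_space (rtop M) \<and>
     (\<forall>c\<in>ratlas M. is_chart (rtop M) c) \<and> (\<Union>c\<in>ratlas M. fst c) = points M \<and>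
     (\<forall>c\<in>ratlas M. \<forall>d\<in>ratlas M. smooth_on (snd c ` (fst c \<inter> fst d)) (\<lambda>x. snd d (chart_inv c x)))"

definition smooth_fun_on ::
    "('a, 'e::euclidean_space) riem \<Rightarrow> 'a set \<Rightarrow> ('a \<Rightarrow> 'v::real_normed_vector) \<Rightarrow> bool" where
  "smooth_fun_on M W f \<longleftrightarrow>
     (\<forall>c\<in>ratlas M. smooth_on (snd c ` (W \<inter> fst c)) (\<lambda>x. f (chart_inv c x)))"

definition tangent_space :: "('a, 'e::euclidean_space) riem \<Rightarrow> 'a \<Rightarrow> ('a, 'e) tvec set" where
  "tangent_space M p =
     {v. (\<forall>c\<in>charts_at M p. \<forall>d\<in>charts_at M p.
            v d = frechet_derivative (\<lambda>x. snd d (chart_inv c x)) (at (snd c p)) (v c)) \<and>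
         (\<forall>c. c \<notin> charts_at M p \<longrightarrow> v c = 0)}"

text \<open>The tangent vector at \<open>p\<close> whose representation in the chart \<open>c\<close> is \<open>a\<close>.\<close>

definition of_coords ::
    "('a, 'e::euclidean_space) riem \<Rightarrow> 'a \<Rightarrow> ('a, 'e) chart \<Rightarrow> 'e \<Rightarrow> ('a, 'e) tvec" where
  "of_coords M p c a = (\<lambda>d. if d \<in> charts_at M p
     then frechet_derivative (\<lambda>x. snd d (chart_inv c x)) (at (snd c p)) a else 0)"

text \<open>
  Derivative at \<open>p\<close> of a vector-valued function along the tangent vector \<open>v\<close>, computed in an
  arbitrary chart around \<open>p\<close>; by the chain rule the choice does not matter.
\<close>

definition dirderiv ::
    "('a, 'e::euclidean_space) riem \<Rightarrow> 'a \<Rightarrow> ('a, 'e) tvec \<Rightarrow> ('a \<Rightarrow> 'v::real_normed_vector) \<Rightarrow> 'v" where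
  "dirderiv M p v f = (let c = (SOME c. c \<in> charts_at M p)
     in frechet_derivative (\<lambda>x. f (chart_inv c x)) (at (snd c p)) (v c))"

definition smooth_vfield_on ::
    "('a, 'e::euclidean_space) riem \<Rightarrow> 'a set \<Rightarrow> ('a, 'e) vfield \<Rightarrow> bool" where
  "smooth_vfield_on M W X \<longleftrightarrow> (\<forall>p\<in>W. X p \<in> tangent_space M p) \<and>
     (\<forall>c\<in>ratlas M. smooth_fun_on M (W \<inter> fst c) (\<lambda>q. X q c))"

definition lie_bracket ::
    "('a, 'e::euclidean_space) riem \<Rightarrow> ('a, 'e) vfield \<Rightarrow> ('a, 'e) vfield \<Rightarrow> ('a, 'e) vfield" where
  "lie_bracket M X Y p = (\<lambda>c. if c \<in> charts_at M p
     then dirderiv M p (X p) (\<lambda>q. Y q c) - dirderiv M p (Y p) (\<lambda>q. X q c) else 0)"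


section \<open>Riemannian metrics and the Levi-Civita connection\<close>

definition metric_in ::
    "('a, 'e::euclidean_space) riem \<Rightarrow> ('a, 'e) chart \<Rightarrow> 'a \<Rightarrow> 'e \<Rightarrow> 'e \<Rightarrow> real" where
  "metric_in M c p a b = rmetric M p (of_coords M p c a) (of_coords M p c b)"

definition riemannian_manifold :: "('a, 'e::euclidean_space) riem \<Rightarrow> bool" where
  "riemannian_manifold M \<longleftrightarrow> smooth_manifold M \<and>
     (\<forall>p\<in>points M. \<forall>v\<in>tangent_space M p. \<forall>w\<in>tangent_space M p.
        rmetric M p v w = rmetric M p w v) \<and>
     (\<forall>p\<in>points M. \<forall>v\<in>tangent_space M p. v \<noteq> (\<lambda>_. 0) \<longrightarrow> rmetric M p v v > 0) \<and>
     (\<forall>p\<in>points M. \<forall>c\<in>charts_at M p. bilinear (metric_in M c p)) \<and>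
     (\<forall>c\<in>ratlas M. \<forall>a b. smooth_fun_on M (fst c) (\<lambda>q. metric_in M c q a b))"

text \<open>
  Christoffel symbols of the Levi-Civita connection in the chart \<open>c\<close> at \<open>p\<close>, that is, the bilinear map
  sending \<open>(a, b)\<close> to the covariant derivative along \<open>a\<close> of the coordinate vector field with constant
  coordinates \<open>b\<close>. For coordinate fields, whose Lie brackets vanish, the two conjuncts say
  that the connection is torsion-free and that it is compatible with the metric; they determine
  the map uniquely.
\<close>

definition christoffel ::
    "('a, 'e::euclidean_space) riem \<Rightarrow> ('a, 'e) chart \<Rightarrow> 'a \<Rightarrow> 'e \<Rightarrow> 'e \<Rightarrow> 'e" where
  "christoffel M c p = (THE \<Gamma>.
     (\<forall>a b. \<Gamma> a b = \<Gamma> b a) \<and>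
     (\<forall>w a b. dirderiv M p (of_coords M p c w) (\<lambda>q. metric_in M c q a b)
                = metric_in M c p (\<Gamma> w a) b + metric_in M c p a (\<Gamma> w b)))"

text \<open>Levi-Civita covariant derivative of the vector field \<open>Y\<close> along the tangent vector \<open>v\<close> at \<open>p\<close>.\<close>

definition cov ::
    "('a, 'e::euclidean_space) riem \<Rightarrow> ('a, 'e) tvec \<Rightarrow> ('a, 'e) vfield \<Rightarrow> 'a \<Rightarrow> ('a, 'e) tvec" where
  "cov M v Y p = (\<lambda>c. if c \<in> charts_at M p
     then dirderiv M p v (\<lambda>q. Y q c) + christoffel M c p (v c) (Y p c) else 0)"

definition curvature_fields ::
    "('a, 'e::euclidean_space) riem \<Rightarrow> ('a, 'e) vfield \<Rightarrow> ('a, 'e) vfield \<Rightarrow> ('a, 'e) vfield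
      \<Rightarrow> ('a, 'e) vfield" where
  "curvature_fields M U V W p = (\<lambda>c.
     cov M (U p) (\<lambda>q. cov M (V q) W q) p c
     - cov M (V p) (\<lambda>q. cov M (U q) W q) p c
     - cov M (lie_bracket M U V p) W p c)"

text \<open>The value of the curvature tensor on tangent vectors, through local extensions to vector fields.\<close>

definition curvature ::
    "('a, 'e::euclidean_space) riem \<Rightarrow> 'a \<Rightarrow> ('a, 'e) tvec \<Rightarrow> ('a, 'e) tvec \<Rightarrow> ('a, 'e) tvec
      \<Rightarrow> ('a, 'e) tvec" where
  "curvature M p u v w = (SOME r. \<exists>S U V W. openin (rtop M) S \<and> p \<in> S \<and>
     smooth_vfield_on M S U \<and> smooth_vfield_on M S V \<and> smooth_vfield_on M S W \<and>
     U p = u \<and> V p = v \<and> W p = w \<and> r = curvature_fields M U V W p)"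

definition orthonormal_at ::
    "('a, 'e::euclidean_space) riem \<Rightarrow> 'a \<Rightarrow> (nat \<Rightarrow> ('a, 'e) tvec) \<Rightarrow> bool" where
  "orthonormal_at M p b \<longleftrightarrow>
     (\<forall>i<DIM('e). b i \<in> tangent_space M p) \<and>
     (\<forall>i<DIM('e). \<forall>j<DIM('e). rmetric M p (b i) (b j) = (if i = j then 1 else 0))"

definition orthonormal_frame_on ::
    "('a, 'e::euclidean_space) riem \<Rightarrow> 'a set \<Rightarrow> (nat \<Rightarrow> ('a, 'e) vfield) \<Rightarrow> bool" where
  "orthonormal_frame_on M W e \<longleftrightarrow>
     (\<forall>i<DIM('e). smooth_vfield_on M W (e i)) \<and> (\<forall>q\<in>W. orthonormal_at M q (\<lambda>i. e i q))"

definition frame :: "('a, 'e::euclidean_space) riem \<Rightarrow> 'a \<Rightarrow> nat \<Rightarrow> ('a, 'e) vfield" where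
  "frame M p = (SOME e. \<exists>W. openin (rtop M) W \<and> p \<in> W \<and> orthonormal_frame_on M W e)"

definition ricci_transform ::
    "('a, 'e::euclidean_space) riem \<Rightarrow> 'a \<Rightarrow> ('a, 'e) tvec \<Rightarrow> ('a, 'e) tvec" where
  "ricci_transform M p u = (let b = (SOME b. orthonormal_at M p b)
     in (\<lambda>c. \<Sum>i<DIM('e). curvature M p u (b i) (b i) c))"

definition einstein_with :: "('a, 'e::euclidean_space) riem \<Rightarrow> real \<Rightarrow> bool" where
  "einstein_with M c \<longleftrightarrow>
     (\<forall>p\<in>points M. \<forall>u\<in>tangent_space M p. ricci_transform M p u = (\<lambda>d. c *\<^sub>R u d))"


section \<open>Isometric immersions\<close>

definition differential ::
    "('a, 'e::euclidean_space) riem \<Rightarrow> ('b, 'f::euclidean_space) riem \<Rightarrow> ('a \<Rightarrow> 'b) \<Rightarrow> 'a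
      \<Rightarrow> ('a, 'e) tvec \<Rightarrow> ('b, 'f) tvec" where
  "differential M N \<phi> p v = (\<lambda>d. if d \<in> charts_at N (\<phi> p)
     then dirderiv M p v (\<lambda>q. snd d (\<phi> q)) else 0)"

definition smooth_map ::
    "('a, 'e::euclidean_space) riem \<Rightarrow> ('b, 'f::euclidean_space) riem \<Rightarrow> ('a \<Rightarrow> 'b) \<Rightarrow> bool" where
  "smooth_map M N \<phi> \<longleftrightarrow> continuous_map (rtop M) (rtop N) \<phi> \<and>
     (\<forall>d\<in>ratlas N. smooth_fun_on M {p \<in> points M. \<phi> p \<in> fst d} (\<lambda>q. snd d (\<phi> q)))"

definition isometric_immersion ::
    "('a, 'e::euclidean_space) riem \<Rightarrow> ('b, 'f::euclidean_space) riem \<Rightarrow> ('a \<Rightarrow> 'b) \<Rightarrow> bool" where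
  "isometric_immersion M N \<phi> \<longleftrightarrow> smooth_map M N \<phi> \<and>
     (\<forall>p\<in>points M. inj_on (differential M N \<phi> p) (tangent_space M p)) \<and>
     (\<forall>p\<in>points M. \<forall>u\<in>tangent_space M p. \<forall>v\<in>tangent_space M p.
        rmetric N (\<phi> p) (differential M N \<phi> p u) (differential M N \<phi> p v) = rmetric M p u v)"

text \<open>Sections of the pull-back bundle of \<open>TN\<close>: \<open>V p\<close> is a tangent vector of \<open>N\<close> at \<open>\<phi> p\<close>.\<close>

type_synonym ('a, 'b, 'f) section_along = "'a \<Rightarrow> ('b, 'f) tvec"

definition smooth_section_along ::
    "('a, 'e::euclidean_space) riem \<Rightarrow> ('b, 'f::euclidean_space) riem \<Rightarrow> ('a \<Rightarrow> 'b)
      \<Rightarrow> ('a, 'b, 'f) section_along \<Rightarrow> bool" where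
  "smooth_section_along M N \<phi> V \<longleftrightarrow> (\<forall>p\<in>points M. V p \<in> tangent_space N (\<phi> p)) \<and>
     (\<forall>d\<in>ratlas N. smooth_fun_on M {p \<in> points M. \<phi> p \<in> fst d} (\<lambda>q. V q d))"

text \<open>The connection on the pull-back bundle induced by the Levi-Civita connection of \<open>N\<close>.\<close>

definition pull_cov ::
    "('a, 'e::euclidean_space) riem \<Rightarrow> ('b, 'f::euclidean_space) riem \<Rightarrow> ('a \<Rightarrow> 'b)
      \<Rightarrow> ('a, 'e) tvec \<Rightarrow> ('a, 'b, 'f) section_along \<Rightarrow> 'a \<Rightarrow> ('b, 'f) tvec" where
  "pull_cov M N \<phi> v V p = (\<lambda>d. if d \<in> charts_at N (\<phi> p)
     then dirderiv M p v (\<lambda>q. V q d) + christoffel N d (\<phi> p) (differential M N \<phi> p v d) (V p d)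
     else 0)"

definition normal_space ::
    "('a, 'e::euclidean_space) riem \<Rightarrow> ('b, 'f::euclidean_space) riem \<Rightarrow> ('a \<Rightarrow> 'b) \<Rightarrow> 'a
      \<Rightarrow> ('b, 'f) tvec set" where
  "normal_space M N \<phi> p = {v \<in> tangent_space N (\<phi> p).
     \<forall>u\<in>tangent_space M p. rmetric N (\<phi> p) v (differential M N \<phi> p u) = 0}"

definition normal_part ::
    "('a, 'e::euclidean_space) riem \<Rightarrow> ('b, 'f::euclidean_space) riem \<Rightarrow> ('a \<Rightarrow> 'b) \<Rightarrow> 'a
      \<Rightarrow> ('b, 'f) tvec \<Rightarrow> ('b, 'f) tvec" where
  "normal_part M N \<phi> p w = (THE v. v \<in> normal_space M N \<phi> p \<and>
     (\<exists>u\<in>tangent_space M p. w = (\<lambda>d. differential M N \<phi> p u d + v d)))"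

definition normal_cov ::
    "('a, 'e::euclidean_space) riem \<Rightarrow> ('b, 'f::euclidean_space) riem \<Rightarrow> ('a \<Rightarrow> 'b)
      \<Rightarrow> ('a, 'e) tvec \<Rightarrow> ('a, 'b, 'f) section_along \<Rightarrow> 'a \<Rightarrow> ('b, 'f) tvec" where
  "normal_cov M N \<phi> v V p = normal_part M N \<phi> p (pull_cov M N \<phi> v V p)"

definition unit_normal_field ::
    "('a, 'e::euclidean_space) riem \<Rightarrow> ('b, 'f::euclidean_space) riem \<Rightarrow> ('a \<Rightarrow> 'b)
      \<Rightarrow> ('a, 'b, 'f) section_along \<Rightarrow> bool" where
  "unit_normal_field M N \<phi> \<xi> \<longleftrightarrow> smooth_section_along M N \<phi> \<xi> \<and>
     (\<forall>p\<in>points M. \<xi> p \<in> normal_space M N \<phi> p \<and> rmetric N (\<phi> p) (\<xi> p) (\<xi> p) = 1)"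

definition second_fund_form ::
    "('a, 'e::euclidean_space) riem \<Rightarrow> ('b, 'f::euclidean_space) riem \<Rightarrow> ('a \<Rightarrow> 'b)
      \<Rightarrow> ('a, 'e) vfield \<Rightarrow> ('a, 'e) vfield \<Rightarrow> ('a, 'b, 'f) section_along" where
  "second_fund_form M N \<phi> X Y p = (\<lambda>d.
     pull_cov M N \<phi> (X p) (\<lambda>q. differential M N \<phi> q (Y q)) p d
     - differential M N \<phi> p (cov M (X p) Y p) d)"

definition tension ::
    "('a, 'e::euclidean_space) riem \<Rightarrow> ('b, 'f::euclidean_space) riem \<Rightarrow> ('a \<Rightarrow> 'b)
      \<Rightarrow> ('a, 'b, 'f) section_along" where
  "tension M N \<phi> p = (let e = frame M p
     in (\<lambda>d. \<Sum>i<DIM('e). second_fund_form M N \<phi> (e i) (e i) p d))"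

definition second_fund_form_norm2 ::
    "('a, 'e::euclidean_space) riem \<Rightarrow> ('b, 'f::euclidean_space) riem \<Rightarrow> ('a \<Rightarrow> 'b) \<Rightarrow> 'a \<Rightarrow> real" where
  "second_fund_form_norm2 M N \<phi> p = (let e = frame M p
     in \<Sum>j<DIM('e). \<Sum>k<DIM('e).
          rmetric N (\<phi> p) (second_fund_form M N \<phi> (e j) (e k) p)
                          (second_fund_form M N \<phi> (e j) (e k) p))"

definition rough_laplacian ::
    "('a, 'e::euclidean_space) riem \<Rightarrow> ('b, 'f::euclidean_space) riem \<Rightarrow> ('a \<Rightarrow> 'b)
      \<Rightarrow> ('a, 'b, 'f) section_along \<Rightarrow> ('a, 'b, 'f) section_along" where
  "rough_laplacian M N \<phi> V p = (let e = frame M p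
     in (\<lambda>d. - (\<Sum>i<DIM('e).
          pull_cov M N \<phi> (e i p) (\<lambda>q. pull_cov M N \<phi> (e i q) V q) p d
          - pull_cov M N \<phi> (cov M (e i p) (e i) p) V p d)))"

definition bitension ::
    "('a, 'e::euclidean_space) riem \<Rightarrow> ('b, 'f::euclidean_space) riem \<Rightarrow> ('a \<Rightarrow> 'b)
      \<Rightarrow> ('a, 'b, 'f) section_along" where
  "bitension M N \<phi> p = (let e = frame M p
     in (\<lambda>d. rough_laplacian M N \<phi> (tension M N \<phi>) p d
          - (\<Sum>i<DIM('e). curvature N (\<phi> p) (tension M N \<phi> p)
               (differential M N \<phi> p (e i p)) (differential M N \<phi> p (e i p)) d)))"

definition harmonic ::
    "('a, 'e::euclidean_space) riem \<Rightarrow> ('b, 'f::euclidean_space) riem \<Rightarrow> ('a \<Rightarrow> 'b) \<Rightarrow> bool" where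
  "harmonic M N \<phi> \<longleftrightarrow> (\<forall>p\<in>points M. tension M N \<phi> p = (\<lambda>_. 0))"

definition biharmonic ::
    "('a, 'e::euclidean_space) riem \<Rightarrow> ('b, 'f::euclidean_space) riem \<Rightarrow> ('a \<Rightarrow> 'b) \<Rightarrow> bool" where
  "biharmonic M N \<phi> \<longleftrightarrow> (\<forall>p\<in>points M. bitension M N \<phi> p = (\<lambda>_. 0))"

end

theory Submission
  imports Defs
begin

text \<open>
  Since \<open>\<tau>\<close> is normal and parallel for the normal connection, \<open>|\<tau>|\<^sup>2\<close> has zero derivative, so on a
  connected manifold \<open>\<tau>\<close> vanishes nowhere unless \<open>\<phi>\<close> is harmonic. Each covariant derivative of \<open>\<tau>\<close> is
  tangential, given by the symmetric form \<open>S(a,b) = - h(\<tau>, B(a,b))\<close>. The tangential part of the second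
  covariant derivative of \<open>\<tau>\<close> is therefore the covariant derivative of \<open>S\<close>; using its symmetry, the
  commutation rule for second derivatives and the constancy of the trace \<open>- |\<tau>|\<^sup>2\<close> of \<open>S\<close>, the
  tangential part of the bitension field is \<open>- 2 \<Sum> R(\<tau>, e\<^sub>i) e\<^sub>i\<close>. Its component along \<open>\<tau>\<close> is
  \<open>|\<tau>|\<^sup>2 |B|\<^sup>2 - \<Sum> h(R(\<tau>, e\<^sub>i) e\<^sub>i, \<tau>)\<close> by differentiating \<open>|\<tau>|\<^sup>2 = const\<close> twice. In codimension one
  \<open>\<Sum> R(\<tau>, e\<^sub>i) e\<^sub>i\<close> is the full Ricci transform of \<open>\<tau>\<close>, because the missing direction is that of \<open>\<tau>\<close>.
  All of this is a computation between open subsets of Euclidean spaces, to which the manifold case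
  reduces through charts.
\<close>

text \<open>The equation for the Ricci transform packs two conditions into one: its tangential part
  says that \<open>\<Sum> R(\<tau>, e\<^sub>i) e\<^sub>i\<close> is normal, its normal part fixes
  the component along \<open>\<tau>\<close>. They match the two parts of the bitension field one by
  one; the factor 2 is harmless because the tangential part is compared with 0. Codimension one is
  also used in that the normal space is a line: this gives \<open>h(\<tau>, B(a,b))\<^sup>2 =
  |\<tau>|\<^sup>2 |B(a,b)|\<^sup>2\<close>, and it makes a unit normal a nonzero multiple of
  \<open>\<tau>\<close>. The obstacle is that the definitions rest on choices: a chart in
  \<open>dirderiv\<close>, extensions in \<open>curvature\<close>, a basis in
  \<open>ricci_transform\<close>, and a new frame at every point in \<open>tension\<close>. Each
  choice has to be shown not to matter; above all, \<open>\<tau>\<close> can only be differentiated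
  once the pointwise frames are replaced by one local frame. The hypothesis on \<open>\<tau>\<close>
  speaks of vector fields on all of \<open>M\<close>, so a single tangent vector is first extended
  by means of a bump function.\<close>

abbreviation Df :: "('a::real_normed_vector \<Rightarrow> 'b::real_normed_vector) \<Rightarrow> 'a \<Rightarrow> 'a \<Rightarrow> 'b" where
  "Df f x \<equiv> frechet_derivative f (at x)"

lemma Df_eq: "(f has_derivative f') (at x) \<Longrightarrow> Df f x = f'"
  by (metis frechet_derivative_at)

text \<open>\<open>frechet_derivative\<close> is a Hilbert choice over the predicate
  \<open>has_derivative\<close>, and that predicate only sees the germ of the function at
  \<open>x\<close>; equal predicates give equal choices.\<close>

lemma Df_cong_open:
  assumes "open S" "x \<in> S" "\<And>y. y \<in> S \<Longrightarrow> f y = g y"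
  shows "Df f x = Df g x"
proof -
  have "(f has_derivative f') (at x) \<longleftrightarrow> (g has_derivative f') (at x)" for f'
    using assms has_derivative_transform_within_open by (metis (no_types, lifting))
  then show ?thesis
    unfolding frechet_derivative_def by presburger
qed

subsection \<open>Closure properties of smooth functions\<close>

lemma Ck_on_subset: "Ck_on k S f \<Longrightarrow> T \<subseteq> S \<Longrightarrow> Ck_on k T f"
  by (induction k arbitrary: f) (auto intro: continuous_on_subset)

lemma Ck_on_cong:
  assumes "open S" "\<And>x. x \<in> S \<Longrightarrow> f x = g x" "Ck_on k S f"
  shows "Ck_on k S g"
  using assms(2,3)
proof (induction k arbitrary: f g)
  case 0
  then show ?case by (metis Ck_on.simps(1) continuous_on_cong)
next
  case (Suc k)
  have "g differentiable (at x)" if "x \<in> S" for x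
  proof -
    have "f differentiable (at x)" using Suc.prems that by simp
    then show ?thesis
      unfolding differentiable_def
      using has_derivative_transform_within_open[OF _ assms(1) that] Suc.prems(1) by blast
  qed
  moreover have "Ck_on k S (\<lambda>x. Df g x v)" for v
  proof (rule Suc.IH)
    show "Ck_on k S (\<lambda>x. Df f x v)" using Suc.prems by simp
    show "Df f x v = Df g x v" if "x \<in> S" for x
      using Df_cong_open[OF assms(1) that] Suc.prems(1) by metis
  qed
  ultimately show ?case by simp
qed

lemma Ck_on_local:
  assumes "\<And>x. x \<in> S \<Longrightarrow> \<exists>T. open T \<and> x \<in> T \<and> Ck_on k T f"
  shows "Ck_on k S f"
  using assms
proof (induction k arbitrary: f)
  case 0
  have "isCont f x" if "x \<in> S" for x
  proof -
    from "0"[OF that] obtain T where T: "open T" "x \<in> T" "Ck_on 0 T f" by (elim exE conjE)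
    from T(3) have "continuous_on T f" by simp
    with T(1,2) show ?thesis by (metis continuous_on_eq_continuous_at)
  qed
  then show ?case by (simp add: continuous_at_imp_continuous_on)
next
  case (Suc k)
  have "f differentiable (at x)" if "x \<in> S" for x
  proof -
    from Suc.prems[OF that] obtain T where "open T" "x \<in> T" "Ck_on (Suc k) T f" by (elim exE conjE)
    then show ?thesis by simp
  qed
  moreover have "Ck_on k S (\<lambda>x. Df f x v)" for v
  proof (rule Suc.IH)
    fix x assume "x \<in> S"
    from Suc.prems[OF this] obtain T where "open T" "x \<in> T" "Ck_on (Suc k) T f" by (elim exE conjE)
    then show "\<exists>T. open T \<and> x \<in> T \<and> Ck_on k T (\<lambda>x. Df f x v)"
      by (intro exI[of _ T]) simp
  qed
  ultimately show ?case by simp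
qed

lemma Ck_on_SucD: "Ck_on (Suc k) S f \<Longrightarrow> Ck_on k S f"
proof (induction k arbitrary: f)
  case 0
  then show ?case
    by (simp add: continuous_at_imp_continuous_on differentiable_imp_continuous_within)
next
  case (Suc k)
  then show ?case by (metis Ck_on.simps(2))
qed

text \<open>Replaces the chosen derivative in the recursion by any explicit one, so that the closure
  properties below follow from the usual differentiation rules by induction on
  \<open>k\<close>.\<close>

lemma Ck_on_SucI:
  assumes "open S" "\<And>x. x \<in> S \<Longrightarrow> (f has_derivative f' x) (at x)" "\<And>v. Ck_on k S (\<lambda>x. f' x v)"
  shows "Ck_on (Suc k) S f"
proof -
  have "Ck_on k S (\<lambda>x. Df f x v)" for v
    by (rule Ck_on_cong[OF assms(1) _ assms(3)[of v]]) (use assms(2) Df_eq in metis)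
  then show ?thesis
    using assms(2) by (auto simp: differentiable_def)
qed

lemma Ck_on_const: "Ck_on k S (\<lambda>x. c)"
  by (induction k arbitrary: c) auto

lemma Ck_on_has_derivative:
  "Ck_on (Suc k) S f \<Longrightarrow> x \<in> S \<Longrightarrow> (f has_derivative Df f x) (at x)"
  by (simp add: frechet_derivative_works[symmetric])

lemma Ck_on_linear:
  assumes "bounded_linear L" "open S"
  shows "Ck_on k S f \<Longrightarrow> Ck_on k S (\<lambda>x. L (f x))"
proof (induction k arbitrary: f)
  case 0
  then show ?case
    using bounded_linear.continuous_on[OF assms(1)] by auto
next
  case (Suc k)
  show ?case
  proof (rule Ck_on_SucI[OF assms(2)])
    show "((\<lambda>x. L (f x)) has_derivative (\<lambda>v. L (Df f x v))) (at x)" if "x \<in> S" for x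
      by (rule bounded_linear.has_derivative[OF assms(1) Ck_on_has_derivative[OF Suc.prems that]])
    show "Ck_on k S (\<lambda>x. L (Df f x v))" for v
      using Suc by simp
  qed
qed

lemma Ck_on_add:
  assumes "open S"
  shows "Ck_on k S f \<Longrightarrow> Ck_on k S g \<Longrightarrow> Ck_on k S (\<lambda>x. f x + g x)"
proof (induction k arbitrary: f g)
  case 0
  then show ?case by (auto intro: continuous_on_add)
next
  case (Suc k)
  show ?case
  proof (rule Ck_on_SucI[OF assms])
    show "((\<lambda>x. f x + g x) has_derivative (\<lambda>v. Df f x v + Df g x v)) (at x)" if "x \<in> S" for x
      by (intro has_derivative_add Ck_on_has_derivative[OF Suc.prems(1) that] Ck_on_has_derivative[OF Suc.prems(2) that])
    show "Ck_on k S (\<lambda>x. Df f x v + Df g x v)" for v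
      using Suc by simp
  qed
qed

lemma Ck_on_bilinear:
  assumes "bounded_bilinear B" "open S"
  shows "Ck_on k S f \<Longrightarrow> Ck_on k S g \<Longrightarrow> Ck_on k S (\<lambda>x. B (f x) (g x))"
proof (induction k arbitrary: f g)
  case 0
  then show ?case by (auto intro: bounded_bilinear.continuous_on[OF assms(1)])
next
  case (Suc k)
  show ?case
  proof (rule Ck_on_SucI[OF assms(2)])
    show "((\<lambda>x. B (f x) (g x)) has_derivative (\<lambda>v. B (f x) (Df g x v) + B (Df f x v) (g x))) (at x)"
      if "x \<in> S" for x
      by (intro bounded_bilinear.FDERIV[OF assms(1)] Ck_on_has_derivative[OF Suc.prems(1) that] Ck_on_has_derivative[OF Suc.prems(2) that])
    show "Ck_on k S (\<lambda>x. B (f x) (Df g x v) + B (Df f x v) (g x))" for v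
      using Suc.prems Ck_on_SucD[OF Suc.prems(1)] Ck_on_SucD[OF Suc.prems(2)]
      by (intro Ck_on_add[OF assms(2)] Suc.IH) auto
  qed
qed

lemma Ck_on_sum:
  assumes "open S" "\<And>i. i \<in> I \<Longrightarrow> Ck_on k S (f i)"
  shows "Ck_on k S (\<lambda>x. \<Sum>i\<in>I. f i x)"
  using assms(2)
  by (induction I rule: infinite_finite_induct) (auto intro: Ck_on_const Ck_on_add[OF assms(1)])

lemma linear_Basis_expand:
  fixes L :: "'e::euclidean_space \<Rightarrow> 'v::real_vector"
  assumes "linear L"
  shows "L a = (\<Sum>b\<in>Basis. (a \<bullet> b) *\<^sub>R L b)"
  by (metis (no_types, lifting) euclidean_representation linear_scale[OF assms] linear_sum[OF assms] sum.cong)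

lemma Ck_on_compose:
  fixes f :: "'e::euclidean_space \<Rightarrow> 'f::euclidean_space" and g :: "'f \<Rightarrow> 'v::real_normed_vector"
  assumes "open S" "open T" "f ` S \<subseteq> T"
  shows "Ck_on k S f \<Longrightarrow> Ck_on k T g \<Longrightarrow> Ck_on k S (\<lambda>x. g (f x))"
proof (induction k arbitrary: g)
  case 0
  then show ?case using assms by (auto intro: continuous_on_compose2)
next
  case (Suc k)
  have g: "(g has_derivative Df g (f x)) (at (f x))" if "x \<in> S" for x
    using Ck_on_has_derivative[OF Suc.prems(2)] that assms(3) by auto
  show ?case
  proof (rule Ck_on_SucI[OF assms(1)])
    show "((\<lambda>x. g (f x)) has_derivative (\<lambda>v. Df g (f x) (Df f x v))) (at x)" if "x \<in> S" for x
      using diff_chain_at[OF Ck_on_has_derivative[OF Suc.prems(1) that] g[OF that]]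
      by (simp add: comp_def)
    show "Ck_on k S (\<lambda>x. Df g (f x) (Df f x v))" for v
    \<comment> \<open>\<open>Ck_on\<close> controls derivatives in fixed directions only, while the
      direction \<open>Df f x v\<close> moves with \<open>x\<close>. Expanding it in the basis
      leaves fixed directions \<open>b\<close> with coefficients that are again in the
      class.\<close>
    proof (rule Ck_on_cong[OF assms(1)])
      show "(\<Sum>b\<in>Basis. (Df f x v \<bullet> b) *\<^sub>R Df g (f x) b) = Df g (f x) (Df f x v)"
        if "x \<in> S" for x
        using linear_Basis_expand[OF has_derivative_linear[OF g[OF that]]] by metis
      show "Ck_on k S (\<lambda>x. \<Sum>b\<in>Basis. (Df f x v \<bullet> b) *\<^sub>R Df g (f x) b)"
        using Suc.prems Ck_on_SucD[OF Suc.prems(1)]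
        by (intro Ck_on_sum Ck_on_bilinear[OF bounded_bilinear_scaleR] Suc.IH assms
            Ck_on_linear[OF bounded_linear_inner_left]) auto
    qed
  qed
qed

text \<open>Needed for the exponent \<open>-1/2\<close>, to normalise vectors in the Gram-Schmidt
  process. The exponent varies in the induction because differentiation lowers it.\<close>

lemma Ck_on_powr: "Ck_on k {0<..} (\<lambda>t::real. t powr a)"
proof (induction k arbitrary: a)
  case 0
  have "continuous_on {0<..} (\<lambda>t::real. t powr a)"
    by (rule continuous_on_powr) (auto intro: continuous_on_id continuous_on_const)
  then show ?case by simp
next
  case (Suc k)
  show ?case
  proof (rule Ck_on_SucI)
    show "((\<lambda>t. t powr a) has_derivative (\<lambda>v. t powr (a - 1) * (a * v))) (at t)" if "t \<in> {0<..}" for t :: real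
    proof -
      have "(*) (a * t powr (a - 1)) = (\<lambda>v. t powr (a - 1) * (a * v))" by (auto simp: ac_simps)
      then show ?thesis
        using has_real_derivative_powr[of t a] that by (simp add: has_field_derivative_def)
    qed
    show "Ck_on k {0<..} (\<lambda>t. t powr (a - 1) * (a * v))" for v
      by (rule Ck_on_linear[OF bounded_linear_mult_left _ Suc.IH]) auto
  qed auto
qed

lemma smooth_on_Ck: "smooth_on S f \<Longrightarrow> Ck_on k S f"
  by (simp add: smooth_on_def)

lemma smooth_on_subset: "smooth_on S f \<Longrightarrow> T \<subseteq> S \<Longrightarrow> smooth_on T f"
  unfolding smooth_on_def by (rule allI, rule Ck_on_subset) auto

lemma smooth_on_cong:
  "smooth_on S f \<Longrightarrow> open S \<Longrightarrow> (\<And>x. x \<in> S \<Longrightarrow> f x = g x) \<Longrightarrow> smooth_on S g"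
  unfolding smooth_on_def by (rule allI, rule Ck_on_cong[where f=f]) auto

lemma smooth_on_local:
  assumes "\<And>x. x \<in> S \<Longrightarrow> \<exists>T. open T \<and> x \<in> T \<and> smooth_on T f"
  shows "smooth_on S f"
proof -
  have "Ck_on k S f" for k
  proof (rule Ck_on_local)
    fix x assume "x \<in> S"
    from assms[OF this] obtain T where "open T" "x \<in> T" "smooth_on T f" by (elim exE conjE)
    then show "\<exists>T. open T \<and> x \<in> T \<and> Ck_on k T f"
      by (rule_tac exI[of _ T]) (simp add: smooth_on_Ck)
  qed
  then show ?thesis unfolding smooth_on_def by (rule allI)
qed

lemma smooth_on_const: "smooth_on S (\<lambda>x. c)"
  unfolding smooth_on_def by (intro allI Ck_on_const)

lemma smooth_on_ident: "open S \<Longrightarrow> smooth_on S (\<lambda>x. x)"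
  unfolding smooth_on_def
proof
  fix k assume "open S"
  then show "Ck_on k S (\<lambda>x. x)"
    by (cases k) (simp_all add: Ck_on_const[of _ S _])
qed

lemma smooth_on_linear:
  "smooth_on S f \<Longrightarrow> open S \<Longrightarrow> bounded_linear L \<Longrightarrow> smooth_on S (\<lambda>x. L (f x))"
  unfolding smooth_on_def by (rule allI, rule Ck_on_linear) auto

lemma smooth_on_add:
  "smooth_on S f \<Longrightarrow> smooth_on S g \<Longrightarrow> open S \<Longrightarrow> smooth_on S (\<lambda>x. f x + g x)"
  unfolding smooth_on_def by (rule allI, rule Ck_on_add) auto

lemma smooth_on_bilinear:
  "bounded_bilinear B \<Longrightarrow> smooth_on S f \<Longrightarrow> smooth_on S g \<Longrightarrow> open S \<Longrightarrow> smooth_on S (\<lambda>x. B (f x) (g x))"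
  unfolding smooth_on_def by (rule allI, rule Ck_on_bilinear) auto

lemma smooth_on_scaleR:
  "smooth_on S f \<Longrightarrow> smooth_on S g \<Longrightarrow> open S \<Longrightarrow> smooth_on S (\<lambda>x. f x *\<^sub>R g x)"
  by (rule smooth_on_bilinear[OF bounded_bilinear_scaleR])

lemma smooth_on_diff:
  fixes f g :: "'e::euclidean_space \<Rightarrow> 'v::real_normed_vector"
  assumes "smooth_on S f" "smooth_on S g" "open S"
  shows "smooth_on S (\<lambda>x. f x - g x)"
  using smooth_on_add[OF assms(1) smooth_on_linear[OF assms(2,3) bounded_linear_minus[OF bounded_linear_ident]] assms(3)]
  by simp

lemma smooth_on_sum:
  "(\<And>i. i \<in> I \<Longrightarrow> smooth_on S (f i)) \<Longrightarrow> open S \<Longrightarrow> smooth_on S (\<lambda>x. \<Sum>i\<in>I. f i x)"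
  unfolding smooth_on_def by (rule allI, rule Ck_on_sum) auto

lemma smooth_on_compose:
  fixes f :: "'e::euclidean_space \<Rightarrow> 'f::euclidean_space" and g :: "'f \<Rightarrow> 'v::real_normed_vector"
  shows "smooth_on T g \<Longrightarrow> smooth_on S f \<Longrightarrow> open S \<Longrightarrow> open T \<Longrightarrow> f ` S \<subseteq> T \<Longrightarrow> smooth_on S (\<lambda>x. g (f x))"
  unfolding smooth_on_def by (rule allI, rule Ck_on_compose) auto

lemma smooth_on_powr: "smooth_on {0<..} (\<lambda>t::real. t powr a)"
  unfolding smooth_on_def by (intro allI Ck_on_powr)

lemma smooth_on_has_derivative:
  "smooth_on S f \<Longrightarrow> x \<in> S \<Longrightarrow> (f has_derivative Df f x) (at x)"
  using Ck_on_has_derivative smooth_on_Ck by blast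

lemma smooth_on_differentiable: "smooth_on S f \<Longrightarrow> x \<in> S \<Longrightarrow> f differentiable (at x)"
  using smooth_on_has_derivative differentiable_def by blast

lemma smooth_on_linear_Df: "smooth_on S f \<Longrightarrow> x \<in> S \<Longrightarrow> linear (Df f x)"
  using smooth_on_has_derivative has_derivative_linear by blast

lemma smooth_on_Df: "smooth_on S f \<Longrightarrow> smooth_on S (\<lambda>x. Df f x v)"
  unfolding smooth_on_def by (metis Ck_on.simps(2))

lemma smooth_on_continuous: "smooth_on S f \<Longrightarrow> continuous_on S f"
  using smooth_on_Ck[of S f 0] by simp

subsection \<open>Smooth families of linear and bilinear maps\<close>

lemma linear_family_expand:
  fixes L :: "'e::euclidean_space \<Rightarrow> 'a::euclidean_space \<Rightarrow> 'v::real_normed_vector"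
  assumes "linear (L x)"
  shows "L x (V x) = (\<Sum>b\<in>Basis. (V x \<bullet> b) *\<^sub>R L x b)"
  using linear_Basis_expand[OF assms] by metis

lemma smooth_on_linear_family:
  fixes L :: "'e::euclidean_space \<Rightarrow> 'a::euclidean_space \<Rightarrow> 'v::real_normed_vector"
  assumes "open S" "\<And>x. x \<in> S \<Longrightarrow> linear (L x)" "\<And>a. smooth_on S (\<lambda>x. L x a)" "smooth_on S V"
  shows "smooth_on S (\<lambda>x. L x (V x))"
proof (rule smooth_on_cong[OF _ assms(1)])
  show "smooth_on S (\<lambda>x. \<Sum>b\<in>Basis. (V x \<bullet> b) *\<^sub>R L x b)"
    by (intro smooth_on_sum smooth_on_scaleR assms smooth_on_linear[OF _ _ bounded_linear_inner_left])
qed (rule linear_family_expand[OF assms(2), symmetric])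

text \<open>Product rule whose first term differentiates the family with its argument frozen at
  \<open>V x\<close>. Working with a basis expansion avoids a norm on the space of linear
  maps.\<close>

lemma Df_linear_family:
  fixes L :: "'e::euclidean_space \<Rightarrow> 'a::euclidean_space \<Rightarrow> 'v::real_normed_vector"
  assumes "open S" "\<And>x. x \<in> S \<Longrightarrow> linear (L x)" "\<And>a. smooth_on S (\<lambda>x. L x a)" "smooth_on S V" "x \<in> S"
  shows "Df (\<lambda>y. L y (V y)) x w = Df (\<lambda>y. L y (V x)) x w + L x (Df V x w)"
proof -
  have 1: "((\<lambda>y. \<Sum>b\<in>Basis. (V y \<bullet> b) *\<^sub>R L y b) has_derivative
      (\<lambda>w. \<Sum>b\<in>Basis. (V x \<bullet> b) *\<^sub>R Df (\<lambda>y. L y b) x w + (Df V x w \<bullet> b) *\<^sub>R L x b)) (at x)"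
    by (intro has_derivative_sum has_derivative_scaleR has_derivative_inner_left
        smooth_on_has_derivative[OF _ assms(5)] assms(3,4))
  have 2: "((\<lambda>y. \<Sum>b\<in>Basis. (V x \<bullet> b) *\<^sub>R L y b) has_derivative
      (\<lambda>w. \<Sum>b\<in>Basis. (V x \<bullet> b) *\<^sub>R Df (\<lambda>y. L y b) x w)) (at x)"
    by (intro has_derivative_sum has_derivative_scaleR_right
        smooth_on_has_derivative[OF _ assms(5)] assms(3))
  have "Df (\<lambda>y. L y (V y)) x = (\<lambda>w. \<Sum>b\<in>Basis. (V x \<bullet> b) *\<^sub>R Df (\<lambda>y. L y b) x w + (Df V x w \<bullet> b) *\<^sub>R L x b)"
    by (rule Df_eq, rule has_derivative_transform_within_open[OF 1 assms(1,5)])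
      (rule linear_family_expand[OF assms(2), symmetric])
  moreover have "Df (\<lambda>y. L y (V x)) x = (\<lambda>w. \<Sum>b\<in>Basis. (V x \<bullet> b) *\<^sub>R Df (\<lambda>y. L y b) x w)"
    by (rule Df_eq, rule has_derivative_transform_within_open[OF 2 assms(1,5)])
      (metis linear_Basis_expand[OF assms(2)])
  moreover have "L x (Df V x w) = (\<Sum>b\<in>Basis. (Df V x w \<bullet> b) *\<^sub>R L x b)"
    by (rule linear_Basis_expand[OF assms(2)[OF assms(5)]])
  ultimately show ?thesis
    by (simp add: sum.distrib)
qed

lemma linear_Df_family:
  fixes L :: "'e::euclidean_space \<Rightarrow> 'a::euclidean_space \<Rightarrow> 'v::real_normed_vector"
  assumes "open S" "\<And>x. x \<in> S \<Longrightarrow> linear (L x)" "\<And>a. smooth_on S (\<lambda>x. L x a)" "x \<in> S"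
  shows "linear (\<lambda>a. Df (\<lambda>y. L y a) x w)"
proof (rule linearI)
  fix a b :: 'a and r :: real
  have "((\<lambda>y. L y a + L y b) has_derivative (\<lambda>w. Df (\<lambda>y. L y a) x w + Df (\<lambda>y. L y b) x w)) (at x)"
    by (intro has_derivative_add smooth_on_has_derivative[OF _ assms(4)] assms(3))
  then have "((\<lambda>y. L y (a + b)) has_derivative (\<lambda>w. Df (\<lambda>y. L y a) x w + Df (\<lambda>y. L y b) x w)) (at x)"
    by (rule has_derivative_transform_within_open[OF _ assms(1,4)]) (rule linear_add[OF assms(2), symmetric])
  then show "Df (\<lambda>y. L y (a + b)) x w = Df (\<lambda>y. L y a) x w + Df (\<lambda>y. L y b) x w"
    by (simp add: Df_eq)
  have "((\<lambda>y. r *\<^sub>R L y a) has_derivative (\<lambda>w. r *\<^sub>R Df (\<lambda>y. L y a) x w)) (at x)"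
    by (intro has_derivative_scaleR_right smooth_on_has_derivative[OF _ assms(4)] assms(3))
  then have "((\<lambda>y. L y (r *\<^sub>R a)) has_derivative (\<lambda>w. r *\<^sub>R Df (\<lambda>y. L y a) x w)) (at x)"
    by (rule has_derivative_transform_within_open[OF _ assms(1,4)]) (rule linear_scale[OF assms(2), symmetric])
  then show "Df (\<lambda>y. L y (r *\<^sub>R a)) x w = r *\<^sub>R Df (\<lambda>y. L y a) x w"
    by (simp add: Df_eq)
qed

text \<open>Smoothness is asked for each fixed pair of arguments, which in finite dimension amounts
  to joint smoothness. Metrics, Christoffel symbols, second fundamental forms and shape forms are
  all families of this kind.\<close>

definition bilinear_family ::
    "'e::euclidean_space set \<Rightarrow> ('e \<Rightarrow> 'a::euclidean_space \<Rightarrow> 'b::euclidean_space \<Rightarrow> 'v::real_normed_vector) \<Rightarrow> bool" where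
  "bilinear_family S K \<longleftrightarrow> (\<forall>x\<in>S. bilinear (K x)) \<and> (\<forall>a b. smooth_on S (\<lambda>x. K x a b))"

lemma bilinear_familyD:
  assumes "bilinear_family S K"
  shows "x \<in> S \<Longrightarrow> bilinear (K x)" "smooth_on S (\<lambda>x. K x a b)"
    "x \<in> S \<Longrightarrow> linear (K x a)" "x \<in> S \<Longrightarrow> linear (\<lambda>a. K x a b)"
  using assms by (auto simp: bilinear_family_def bilinear_def)

lemma smooth_on_bilinear_family_left:
  assumes "open S" "bilinear_family S K" "smooth_on S V"
  shows "smooth_on S (\<lambda>x. K x (V x) b)"
  by (rule smooth_on_linear_family[where L="\<lambda>x a. K x a b", OF assms(1) bilinear_familyD(4)[OF assms(2)]
      bilinear_familyD(2)[OF assms(2)] assms(3)])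

lemma smooth_on_bilinear_family:
  assumes "open S" "bilinear_family S K" "smooth_on S V" "smooth_on S W"
  shows "smooth_on S (\<lambda>x. K x (V x) (W x))"
  by (rule smooth_on_linear_family[where L="\<lambda>x. K x (V x)", OF assms(1) bilinear_familyD(3)[OF assms(2)]
      smooth_on_bilinear_family_left[OF assms(1-3)] assms(4)])

lemma Df_bilinear_family:
  assumes "open S" "bilinear_family S K" "smooth_on S V" "smooth_on S W" "x \<in> S"
  shows "Df (\<lambda>y. K y (V y) (W y)) x w =
    Df (\<lambda>y. K y (V x) (W x)) x w + K x (Df V x w) (W x) + K x (V x) (Df W x w)"
proof -
  have "Df (\<lambda>y. K y (V y) (W y)) x w = Df (\<lambda>y. K y (V y) (W x)) x w + K x (V x) (Df W x w)"
    by (rule Df_linear_family[where L="\<lambda>x. K x (V x)", OF assms(1) bilinear_familyD(3)[OF assms(2)]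
      smooth_on_bilinear_family_left[OF assms(1-3)] assms(4,5)])
  also have "Df (\<lambda>y. K y (V y) (W x)) x w = Df (\<lambda>y. K y (V x) (W x)) x w + K x (Df V x w) (W x)"
    by (rule Df_linear_family[where L="\<lambda>y a. K y a (W x)", OF assms(1) bilinear_familyD(4)[OF assms(2)]
      bilinear_familyD(2)[OF assms(2)] assms(3,5)])
  finally show ?thesis .
qed

lemma bilinear_Df_family:
  assumes "open S" "bilinear_family S K" "x \<in> S"
  shows "bilinear (\<lambda>a b. Df (\<lambda>y. K y a b) x w)"
  unfolding bilinear_def
proof (intro conjI allI)
  show "linear (\<lambda>b. Df (\<lambda>y. K y a b) x w)" for a
    by (rule linear_Df_family[where L="\<lambda>y. K y a", OF assms(1) bilinear_familyD(3)[OF assms(2)]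
      bilinear_familyD(2)[OF assms(2)] assms(3)])
  show "linear (\<lambda>a. Df (\<lambda>y. K y a b) x w)" for b
    by (rule linear_Df_family[where L="\<lambda>y a. K y a b", OF assms(1) bilinear_familyD(4)[OF assms(2)]
      bilinear_familyD(2)[OF assms(2)] assms(3)])
qed

lemma Df_compose:
  fixes f :: "'e::euclidean_space \<Rightarrow> 'f::euclidean_space" and g :: "'f \<Rightarrow> 'v::real_normed_vector"
  assumes "smooth_on S f" "smooth_on T g" "f ` S \<subseteq> T" "x \<in> S"
  shows "Df (\<lambda>y. g (f y)) x = (\<lambda>v. Df g (f x) (Df f x v))"
  using Df_eq[OF diff_chain_at[OF smooth_on_has_derivative[OF assms(1,4)] smooth_on_has_derivative[OF assms(2), of "f x"]]]
    assms(3,4) by (auto simp: comp_def)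

lemma bilinear_family_compose:
  assumes "bilinear_family T K" "smooth_on S f" "open S" "open T" "f ` S \<subseteq> T"
  shows "bilinear_family S (\<lambda>x. K (f x))"
  unfolding bilinear_family_def
proof (intro conjI allI ballI)
  show "bilinear (K (f x))" if "x \<in> S" for x
    using bilinear_familyD(1)[OF assms(1)] assms(5) that by blast
  show "smooth_on S (\<lambda>x. K (f x) a b)" for a b
    by (rule smooth_on_compose[OF bilinear_familyD(2)[OF assms(1)] assms(2-5)])
qed

lemma smooth_on_deriv_along:
  assumes "open S" "smooth_on S f" "smooth_on S V"
  shows "smooth_on S (\<lambda>x. Df f x (V x))"
  by (rule smooth_on_linear_family[where L="Df f", OF assms(1) smooth_on_linear_Df[OF assms(2)]
      smooth_on_Df[OF assms(2)] assms(3)])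

lemma Df_deriv_along:
  assumes "open S" "smooth_on S f" "smooth_on S V" "x \<in> S"
  shows "Df (\<lambda>y. Df f y (V y)) x w = Df (\<lambda>y. Df f y (V x)) x w + Df f x (Df V x w)"
  by (rule Df_linear_family[where L="Df f", OF assms(1) smooth_on_linear_Df[OF assms(2)]
      smooth_on_Df[OF assms(2)] assms(3,4)])

subsection \<open>Symmetry of second derivatives\<close>

lemma smooth_on_line_derivative:
  fixes g :: "'e::euclidean_space \<Rightarrow> real"
  assumes "smooth_on S g" "c + a *\<^sub>R v \<in> S"
  shows "((\<lambda>a. g (c + a *\<^sub>R v)) has_real_derivative Df g (c + a *\<^sub>R v) v) (at a)"
proof -
  have "((\<lambda>a. c + a *\<^sub>R v) has_derivative (\<lambda>h. h *\<^sub>R v)) (at a)"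
    by (auto intro!: derivative_eq_intros)
  from diff_chain_at[OF this smooth_on_has_derivative[OF assms]]
  have "((\<lambda>a. g (c + a *\<^sub>R v)) has_derivative (\<lambda>h. Df g (c + a *\<^sub>R v) (h *\<^sub>R v))) (at a)"
    by (simp add: comp_def)
  moreover have "(\<lambda>h. Df g (c + a *\<^sub>R v) (h *\<^sub>R v)) = (*) (Df g (c + a *\<^sub>R v) v)"
    by (auto simp: linear_scale[OF smooth_on_linear_Df[OF assms]])
  ultimately show ?thesis
    by (simp add: has_field_derivative_def)
qed

text \<open>The mean value theorem is applied along \<open>v\<close> and then along
  \<open>w\<close>. The second difference on the left is symmetric in \<open>v\<close> and
  \<open>w\<close> while the right-hand side is not, and this is the source of the symmetry of
  second derivatives.\<close>

lemma mixed_difference: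
  fixes f :: "'e::euclidean_space \<Rightarrow> real"
  assumes f: "smooth_on (ball x r) f" and s: "0 < s" "s * (norm v + norm w) < r"
  shows "\<exists>y. norm (y - x) \<le> s * (norm v + norm w) \<and>
    f (x + s *\<^sub>R v + s *\<^sub>R w) - f (x + s *\<^sub>R v) - f (x + s *\<^sub>R w) + f x = s * (s * Df (\<lambda>y. Df f y v) y w)"
proof -
  have le: "norm (a *\<^sub>R v + b *\<^sub>R w) \<le> s * (norm v + norm w)" if "0 \<le> a" "a \<le> s" "0 \<le> b" "b \<le> s" for a b
  proof -
    have "norm (a *\<^sub>R v + b *\<^sub>R w) \<le> a * norm v + b * norm w"
      using norm_triangle_ineq[of "a *\<^sub>R v" "b *\<^sub>R w"] that by simp
    also have "\<dots> \<le> s * norm v + s * norm w"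
      by (intro add_mono mult_right_mono that) auto
    finally show ?thesis by (simp add: distrib_left)
  qed
  have inb: "x + a *\<^sub>R v + b *\<^sub>R w \<in> ball x r" if "0 \<le> a" "a \<le> s" "0 \<le> b" "b \<le> s" for a b
    using le[OF that] s(2) by (simp add: dist_norm norm_minus_commute add.assoc) (metis add.commute diff_add_cancel minus_diff_eq norm_minus_cancel add_diff_cancel_left' le_less_trans)
  have d1: "((\<lambda>a. f (x + a *\<^sub>R v + b *\<^sub>R w)) has_real_derivative Df f (x + a *\<^sub>R v + b *\<^sub>R w) v) (at a)"
    if "0 \<le> a" "a \<le> s" "0 \<le> b" "b \<le> s" for a b
    using smooth_on_line_derivative[OF f, of "x + b *\<^sub>R w" a v] inb[OF that] by (simp add: ac_simps)
  have "\<exists>a>0. a < s \<and> (f (x + s *\<^sub>R v + s *\<^sub>R w) - f (x + s *\<^sub>R v + 0 *\<^sub>R w)) - (f (x + 0 *\<^sub>R v + s *\<^sub>R w) - f (x + 0 *\<^sub>R v + 0 *\<^sub>R w))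
      = (s - 0) * (Df f (x + a *\<^sub>R v + s *\<^sub>R w) v - Df f (x + a *\<^sub>R v + 0 *\<^sub>R w) v)"
    by (rule MVT2[where f="\<lambda>a. f (x + a *\<^sub>R v + s *\<^sub>R w) - f (x + a *\<^sub>R v + 0 *\<^sub>R w)"
          and f'="\<lambda>a. Df f (x + a *\<^sub>R v + s *\<^sub>R w) v - Df f (x + a *\<^sub>R v + 0 *\<^sub>R w) v"])
      (use s(1) d1[where b=0] in \<open>auto intro!: DERIV_diff d1\<close>)
  then obtain a where a: "0 < a" "a < s"
    "f (x + s *\<^sub>R v + s *\<^sub>R w) - f (x + s *\<^sub>R v) - f (x + s *\<^sub>R w) + f x
      = s * (Df f (x + a *\<^sub>R v + s *\<^sub>R w) v - Df f (x + a *\<^sub>R v + 0 *\<^sub>R w) v)"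
    by auto
  have "((\<lambda>b. Df f (x + a *\<^sub>R v + b *\<^sub>R w) v) has_real_derivative Df (\<lambda>y. Df f y v) (x + a *\<^sub>R v + b *\<^sub>R w) w) (at b)"
    if "0 \<le> b" "b \<le> s" for b
    using smooth_on_line_derivative[OF smooth_on_Df[OF f], of "x + a *\<^sub>R v" b w v] inb[of a b] a that by simp
  then have "\<exists>b>0. b < s \<and> Df f (x + a *\<^sub>R v + s *\<^sub>R w) v - Df f (x + a *\<^sub>R v + 0 *\<^sub>R w) v
      = (s - 0) * Df (\<lambda>y. Df f y v) (x + a *\<^sub>R v + b *\<^sub>R w) w"
    by (intro MVT2[where f="\<lambda>b. Df f (x + a *\<^sub>R v + b *\<^sub>R w) v"
          and f'="\<lambda>b. Df (\<lambda>y. Df f y v) (x + a *\<^sub>R v + b *\<^sub>R w) w"] s(1))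
  then obtain b where b: "0 < b" "b < s" "Df f (x + a *\<^sub>R v + s *\<^sub>R w) v - Df f (x + a *\<^sub>R v + 0 *\<^sub>R w) v
      = s * Df (\<lambda>y. Df f y v) (x + a *\<^sub>R v + b *\<^sub>R w) w"
    by auto
  show ?thesis
    by (rule exI[of _ "x + a *\<^sub>R v + b *\<^sub>R w"]) (use a b le[of a b] in \<open>simp add: add.assoc\<close>)
qed

lemma second_derivative_symmetric_real:
  fixes f :: "'e::euclidean_space \<Rightarrow> real"
  assumes "open S" "smooth_on S f" "x \<in> S"
  shows "Df (\<lambda>y. Df f y v) x w = Df (\<lambda>y. Df f y w) x v"
proof (rule ccontr)
  define P where "P = (\<lambda>y. Df (\<lambda>y. Df f y v) y w)"
  define Q where "Q = (\<lambda>y. Df (\<lambda>y. Df f y w) y v)"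
  assume "\<not> ?thesis"
  then have ne: "P x \<noteq> Q x" by (simp add: P_def Q_def)
  obtain r where r: "0 < r" "ball x r \<subseteq> S" using assms openE by blast
  have f: "smooth_on (ball x r) f" by (rule smooth_on_subset[OF assms(2) r(2)])
  have "smooth_on (ball x r) P" "smooth_on (ball x r) Q"
    unfolding P_def Q_def by (rule smooth_on_Df, rule smooth_on_Df, rule f)+
  then have "isCont P x" "isCont Q x"
    using smooth_on_continuous continuous_on_eq_continuous_at[OF open_ball] r(1) centre_in_ball by metis+
  \<comment> \<open>Half of the gap: a common value \<open>P y = Q z\<close> cannot lie within
    \<open>e\<close> of both \<open>P x\<close> and \<open>Q x\<close>.\<close>
  moreover define e where "e = \<bar>P x - Q x\<bar> / 2"
  moreover have "e > 0" using ne by (simp add: e_def)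
  ultimately obtain d1 d2 where d: "d1 > 0" "\<And>y. dist y x < d1 \<Longrightarrow> dist (P y) (P x) < e"
     "d2 > 0" "\<And>y. dist y x < d2 \<Longrightarrow> dist (Q y) (Q x) < e"
    unfolding continuous_at by (metis continuous_at continuous_at_eps_delta)
  define m where "m = min r (min d1 d2)"
  \<comment> \<open>The summand 1 keeps the denominator positive when \<open>v\<close> and
    \<open>w\<close> are both 0, and it makes \<open>s * (norm v + norm w)\<close> strictly smaller
    than \<open>m\<close>.\<close>
  define s where "s = m / (norm v + norm w + 1)"
  have m: "m > 0" "m \<le> r" "m \<le> d1" "m \<le> d2" using r d by (auto simp: m_def)
  have pos: "norm v + norm w + 1 > 0" by (simp add: add_nonneg_pos)
  have s: "s > 0" using m pos by (simp add: s_def)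
  have sm: "s * (norm v + norm w) < m"
  proof -
    have "s * (norm v + norm w) < s * (norm v + norm w + 1)" using s by simp
    also have "\<dots> = m" using pos by (simp add: s_def)
    finally show ?thesis .
  qed
  obtain y where y: "norm (y - x) \<le> s * (norm v + norm w)"
    "f (x + s *\<^sub>R v + s *\<^sub>R w) - f (x + s *\<^sub>R v) - f (x + s *\<^sub>R w) + f x = s * (s * P y)"
    using mixed_difference[OF f s, of v w] sm m(2) unfolding P_def by auto
  obtain z where z: "norm (z - x) \<le> s * (norm v + norm w)"
    "f (x + s *\<^sub>R w + s *\<^sub>R v) - f (x + s *\<^sub>R w) - f (x + s *\<^sub>R v) + f x = s * (s * Q z)"
    using mixed_difference[OF f s, of w v] sm m(2) unfolding Q_def by (auto simp: add.commute)
  have "s * (s * P y) = s * (s * Q z)"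
  proof -
    have eq: "x + s *\<^sub>R w + s *\<^sub>R v = x + s *\<^sub>R v + s *\<^sub>R w" by simp
    show ?thesis using y(2) z(2)[unfolded eq] by linarith
  qed
  then have "P y = Q z" using s by simp
  moreover have "dist (P y) (P x) < e" "dist (Q z) (Q x) < e"
    using y(1) z(1) sm m d(2)[of y] d(4)[of z] by (simp_all add: dist_norm)
  ultimately show False
    by (auto simp: e_def dist_real_def abs_if split: if_splits)
qed

lemma Df_inner_left:
  assumes "smooth_on S f" "x \<in> S"
  shows "Df (\<lambda>y. f y \<bullet> u) x v = Df f x v \<bullet> u"
  using Df_eq[OF has_derivative_inner_left[OF smooth_on_has_derivative[OF assms]]] by metis

lemma second_derivative_symmetric:
  fixes f :: "'e::euclidean_space \<Rightarrow> 'f::euclidean_space"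
  assumes "open S" "smooth_on S f" "x \<in> S"
  shows "Df (\<lambda>y. Df f y v) x w = Df (\<lambda>y. Df f y w) x v"
proof (rule euclidean_eqI)
  fix u :: 'f
  have *: "Df (\<lambda>y. Df f y v) x w \<bullet> u = Df (\<lambda>y. Df (\<lambda>y. f y \<bullet> u) y v) x w" for v w
  proof -
    have "Df (\<lambda>y. Df (\<lambda>y. f y \<bullet> u) y v) x = Df (\<lambda>y. Df f y v \<bullet> u) x"
      by (rule Df_cong_open[OF assms(1,3)]) (rule Df_inner_left[OF assms(2)])
    then show ?thesis
      using Df_inner_left[OF smooth_on_Df[OF assms(2), of v] assms(3), of u w] by simp
  qed
  have "smooth_on S (\<lambda>y. f y \<bullet> u)"
    by (rule smooth_on_linear[OF assms(2,1) bounded_linear_inner_left])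
  then show "Df (\<lambda>y. Df f y v) x w \<bullet> u = Df (\<lambda>y. Df f y w) x v \<bullet> u"
    unfolding * by (rule second_derivative_symmetric_real[OF assms(1) _ assms(3)])
qed

subsection \<open>Bump functions\<close>

text \<open>\<open>flat 0\<close> is the classical smooth function that is flat at 0. The powers of
  \<open>inverse t\<close> are included because differentiation produces them: each derivative is a
  linear combination of members of the same family, so smoothness follows by induction for all
  \<open>n\<close> at once.\<close>

definition flat :: "nat \<Rightarrow> real \<Rightarrow> real" where
  "flat n t = (if t > 0 then inverse t ^ n * exp (- inverse t) else 0)"

lemma flat_tendsto_0: "(flat n \<longlongrightarrow> 0) (at 0)"
proof -
  have "((\<lambda>t::real. inverse t ^ n / exp (inverse t)) \<longlongrightarrow> 0) (at_right 0)"
    by (rule filterlim_compose[OF tendsto_power_div_exp_0 filterlim_inverse_at_top_right])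
  then have "(flat n \<longlongrightarrow> 0) (at_right 0)"
    by (rule Lim_transform_eventually)
      (auto simp: flat_def exp_minus divide_inverse eventually_at_right_field intro!: exI[of _ 1])
  moreover have "(flat n \<longlongrightarrow> 0) (at_left 0)"
    by (rule Lim_transform_eventually[OF tendsto_const])
      (auto simp: flat_def eventually_at_left_field intro!: exI[of _ "-1"])
  ultimately show ?thesis by (simp add: filterlim_at_split)
qed

lemma flat_has_derivative:
  "(flat n has_real_derivative flat (n + 2) t - of_nat n * flat (n + 1) t) (at t)"
proof -
  consider "t > 0" | "t < 0" | "t = 0" by linarith
  then show ?thesis
  proof cases
    case 1
    have "((\<lambda>t::real. inverse t ^ n * exp (- inverse t)) has_real_derivative
        flat (n + 2) t - of_nat n * flat (n + 1) t) (at t)"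
      using 1
      by (cases n) (auto intro!: derivative_eq_intros simp: flat_def algebra_simps power2_eq_square,
        metis One_nat_def power_eq_if)
    then show ?thesis
      by (rule has_field_derivative_transform_within_open[where S="{0<..}"]) (use 1 in \<open>auto simp: flat_def\<close>)
  next
    case 2
    have "((\<lambda>t::real. 0) has_real_derivative flat (n + 2) t - of_nat n * flat (n + 1) t) (at t)"
      using 2 by (auto simp: flat_def)
    then show ?thesis
      by (rule has_field_derivative_transform_within_open[where S="{..<0}"]) (use 2 in \<open>auto simp: flat_def\<close>)
  next
    case 3
    \<comment> \<open>The factor \<open>inverse h\<close> of the difference quotient at 0 raises the
      power by one, so the quotient is \<open>flat (Suc n) h\<close>.\<close>
    have "((\<lambda>h. (flat n (0 + h) - flat n 0) / h) \<longlongrightarrow> 0) (at 0)"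
      by (rule Lim_transform_eventually[OF flat_tendsto_0[of "Suc n"]])
        (auto simp: flat_def eventually_at_filter divide_inverse)
    then show ?thesis
      using 3 by (simp add: DERIV_def flat_def)
  qed
qed

lemma Ck_on_flat: "Ck_on k UNIV (flat n)"
proof (induction k arbitrary: n)
  case 0
  have "continuous_on UNIV (flat n)"
    by (rule DERIV_continuous_on) (rule flat_has_derivative)
  then show ?case by simp
next
  case (Suc k)
  show ?case
  proof (rule Ck_on_SucI)
    show "(flat n has_derivative (\<lambda>v. flat (n + 2) t * v + flat (n + 1) t * (- of_nat n * v))) (at t)" for t
    proof -
      have "(*) (flat (n + 2) t - of_nat n * flat (n + 1) t) =
          (\<lambda>v. flat (n + 2) t * v + flat (n + 1) t * (- of_nat n * v))"
        by (auto simp: algebra_simps)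
      then show ?thesis
        using flat_has_derivative[of n t] unfolding has_field_derivative_def by metis
    qed
    show "Ck_on k UNIV (\<lambda>t. flat (n + 2) t * v + flat (n + 1) t * (- of_nat n * v))" for v
      by (rule Ck_on_add; (rule Ck_on_linear[OF bounded_linear_mult_left])?) (rule Suc.IH open_UNIV)+
  qed simp
qed

lemma smooth_bump:
  fixes a :: "'e::euclidean_space"
  assumes "r > 0"
  obtains \<beta> :: "'e \<Rightarrow> real" where "smooth_on UNIV \<beta>" "\<beta> a = 1" "\<And>x. r \<le> norm (x - a) \<Longrightarrow> \<beta> x = 0"
proof -
  \<comment> \<open>The squared distance is used because it is smooth at \<open>a\<close>; dividing
    by \<open>flat 0 (r\<^sup>2)\<close> normalises the value at \<open>a\<close> to 1.\<close>
  define \<beta> where "\<beta> x = flat 0 (r\<^sup>2 - (x - a) \<bullet> (x - a)) * inverse (flat 0 (r\<^sup>2))" for x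
  have d: "smooth_on UNIV (\<lambda>x. x - a)"
    by (rule smooth_on_diff[OF smooth_on_ident smooth_on_const]) auto
  have q: "smooth_on UNIV (\<lambda>x. r\<^sup>2 - (x - a) \<bullet> (x - a))"
    by (rule smooth_on_diff[OF smooth_on_const smooth_on_bilinear[OF bounded_bilinear_inner d d]]) auto
  have fl: "smooth_on UNIV (flat 0)" unfolding smooth_on_def by (intro allI Ck_on_flat)
  have "smooth_on UNIV \<beta>"
    unfolding \<beta>_def
    by (rule smooth_on_linear[OF smooth_on_compose[OF fl q] _ bounded_linear_mult_left]) auto
  moreover have "\<beta> a = 1" using assms by (simp add: \<beta>_def flat_def)
  moreover have "\<beta> x = 0" if "r \<le> norm (x - a)" for x
  proof -
    have "r\<^sup>2 \<le> (x - a) \<bullet> (x - a)"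
      using power_mono[OF that, of 2] assms by (simp add: power2_norm_eq_inner)
    then show ?thesis by (simp add: \<beta>_def flat_def)
  qed
  ultimately show thesis by (rule that)
qed

subsection \<open>Inner products and orthonormal families\<close>

locale inner_form =
  fixes g :: "'e::euclidean_space \<Rightarrow> 'e \<Rightarrow> real"
  assumes bil: "bilinear g" and sym: "g a b = g b a" and pos: "a \<noteq> 0 \<Longrightarrow> g a a > 0"
begin

lemmas g_simps = bilinear_ladd[OF bil] bilinear_radd[OF bil] bilinear_lmul[OF bil] bilinear_rmul[OF bil]
  bilinear_lsub[OF bil] bilinear_rsub[OF bil] bilinear_lneg[OF bil] bilinear_rneg[OF bil]
  bilinear_lzero[OF bil] bilinear_rzero[OF bil]

lemma linear_g: "linear (g a)" "linear (\<lambda>a. g a b)"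
  using bil by (auto simp: bilinear_def)

lemma g_sum_left: "g (\<Sum>i\<in>I. f i) b = (\<Sum>i\<in>I. g (f i) b)"
  using linear_sum[OF linear_g(2)] .

lemma g_sum_right: "g a (\<Sum>i\<in>I. f i) = (\<Sum>i\<in>I. g a (f i))"
  using linear_sum[OF linear_g(1)] .

lemma g_eq_0: "g a a = 0 \<longleftrightarrow> a = 0"
  using pos[of a] g_simps(9)[of a] by (cases "a = 0") auto

lemma g_eqI: "(\<And>c. g a c = g b c) \<Longrightarrow> a = b"
  using g_eq_0[of "a - b"] by (simp add: g_simps)

definition ortho :: "(nat \<Rightarrow> 'e) \<Rightarrow> nat \<Rightarrow> bool" where
  "ortho b n \<longleftrightarrow> (\<forall>i<n. \<forall>j<n. g (b i) (b j) = (if i = j then 1 else 0))"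

lemma ortho_D: "ortho b n \<Longrightarrow> i < n \<Longrightarrow> j < n \<Longrightarrow> g (b i) (b j) = (if i = j then 1 else 0)"
  by (auto simp: ortho_def)

lemma g_ortho_sum:
  assumes "ortho b n" "j < n"
  shows "g (\<Sum>i<n. c i *\<^sub>R b i) (b j) = c j"
proof -
  have "g (\<Sum>i<n. c i *\<^sub>R b i) (b j) = (\<Sum>i<n. if i = j then c i else 0)"
    unfolding g_sum_left by (rule sum.cong) (auto simp: g_simps ortho_D[OF assms(1) _ assms(2)])
  then show ?thesis using assms(2) by simp
qed

text \<open>The linear map \<open>L\<close> that sends the standard basis to \<open>b\<close> is
  injective, since pairing with \<open>b j\<close> recovers the coordinates. Equal dimensions make
  it surjective, and the same pairing identifies the coefficients.\<close>

lemma ortho_expand: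
  assumes "ortho b DIM('e)"
  shows "a = (\<Sum>i<DIM('e). g a (b i) *\<^sub>R b i)"
proof -
  obtain B :: "nat \<Rightarrow> 'e" where B: "bij_betw B {0..<DIM('e)} Basis"
    using ex_bij_betw_nat_finite[OF finite_Basis] by blast
  define L where "L x = (\<Sum>i<DIM('e). (x \<bullet> B i) *\<^sub>R b i)" for x :: 'e
  have lin: "linear L"
    by (rule linearI) (auto simp: L_def inner_add_left algebra_simps sum.distrib scaleR_sum_right)
  have "x = 0" if "L x = 0" for x
  proof -
    have "x \<bullet> u = 0" if "u \<in> Basis" for u
    proof -
      have "u \<in> B ` {0..<DIM('e)}" using B that by (simp add: bij_betw_def)
      then obtain j where "j < DIM('e)" "u = B j" by auto
      then show ?thesis
        using g_ortho_sum[OF assms, of j "\<lambda>i. x \<bullet> B i"] \<open>L x = 0\<close> by (simp add: L_def g_simps)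
    qed
    then show ?thesis by (metis euclidean_all_zero_iff)
  qed
  then have "inj L" using linear_injective_0[OF lin] by auto
  then have "surj L" by (rule linear_injective_imp_surjective[OF lin]) simp
  then obtain x where x: "a = L x" by (metis surjD)
  have "g a (b j) = x \<bullet> B j" if "j < DIM('e)" for j
    using g_ortho_sum[OF assms that] by (simp add: x L_def)
  then show ?thesis by (simp add: x L_def)
qed

lemma ortho_norm:
  assumes "ortho b DIM('e)"
  shows "g a c = (\<Sum>i<DIM('e). g a (b i) * g c (b i))"
  by (subst ortho_expand[OF assms, of a]) (simp add: g_sum_left g_simps sym[of "b _" c])

lemma ortho_eqI:
  assumes "ortho b DIM('e)" "\<And>i. i < DIM('e) \<Longrightarrow> g a (b i) = g c (b i)"
  shows "a = c"
  using ortho_expand[OF assms(1), of a] ortho_expand[OF assms(1), of c] assms(2) by simp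

text \<open>Expanding each basis in the other one turns both traces into the same double sum. This
  frees \<open>tension\<close> and \<open>ricci_transform\<close> from the frames and bases that
  they choose.\<close>

lemma trace_independent:
  fixes Q :: "'e \<Rightarrow> 'e \<Rightarrow> 'v::real_vector"
  assumes b: "ortho b DIM('e)" and c: "ortho c DIM('e)" and Q: "\<And>a. linear (Q a)" "\<And>b. linear (\<lambda>a. Q a b)"
  shows "(\<Sum>i<DIM('e). Q (b i) (b i)) = (\<Sum>i<DIM('e). Q (c i) (c i))"
proof -
  have "(\<Sum>i<DIM('e). Q (b i) (b i)) = (\<Sum>i<DIM('e). Q (b i) (\<Sum>j<DIM('e). g (b i) (c j) *\<^sub>R c j))"
    by (metis ortho_expand[OF c])
  also have "\<dots> = (\<Sum>i<DIM('e). \<Sum>j<DIM('e). g (b i) (c j) *\<^sub>R Q (b i) (c j))"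
    by (simp add: linear_sum[OF Q(1)] linear_scale[OF Q(1)])
  also have "\<dots> = (\<Sum>j<DIM('e). \<Sum>i<DIM('e). g (b i) (c j) *\<^sub>R Q (b i) (c j))"
    by (rule sum.swap)
  also have "\<dots> = (\<Sum>j<DIM('e). Q (\<Sum>i<DIM('e). g (c j) (b i) *\<^sub>R b i) (c j))"
    by (simp add: linear_sum[OF Q(2)] linear_scale[OF Q(2)] sym[of "c _" "b _"])
  also have "\<dots> = (\<Sum>j<DIM('e). Q (c j) (c j))"
    by (metis ortho_expand[OF b])
  finally show ?thesis .
qed

end

subsection \<open>Riemannian metrics on open subsets of Euclidean space\<close>

locale local_metric =
  fixes S :: "'e::euclidean_space set" and G :: "'e \<Rightarrow> 'e \<Rightarrow> 'e \<Rightarrow> real"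
  assumes open_S: "open S" and family: "bilinear_family S G"
    and G_sym: "x \<in> S \<Longrightarrow> G x a b = G x b a" and G_pos: "x \<in> S \<Longrightarrow> a \<noteq> 0 \<Longrightarrow> G x a a > 0"
begin

lemma inner_form: "x \<in> S \<Longrightarrow> inner_form (G x)"
  using bilinear_familyD[OF family] G_sym G_pos by unfold_locales

lemma smooth_G: "smooth_on S V \<Longrightarrow> smooth_on S W \<Longrightarrow> smooth_on S (\<lambda>x. G x (V x) (W x))"
  by (rule smooth_on_bilinear_family[OF open_S family])

text \<open>The span condition is carried through the induction to guarantee
  \<open>u x \<noteq> 0\<close>: otherwise \<open>B n\<close> would lie in the span of other basis
  vectors.\<close>

lemma gram_schmidt_step:
  assumes B: "bij_betw B {0..<DIM('e)} (Basis::'e set)" and n: "n < DIM('e)"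
    and E: "\<And>i. i < n \<Longrightarrow> smooth_on S (E i)" "\<And>x. x \<in> S \<Longrightarrow> inner_form.ortho (G x) (\<lambda>i. E i x) n"
      "\<And>i x. i < n \<Longrightarrow> x \<in> S \<Longrightarrow> E i x \<in> span (B ` {..<n})"
  shows "\<exists>F. smooth_on S F \<and> (\<forall>x\<in>S. G x (F x) (F x) = 1 \<and> (\<forall>i<n. G x (F x) (E i x) = 0) \<and>
    F x \<in> span (B ` {..<Suc n}))"
proof -
  define u where "u x = B n - (\<Sum>i<n. G x (B n) (E i x) *\<^sub>R E i x)" for x
  define F where "F x = (G x (u x) (u x)) powr (-1/2) *\<^sub>R u x" for x
  have smooth_u: "smooth_on S u"
    unfolding u_def
    by (rule smooth_on_diff[OF smooth_on_const smooth_on_sum[OF smooth_on_scaleR[OF smooth_G[OF smooth_on_const]]]])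
      (use E open_S in auto)
  have span_le: "span (B ` {..<n}) \<subseteq> span (B ` {..<Suc n})" by (rule span_mono) auto
  have u0: "u x \<noteq> 0" if x: "x \<in> S" for x
  proof
    assume "u x = 0"
    then have "B n = (\<Sum>i<n. G x (B n) (E i x) *\<^sub>R E i x)" by (simp add: u_def)
    also have "\<dots> \<in> span (B ` {..<n})"
      by (rule span_sum, rule span_scale, rule E(3)) (use x in auto)
    also have "\<dots> \<subseteq> span (Basis - {B n})"
    proof (rule span_mono)
      have "B i \<in> Basis - {B n}" if "i < n" for i
        using inj_onD[OF bij_betw_imp_inj_on[OF B], of i n] bij_betw_apply[OF B, of i] n that by auto
      then show "B ` {..<n} \<subseteq> Basis - {B n}" by auto
    qed
    finally have "dependent (Basis::'e set)"
      using B n by (auto simp: dependent_def bij_betw_def)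
    then show False using independent_Basis by blast
  qed
  have u_pos: "G x (u x) (u x) > 0" if "x \<in> S" for x
    using G_pos[OF that u0[OF that]] .
  have "smooth_on S (\<lambda>x. (G x (u x) (u x)) powr (-1/2))"
    by (rule smooth_on_compose[OF smooth_on_powr smooth_G[OF smooth_u smooth_u] open_S]) (use u_pos in auto)
  then have "smooth_on S F"
    unfolding F_def by (rule smooth_on_scaleR[OF _ smooth_u open_S])
  moreover have "G x (F x) (F x) = 1 \<and> (\<forall>i<n. G x (F x) (E i x) = 0) \<and> F x \<in> span (B ` {..<Suc n})"
    if x: "x \<in> S" for x
  proof (intro conjI allI impI)
    interpret inner_form "G x" by (rule inner_form[OF x])
    have "G x (F x) (F x) = (G x (u x) (u x) powr (-1/2) * G x (u x) (u x) powr (-1/2)) * G x (u x) (u x)"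
      by (simp add: F_def g_simps)
    also have "\<dots> = G x (u x) (u x) powr (-1/2 + -1/2) * G x (u x) (u x)"
      by (simp only: powr_add)
    also have "\<dots> = 1"
      using u_pos[OF x] by (simp add: powr_minus)
    finally show "G x (F x) (F x) = 1" .
    show "G x (F x) (E i x) = 0" if "i < n" for i
      using g_ortho_sum[OF E(2)[OF x] that, of "\<lambda>i. G x (B n) (E i x)"]
      by (simp add: F_def u_def g_simps)
    have "B n \<in> span (B ` {..<Suc n})" by (rule span_base) auto
    moreover have "(\<Sum>i<n. G x (B n) (E i x) *\<^sub>R E i x) \<in> span (B ` {..<Suc n})"
      by (rule span_sum, rule span_scale) (use x E(3) span_le in auto)
    ultimately show "F x \<in> span (B ` {..<Suc n})"
      unfolding F_def u_def by (intro span_scale span_diff)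
  qed
  ultimately show ?thesis by blast
qed

lemma smooth_orthonormal_frame:
  obtains E where "\<And>i. i < DIM('e) \<Longrightarrow> smooth_on S (E i)"
    "\<And>x. x \<in> S \<Longrightarrow> inner_form.ortho (G x) (\<lambda>i. E i x) DIM('e)"
proof -
  obtain B :: "nat \<Rightarrow> 'e" where B: "bij_betw B {0..<DIM('e)} Basis"
    using ex_bij_betw_nat_finite[OF finite_Basis] by blast
  have "\<exists>E. (\<forall>i<n. smooth_on S (E i)) \<and> (\<forall>x\<in>S. inner_form.ortho (G x) (\<lambda>i. E i x) n) \<and>
      (\<forall>i<n. \<forall>x\<in>S. E i x \<in> span (B ` {..<n}))" if "n \<le> DIM('e)" for n
    using that
  proof (induction n)
    case 0
    then show ?case by (auto simp: inner_form.ortho_def[OF inner_form])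
  next
    case (Suc n)
    then have "n \<le> DIM('e)" by simp
    from Suc.IH[OF this] obtain E where E0: "(\<forall>i<n. smooth_on S (E i)) \<and>
      (\<forall>x\<in>S. inner_form.ortho (G x) (\<lambda>i. E i x) n) \<and> (\<forall>i<n. \<forall>x\<in>S. E i x \<in> span (B ` {..<n}))"
      by (elim exE)
    then have E: "\<And>i. i < n \<Longrightarrow> smooth_on S (E i)"
      "\<And>x. x \<in> S \<Longrightarrow> inner_form.ortho (G x) (\<lambda>i. E i x) n"
      "\<And>i x. i < n \<Longrightarrow> x \<in> S \<Longrightarrow> E i x \<in> span (B ` {..<n})"
      by simp_all
    obtain F where F: "smooth_on S F" "\<And>x. x \<in> S \<Longrightarrow> G x (F x) (F x) = 1"
      "\<And>x i. x \<in> S \<Longrightarrow> i < n \<Longrightarrow> G x (F x) (E i x) = 0"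
      "\<And>x. x \<in> S \<Longrightarrow> F x \<in> span (B ` {..<Suc n})"
      using gram_schmidt_step[OF B _ E] Suc.prems by auto
    have le: "span (B ` {..<n}) \<subseteq> span (B ` {..<Suc n})" by (rule span_mono) auto
    show ?case
    proof (intro exI[of _ "\<lambda>i. if i < n then E i else F"] conjI allI impI ballI)
      show "smooth_on S (if i < n then E i else F)" for i using E F by auto
      show "inner_form.ortho (G x) (\<lambda>i. (if i < n then E i else F) x) (Suc n)" if x: "x \<in> S" for x
        using E(2)[OF x] F(2,3)[OF x] G_sym[OF x]
        by (auto simp: inner_form.ortho_def[OF inner_form[OF x]] less_Suc_eq)
      show "(if i < n then E i else F) x \<in> span (B ` {..<Suc n})" if "i < Suc n" "x \<in> S" for i x
        using E(3)[OF _ that(2)] F(4)[OF that(2)] le by auto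
    qed
  qed
  from this[of "DIM('e)"] that show thesis by auto
qed

section \<open>Existence and uniqueness of the Levi-Civita connection in coordinates\<close>

definition dG :: "'e \<Rightarrow> 'e \<Rightarrow> 'e \<Rightarrow> 'e \<Rightarrow> real" where
  "dG x w a b = Df (\<lambda>y. G y a b) x w"

lemma linear_dG:
  assumes "x \<in> S"
  shows "linear (\<lambda>w. dG x w a b)" "linear (\<lambda>a. dG x w a b)" "linear (\<lambda>b. dG x w a b)"
  using bilinear_Df_family[OF open_S family assms] smooth_on_linear_Df[OF bilinear_familyD(2)[OF family] assms]
  by (auto simp: dG_def bilinear_def)

lemma dG_sym: "x \<in> S \<Longrightarrow> dG x w a b = dG x w b a"
  unfolding dG_def by (rule fun_cong[OF Df_cong_open[OF open_S]]) (auto intro: G_sym)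

definition is_levi_civita :: "'e \<Rightarrow> ('e \<Rightarrow> 'e \<Rightarrow> 'e) \<Rightarrow> bool" where
  "is_levi_civita x \<Gamma> \<longleftrightarrow> (\<forall>a b. \<Gamma> a b = \<Gamma> b a) \<and>
     (\<forall>w a b. dG x w a b = G x (\<Gamma> w a) b + G x a (\<Gamma> w b))"

text \<open>In the alternating sum of the three derivatives of the metric, symmetry of
  \<open>\<Gamma>\<close> cancels all but two equal terms. Hence \<open>\<Gamma>\<close> is
  determined by the metric.\<close>

lemma koszul:
  assumes x: "x \<in> S" and \<Gamma>: "is_levi_civita x \<Gamma>"
  shows "2 * G x (\<Gamma> a b) c = dG x a b c + dG x b a c - dG x c a b"
proof -
  have s: "\<Gamma> a b = \<Gamma> b a" for a b using \<Gamma> by (auto simp: is_levi_civita_def)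
  have m: "dG x w a b = G x (\<Gamma> w a) b + G x a (\<Gamma> w b)" for w a b
    using \<Gamma> by (auto simp: is_levi_civita_def)
  show ?thesis
    unfolding m using G_sym[OF x, of "\<Gamma> b a" c] G_sym[OF x, of "\<Gamma> b c" a] G_sym[OF x, of "\<Gamma> c a" b]
      G_sym[OF x, of "\<Gamma> a c" b] s[of a b] s[of a c] s[of b c] by simp
qed

lemma levi_civita_unique:
  assumes "x \<in> S" "is_levi_civita x \<Gamma>" "is_levi_civita x \<Delta>"
  shows "\<Gamma> = \<Delta>"
proof (intro ext)
  fix a b
  interpret inner_form "G x" by (rule inner_form[OF assms(1)])
  show "\<Gamma> a b = \<Delta> a b"
    by (rule g_eqI) (use koszul[OF assms(1,2), of a b] koszul[OF assms(1,3), of a b] in \<open>metis mult_cancel_left zero_neq_numeral\<close>)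
qed

text \<open>The Koszul formula is taken as the definition: the functional \<open>K x a b / 2\<close>
  is represented by a vector through a smooth orthonormal frame. In this way smoothness of the
  symbols needs no inversion of the metric matrix.\<close>

lemma levi_civita_exists:
  obtains \<Gamma> where "bilinear_family S \<Gamma>" "\<And>x. x \<in> S \<Longrightarrow> is_levi_civita x (\<Gamma> x)"
proof -
  obtain E where E: "\<And>i. i < DIM('e) \<Longrightarrow> smooth_on S (E i)"
    "\<And>x. x \<in> S \<Longrightarrow> inner_form.ortho (G x) (\<lambda>i. E i x) DIM('e)"
    by (rule smooth_orthonormal_frame) (rule that)
  define K where "K x a b c = dG x a b c + dG x b a c - dG x c a b" for x a b c
  define \<Gamma> where "\<Gamma> x a b = (\<Sum>i<DIM('e). (K x a b (E i x) / 2) *\<^sub>R E i x)" for x a b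
  have K_add: "K x (a + a') b c = K x a b c + K x a' b c" "K x a (b + b') c = K x a b c + K x a b' c"
    "K x (r *\<^sub>R a) b c = r * K x a b c" "K x a (r *\<^sub>R b) c = r * K x a b c" if "x \<in> S" for x a a' b b' c r
    by (simp_all add: K_def linear_add[OF linear_dG(1)[OF that]] linear_add[OF linear_dG(2)[OF that]]
       linear_add[OF linear_dG(3)[OF that]] linear_scale[OF linear_dG(1)[OF that]]
       linear_scale[OF linear_dG(2)[OF that]] linear_scale[OF linear_dG(3)[OF that]] algebra_simps)
  have K_lin: "linear (K x a b)" if "x \<in> S" for x a b
    by (rule linearI) (simp_all add: K_def linear_add[OF linear_dG(1)[OF that]] linear_add[OF linear_dG(2)[OF that]]
       linear_add[OF linear_dG(3)[OF that]] linear_scale[OF linear_dG(1)[OF that]]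
       linear_scale[OF linear_dG(2)[OF that]] linear_scale[OF linear_dG(3)[OF that]] algebra_simps)
  have K_sym: "K x a b c = K x b a c" if "x \<in> S" for x a b c
    using dG_sym[OF that, of c a b] by (simp add: K_def)
  have K_smooth: "smooth_on S (\<lambda>x. K x a b c)" for a b c
    unfolding K_def dG_def
    by (rule smooth_on_diff[OF smooth_on_add]) (rule smooth_on_Df bilinear_familyD(2)[OF family] open_S)+
  have "bilinear_family S \<Gamma>"
    unfolding bilinear_family_def
  proof (intro conjI ballI allI)
    show "bilinear (\<Gamma> x)" if "x \<in> S" for x
      unfolding bilinear_def
      by (intro conjI allI linearI) (simp_all add: \<Gamma>_def K_add[OF that] add_divide_distrib scaleR_left_distrib
        sum.distrib scaleR_sum_right)
    show "smooth_on S (\<lambda>x. \<Gamma> x a b)" for a b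
      unfolding \<Gamma>_def
    proof (rule smooth_on_sum[OF _ open_S], rule smooth_on_scaleR[OF _ _ open_S])
      fix i assume "i \<in> {..<DIM('e)}"
      then show Ei: "smooth_on S (E i)" using E by auto
      have "smooth_on S (\<lambda>x. K x a b (E i x))"
        by (rule smooth_on_linear_family[where L="\<lambda>x. K x a b" and V="E i"]) (rule open_S K_lin K_smooth Ei | assumption)+
      then show "smooth_on S (\<lambda>x. K x a b (E i x) / 2)"
        by (rule smooth_on_linear[OF _ open_S bounded_linear_divide])
    qed
  qed
  moreover have "is_levi_civita x (\<Gamma> x)" if x: "x \<in> S" for x
  proof -
    interpret inner_form "G x" by (rule inner_form[OF x])
    have *: "G x (\<Gamma> x a b) c = K x a b c / 2" for a b c
    proof -
      have "G x (\<Gamma> x a b) c = (\<Sum>i<DIM('e). g' i) " if "g' = (\<lambda>i. K x a b (E i x) / 2 * G x (E i x) c)" for g'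
        by (simp add: \<Gamma>_def g_sum_left g_simps that)
      moreover have "K x a b c = (\<Sum>i<DIM('e). G x c (E i x) * K x a b (E i x))"
        by (subst ortho_expand[OF E(2)[OF x], of c])
          (simp add: linear_sum[OF K_lin[OF x]] linear_scale[OF K_lin[OF x]])
      ultimately show ?thesis
        by (simp add: sum_divide_distrib sym[of "E _ x" c] mult.commute)
    qed
    have "\<Gamma> x a b = \<Gamma> x b a" for a b by (simp add: \<Gamma>_def K_sym[OF x, of a b])
    moreover have "dG x w a b = G x (\<Gamma> x w a) b + G x a (\<Gamma> x w b)" for w a b
      unfolding sym[of a "\<Gamma> x w b"] * K_def using dG_sym[OF x, of w a b] by (simp add: field_simps)
    ultimately show ?thesis
      unfolding is_levi_civita_def by blast
  qed
  ultimately show thesis by (rule that)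
qed

text \<open>Built like the global \<open>christoffel\<close>, so that in a chart the two agree by
  unfolding.\<close>

definition chr :: "'e \<Rightarrow> 'e \<Rightarrow> 'e \<Rightarrow> 'e" where
  "chr x = (THE \<Gamma>. is_levi_civita x \<Gamma>)"

lemma chr_eqI: "x \<in> S \<Longrightarrow> is_levi_civita x \<Gamma> \<Longrightarrow> chr x = \<Gamma>"
  unfolding chr_def by (rule the_equality) (auto intro: levi_civita_unique)

lemma chr_levi_civita: "x \<in> S \<Longrightarrow> is_levi_civita x (chr x)"
  by (metis levi_civita_exists chr_eqI)

lemma chr_sym: "x \<in> S \<Longrightarrow> chr x a b = chr x b a"
  using chr_levi_civita by (auto simp: is_levi_civita_def)

lemma chr_metric: "x \<in> S \<Longrightarrow> dG x w a b = G x (chr x w a) b + G x a (chr x w b)"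
  using chr_levi_civita by (auto simp: is_levi_civita_def)

lemma chr_family: "bilinear_family S chr"
proof -
  obtain \<Gamma> where \<Gamma>: "bilinear_family S \<Gamma>" "\<And>x. x \<in> S \<Longrightarrow> is_levi_civita x (\<Gamma> x)"
    by (rule levi_civita_exists) (rule that)
  then have eq: "\<And>x. x \<in> S \<Longrightarrow> \<Gamma> x = chr x" using chr_eqI by metis
  have "smooth_on S (\<lambda>x. chr x a b)" for a b
    by (rule smooth_on_cong[OF bilinear_familyD(2)[OF \<Gamma>(1), of a b] open_S]) (simp add: eq)
  then show ?thesis
    using bilinear_familyD(1)[OF \<Gamma>(1)] eq unfolding bilinear_family_def by metis
qed

end

lemma local_metric_subset:
  assumes "local_metric S G" "open S'" "S' \<subseteq> S"
  shows "local_metric S' G"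
proof -
  interpret local_metric S G by (rule assms(1))
  show ?thesis
  proof
    show "bilinear_family S' G"
      using family smooth_on_subset[OF bilinear_familyD(2)[OF family] assms(3)] assms(3)
      unfolding bilinear_family_def by blast
  qed (use assms G_sym G_pos in blast)+
qed

subsection \<open>Covariant derivatives along a map\<close>

text \<open>One setting for two connections: with \<open>F\<close> the identity, \<open>cd\<close>
  is the Levi-Civita derivative, and with \<open>F\<close> a coordinate representation of a map
  between manifolds it is the induced connection on the pull-back bundle.\<close>

locale along_map = N: local_metric T H
  for T :: "'f::euclidean_space set" and H +
  fixes S :: "'e::euclidean_space set" and F :: "'e \<Rightarrow> 'f"
  assumes open_dom: "open S" and smooth_F: "smooth_on S F" and F_into: "F ` S \<subseteq> T"
begin

lemma F_in: "x \<in> S \<Longrightarrow> F x \<in> T"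
  using F_into by blast

lemma inner_F: "x \<in> S \<Longrightarrow> inner_form (H (F x))"
  by (rule N.inner_form[OF F_in])

lemma H_family: "bilinear_family S (\<lambda>x. H (F x))"
  by (rule bilinear_family_compose[OF N.family smooth_F open_dom N.open_S F_into])

lemma chr_F_family: "bilinear_family S (\<lambda>x. N.chr (F x))"
  by (rule bilinear_family_compose[OF N.chr_family smooth_F open_dom N.open_S F_into])

lemma linear_DF: "x \<in> S \<Longrightarrow> linear (Df F x)"
  by (rule smooth_on_linear_Df[OF smooth_F])

lemma smooth_DF: "smooth_on S X \<Longrightarrow> smooth_on S (\<lambda>x. Df F x (X x))"
  by (rule smooth_on_deriv_along[OF open_dom smooth_F])

definition cd :: "('e \<Rightarrow> 'f) \<Rightarrow> 'e \<Rightarrow> 'e \<Rightarrow> 'f" where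
  "cd V x a = Df V x a + N.chr (F x) (Df F x a) (V x)"

lemma linear_cd:
  assumes "smooth_on S V" "x \<in> S"
  shows "linear (cd V x)"
proof -
  note l = bilinear_familyD(4)[OF N.chr_family F_in[OF assms(2)]] linear_DF[OF assms(2)]
    smooth_on_linear_Df[OF assms]
  show ?thesis
    by (rule linearI) (simp_all add: cd_def linear_add[OF l(1)] linear_add[OF l(2)] linear_add[OF l(3)]
      linear_scale[OF l(1)] linear_scale[OF l(2)] linear_scale[OF l(3)] scaleR_right_distrib)
qed

lemma smooth_cd_const:
  assumes "smooth_on S V"
  shows "smooth_on S (\<lambda>x. cd V x a)"
  unfolding cd_def
  by (rule smooth_on_add[OF smooth_on_Df[OF assms] smooth_on_bilinear_family[OF open_dom chr_F_family
        smooth_on_Df[OF smooth_F] assms] open_dom])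

lemma smooth_cd:
  assumes "smooth_on S V" "smooth_on S X"
  shows "smooth_on S (\<lambda>x. cd V x (X x))"
  by (rule smooth_on_linear_family[where L="cd V", OF open_dom linear_cd[OF assms(1)]
        smooth_cd_const[OF assms(1)] assms(2)])

lemma cd_cong: "x \<in> S \<Longrightarrow> (\<And>y. y \<in> S \<Longrightarrow> V y = W y) \<Longrightarrow> cd V x a = cd W x a"
  unfolding cd_def using Df_cong_open[OF open_dom, of x V W] by simp

text \<open>Splits off the derivative of the field \<open>X\<close>. Taken with
  \<open>L = cd V\<close> or \<open>L = Df F\<close>, it isolates the tensorial part, in which
  \<open>X\<close> enters only through its value at \<open>x\<close>.\<close>

lemma cd_linear_family:
  fixes L :: "'e \<Rightarrow> 'a::euclidean_space \<Rightarrow> 'f"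
  assumes "\<And>x. x \<in> S \<Longrightarrow> linear (L x)" "\<And>a. smooth_on S (\<lambda>x. L x a)" "smooth_on S X" "x \<in> S"
  shows "cd (\<lambda>y. L y (X y)) x a = cd (\<lambda>y. L y (X x)) x a + L x (Df X x a)"
  unfolding cd_def using Df_linear_family[where L=L, OF open_dom assms, of a] by simp

lemma cd_metric:
  assumes "smooth_on S V" "smooth_on S W" "x \<in> S"
  shows "Df (\<lambda>y. H (F y) (V y) (W y)) x a = H (F x) (cd V x a) (W x) + H (F x) (V x) (cd W x a)"
proof -
  interpret inner_form "H (F x)" by (rule inner_F[OF assms(3)])
  have "Df (\<lambda>y. H (F y) (V x) (W x)) x a = N.dG (F x) (Df F x a) (V x) (W x)"
    unfolding N.dG_def
    using Df_compose[OF smooth_F bilinear_familyD(2)[OF N.family] F_into assms(3)] by metis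
  then show ?thesis
    using Df_bilinear_family[OF open_dom H_family assms, of a] N.chr_metric[OF F_in[OF assms(3)]]
    by (simp add: cd_def g_simps)
qed

lemma cd_torsion:
  assumes "x \<in> S"
  shows "cd (\<lambda>y. Df F y b) x a = cd (\<lambda>y. Df F y a) x b"
  unfolding cd_def second_derivative_symmetric[OF open_dom smooth_F assms, of b a]
    N.chr_sym[OF F_in[OF assms], of "Df F x a" "Df F x b"] by simp

text \<open>Second derivatives of \<open>F\<close> and of \<open>V\<close> are symmetric, and the
  terms with one derivative of \<open>V\<close> cancel in pairs; only the curvature at
  \<open>F x\<close> is left. \<open>R\<close> is written out because \<open>curv\<close> is
  introduced below, through the instance of this locale with the identity map.\<close>

lemma cd_commute:
  assumes V: "smooth_on S V" and x: "x \<in> S"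
  defines "R \<equiv> \<lambda>a b c. Df (\<lambda>y. N.chr y b c) (F x) a - Df (\<lambda>y. N.chr y a c) (F x) b
    + N.chr (F x) a (N.chr (F x) b c) - N.chr (F x) b (N.chr (F x) a c)"
  shows "cd (\<lambda>y. cd V y b) x a - cd (\<lambda>y. cd V y a) x b = R (Df F x a) (Df F x b) (V x)"
proof -
  note bil = bilinear_familyD(1)[OF N.chr_family F_in[OF x]]
  have *: "Df (\<lambda>y. cd V y b) x a = Df (\<lambda>y. Df V y b) x a +
      (Df (\<lambda>y. N.chr y (Df F x b) (V x)) (F x) (Df F x a)
       + N.chr (F x) (Df (\<lambda>y. Df F y b) x a) (V x) + N.chr (F x) (Df F x b) (Df V x a))" for a b
  proof -
    have "Df (\<lambda>y. N.chr (F y) (Df F x b) (V x)) x a = Df (\<lambda>y. N.chr y (Df F x b) (V x)) (F x) (Df F x a)"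
      using Df_compose[OF smooth_F bilinear_familyD(2)[OF N.chr_family] F_into x] by metis
    moreover have "Df (\<lambda>y. Df V y b + N.chr (F y) (Df F y b) (V y)) x
        = (\<lambda>a. Df (\<lambda>y. Df V y b) x a + Df (\<lambda>y. N.chr (F y) (Df F y b) (V y)) x a)"
      by (rule Df_eq[OF has_derivative_add[OF smooth_on_has_derivative[OF smooth_on_Df[OF V] x]
            smooth_on_has_derivative[OF smooth_on_bilinear_family[OF open_dom chr_F_family smooth_on_Df[OF smooth_F] V] x]]])
    ultimately show ?thesis
      unfolding cd_def
      using Df_bilinear_family[OF open_dom chr_F_family smooth_on_Df[OF smooth_F] V x, of b a] by simp
  qed
  show ?thesis
    unfolding cd_def[of "\<lambda>y. cd V y _"] * R_def
    using second_derivative_symmetric[OF open_dom smooth_F x, of b a]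
      second_derivative_symmetric[OF open_dom V x, of b a]
    by (simp add: cd_def bilinear_radd[OF bil] algebra_simps)
qed

end

sublocale local_metric \<subseteq> self: along_map S G S "\<lambda>x. x"
  by unfold_locales (auto intro: open_S smooth_on_ident)

section \<open>The curvature tensor and its algebraic symmetries\<close>

context local_metric
begin

text \<open>The curvature on fields with constant coordinates, whose Lie bracket vanishes; the sign
  is that of \<open>curvature_fields\<close>.\<close>

definition curv :: "'e \<Rightarrow> 'e \<Rightarrow> 'e \<Rightarrow> 'e \<Rightarrow> 'e" where
  "curv x a b c = Df (\<lambda>y. chr y b c) x a - Df (\<lambda>y. chr y a c) x b
    + chr x a (chr x b c) - chr x b (chr x a c)"

lemma curv_skew: "curv x a b c = - curv x b a c"
  by (simp add: curv_def)

lemma linear_curv: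
  assumes "x \<in> S"
  shows "linear (\<lambda>a. curv x a b c)" "linear (\<lambda>b. curv x a b c)" "linear (\<lambda>c. curv x a b c)"
proof -
  note chr = bilinear_familyD(1)[OF chr_family assms]
  note D1 = smooth_on_linear_Df[OF bilinear_familyD(2)[OF chr_family] assms]
  note D2 = bilinear_Df_family[OF open_S chr_family assms]
  show "linear (\<lambda>a. curv x a b c)" "linear (\<lambda>b. curv x a b c)" "linear (\<lambda>c. curv x a b c)"
    by (rule linearI; simp add: curv_def linear_add[OF D1] linear_scale[OF D1]
        bilinear_ladd[OF D2] bilinear_radd[OF D2] bilinear_lmul[OF D2] bilinear_rmul[OF D2]
        bilinear_ladd[OF chr] bilinear_radd[OF chr] bilinear_lmul[OF chr] bilinear_rmul[OF chr] algebra_simps)+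
qed

text \<open>After the Christoffel symbols and their derivatives are rewritten by
  \<open>chr_sym\<close>, the cyclic sum cancels term by term.\<close>

lemma curv_bianchi:
  assumes x: "x \<in> S"
  shows "curv x a b c + curv x b c a + curv x c a b = 0"
proof -
  have "Df (\<lambda>y. chr y a b) x w = Df (\<lambda>y. chr y b a) x w" for a b w
    by (rule fun_cong[OF Df_cong_open[OF open_S x]]) (rule chr_sym)
  note D = this[of a b c] this[of b c a] this[of c a b]
  note C = chr_sym[OF x, of a b] chr_sym[OF x, of b c] chr_sym[OF x, of c a]
  show ?thesis
    unfolding curv_def D C by simp
qed

text \<open>The second derivatives of the function \<open>G y c d\<close> commute. Expanding them by
  metric compatibility, the mixed products of first covariant derivatives cancel, and the two
  curvature terms remain.\<close>

lemma curv_metric_skew: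
  assumes x: "x \<in> S"
  shows "G x (curv x a b c) d = - G x (curv x a b d) c"
proof -
  interpret inner_form "G x" by (rule inner_form[OF x])
  note sm = self.smooth_cd_const[OF smooth_on_const]
  have 1: "Df (\<lambda>y. Df (\<lambda>y. G y c d) y b) x a = 
      (G x (self.cd (\<lambda>y. self.cd (\<lambda>_. c) y b) x a) d + G x (self.cd (\<lambda>_. c) x b) (self.cd (\<lambda>_. d) x a))
    + (G x (self.cd (\<lambda>_. c) x a) (self.cd (\<lambda>_. d) x b) + G x c (self.cd (\<lambda>y. self.cd (\<lambda>_. d) y b) x a))" for a b
  proof -
    have "Df (\<lambda>y. Df (\<lambda>y. G y c d) y b) x = Df (\<lambda>y. G y (self.cd (\<lambda>_. c) y b) d + G y c (self.cd (\<lambda>_. d) y b)) x"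
      by (rule Df_cong_open[OF open_S x]) (rule self.cd_metric[OF smooth_on_const smooth_on_const])
    also have "\<dots> = (\<lambda>a. Df (\<lambda>y. G y (self.cd (\<lambda>_. c) y b) d) x a + Df (\<lambda>y. G y c (self.cd (\<lambda>_. d) y b)) x a)"
      by (rule Df_eq[OF has_derivative_add[OF smooth_on_has_derivative[OF smooth_G[OF sm smooth_on_const] x]
            smooth_on_has_derivative[OF smooth_G[OF smooth_on_const sm] x]]])
    finally show ?thesis
      using self.cd_metric[OF sm smooth_on_const x, of c b d a] self.cd_metric[OF smooth_on_const sm x, of c d b a]
      by simp
  qed
  have "self.cd (\<lambda>y. self.cd (\<lambda>_. c) y b) x a - self.cd (\<lambda>y. self.cd (\<lambda>_. c) y a) x b = curv x a b c" for c
    using self.cd_commute[OF smooth_on_const x, of c b a] by (simp add: curv_def)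
  then have 2: "G x (curv x a b c) d = G x (self.cd (\<lambda>y. self.cd (\<lambda>_. c) y b) x a) d - G x (self.cd (\<lambda>y. self.cd (\<lambda>_. c) y a) x b) d" for c d
    by (metis g_simps(5))
  show ?thesis
    using second_derivative_symmetric_real[OF open_S bilinear_familyD(2)[OF family] x, of c d b a]
    unfolding 1 2 by (simp add: sym[of c])
qed

text \<open>The classical argument: four instances of the Bianchi identity are combined by means of
  the two skew symmetries.\<close>

lemma curv_pair_sym:
  assumes x: "x \<in> S"
  shows "G x (curv x a b c) d = G x (curv x c d a) b"
proof -
  interpret inner_form "G x" by (rule inner_form[OF x])
  have B: "G x (curv x a b c) d + G x (curv x b c a) d + G x (curv x c a b) d = 0" for a b c d
    using curv_bianchi[OF x, of a b c] by (metis g_simps(1,9))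
  have S: "G x (curv x a b c) d = - G x (curv x b a c) d" for a b c d
    by (subst curv_skew) (simp add: g_simps)
  show ?thesis
    using B[of a b c d] B[of b c d a] B[of c d a b] B[of d a b c]
      S[of a b c d] S[of a b d c] S[of b c a d] S[of b c d a] S[of c a b d] S[of c a d b]
      S[of c d a b] S[of c d b a] S[of d b c a] S[of d b a c] S[of d a b c] S[of d a c b]
      curv_metric_skew[OF x, of a b c d] curv_metric_skew[OF x, of b c a d] curv_metric_skew[OF x, of c a b d]
      curv_metric_skew[OF x, of c d a b] curv_metric_skew[OF x, of d a b c] curv_metric_skew[OF x, of b d a c]
      curv_metric_skew[OF x, of d b a c] curv_metric_skew[OF x, of a d b c] curv_metric_skew[OF x, of a c b d]
    by linarith
qed

end

subsection \<open>Isometric immersions between open subsets of Euclidean spaces\<close>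

locale local_immersion = along_map T H S F + M: local_metric S G
  for T :: "'f::euclidean_space set" and H and S :: "'e::euclidean_space set" and F and G +
  assumes isometric: "x \<in> S \<Longrightarrow> H (F x) (Df F x a) (Df F x b) = G x a b"
begin

text \<open>The second fundamental form on fields with constant coordinates;
  \<open>sff_along\<close> shows that a varying field gives the same value.\<close>

definition sff :: "'e \<Rightarrow> 'e \<Rightarrow> 'e \<Rightarrow> 'f" where
  "sff x a b = cd (\<lambda>y. Df F y b) x a - Df F x (M.chr x a b)"

lemma sff_sym: "x \<in> S \<Longrightarrow> sff x a b = sff x b a"
  unfolding sff_def using cd_torsion[of x b a] M.chr_sym[of x a b] by simp

lemma sff_family: "bilinear_family S sff"
  unfolding bilinear_family_def
proof (intro conjI ballI allI)
  fix x assume x: "x \<in> S"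
  note chr = bilinear_familyD(1)[OF M.chr_family x]
  have lin: "linear (\<lambda>a. sff x a b)" for b
    unfolding sff_def
    by (rule linearI) (simp_all add: linear_add[OF linear_cd[OF smooth_on_Df[OF smooth_F] x]]
      linear_scale[OF linear_cd[OF smooth_on_Df[OF smooth_F] x]] linear_add[OF linear_DF[OF x]]
      linear_scale[OF linear_DF[OF x]] bilinear_ladd[OF chr] bilinear_lmul[OF chr] algebra_simps)
  show "bilinear (sff x)"
    unfolding bilinear_def
  proof (intro conjI allI lin)
    have "sff x a = (\<lambda>b. sff x b a)" for a by (rule ext) (rule sff_sym[OF x])
    then show "linear (sff x a)" for a using lin[of a] by metis
  qed
next
  fix a b
  show "smooth_on S (\<lambda>x. sff x a b)"
    unfolding sff_def
    by (rule smooth_on_diff[OF smooth_cd_const[OF smooth_on_Df[OF smooth_F]]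
      smooth_DF[OF bilinear_familyD(2)[OF M.chr_family]] open_dom])
qed

text \<open>The trilinear form \<open>B\<close> is symmetric in its first two arguments and, by
  differentiating the isometry condition, skew in its last two. Such a form is zero.\<close>

lemma sff_normal:
  assumes x: "x \<in> S"
  shows "H (F x) (sff x a b) (Df F x c) = 0"
proof -
  interpret inner_form "H (F x)" by (rule inner_F[OF x])
  define B where "B a b c = H (F x) (sff x a b) (Df F x c)" for a b c
  have B_sym: "B a b c = B b a c" for a b c
    by (simp add: B_def sff_sym[OF x, of a b])
  have "B a b c + B a c b = 0" for a b c
  proof -
    have "M.dG x a b c = Df (\<lambda>y. H (F y) (Df F y b) (Df F y c)) x a"
      unfolding M.dG_def by (rule fun_cong[OF Df_cong_open[OF open_dom x]]) (simp add: isometric)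
    also have "\<dots> = H (F x) (cd (\<lambda>y. Df F y b) x a) (Df F x c) + H (F x) (Df F x b) (cd (\<lambda>y. Df F y c) x a)"
      by (rule cd_metric[OF smooth_on_Df[OF smooth_F] smooth_on_Df[OF smooth_F] x])
    finally show ?thesis
      using M.chr_metric[OF x, of a b c] sym[of "Df F x b" "cd (\<lambda>y. Df F y c) x a"]
        M.G_sym[OF x, of b "M.chr x a c"]
      by (simp add: B_def sff_def g_simps isometric[OF x])
  qed
  from this[of a b c] this[of c a b] this[of b c a] have "B a b c = 0"
    using B_sym[of a b c] B_sym[of a c b] B_sym[of c b a] by simp
  then show ?thesis by (simp add: B_def)
qed

text \<open>The Hessian of \<open>V\<close> along \<open>F\<close>. The correction term makes it
  tensorial, and \<open>cd2_along\<close> uses this to remove the derivatives of the frame from the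
  rough Laplacian.\<close>

definition cd2 :: "('e \<Rightarrow> 'f) \<Rightarrow> 'e \<Rightarrow> 'e \<Rightarrow> 'e \<Rightarrow> 'f" where
  "cd2 V x a b = cd (\<lambda>y. cd V y b) x a - cd V x (M.chr x a b)"

lemma cd2_commute:
  assumes "smooth_on S V" "x \<in> S"
  shows "cd2 V x a b - cd2 V x b a = N.curv (F x) (Df F x a) (Df F x b) (V x)"
  using cd_commute[OF assms, of b a] M.chr_sym[OF assms(2), of a b]
  by (simp add: cd2_def N.curv_def)

lemma cd2_along:
  assumes "smooth_on S V" "smooth_on S X" "x \<in> S"
  shows "cd (\<lambda>y. cd V y (X y)) x (X x) - cd V x (M.self.cd X x (X x)) = cd2 V x (X x) (X x)"
proof -
  have "M.self.cd X x (X x) = Df X x (X x) + M.chr x (X x) (X x)"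
    by (simp add: M.self.cd_def)
  then show ?thesis
    using cd_linear_family[where L="cd V", OF linear_cd[OF assms(1)] smooth_cd_const[OF assms(1)] assms(2,3), of "X x"]
    by (simp add: cd2_def linear_add[OF linear_cd[OF assms(1,3)]])
qed

lemma sff_along:
  assumes "smooth_on S X" "x \<in> S"
  shows "cd (\<lambda>y. Df F y (X y)) x a - Df F x (M.self.cd X x a) = sff x a (X x)"
proof -
  have "M.self.cd X x a = Df X x a + M.chr x a (X x)"
    by (simp add: M.self.cd_def)
  then show ?thesis
    using cd_linear_family[where L="Df F", OF linear_DF smooth_on_Df[OF smooth_F] assms]
    by (simp add: sff_def linear_add[OF linear_DF[OF assms(2)]])
qed

end

section \<open>Hypersurfaces with parallel tension field, in coordinates\<close>

locale parallel_hypersurface = local_immersion T H S F G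
  for T :: "'f::euclidean_space set" and H and S :: "'e::euclidean_space set" and F and G +
  fixes E :: "nat \<Rightarrow> 'e \<Rightarrow> 'e" and \<tau> :: "'e \<Rightarrow> 'f"
  assumes codim: "DIM('f) = DIM('e) + 1"
    and smooth_E: "i < DIM('e) \<Longrightarrow> smooth_on S (E i)"
    and ortho_E: "x \<in> S \<Longrightarrow> inner_form.ortho (G x) (\<lambda>i. E i x) DIM('e)"
    and tau_eq: "x \<in> S \<Longrightarrow> \<tau> x = (\<Sum>i<DIM('e). sff x (E i x) (E i x))"
    and parallel: "x \<in> S \<Longrightarrow> \<exists>u. cd \<tau> x a = Df F x u"
begin

lemma smooth_tau: "smooth_on S \<tau>"
proof (rule smooth_on_cong[OF _ open_dom])
  show "smooth_on S (\<lambda>x. \<Sum>i<DIM('e). sff x (E i x) (E i x))"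
    by (rule smooth_on_sum[OF smooth_on_bilinear_family[OF open_dom sff_family]])
      (use smooth_E open_dom in auto)
qed (simp add: tau_eq)

lemma tau_normal: "x \<in> S \<Longrightarrow> H (F x) (\<tau> x) (Df F x c) = 0"
  unfolding tau_eq
  by (simp add: inner_form.g_sum_left[OF inner_F] sff_normal)

text \<open>The assumption \<open>parallel\<close> expresses the vanishing of the normal derivative
  as tangency of \<open>cd \<tau>\<close>; it is used through this orthogonality to normal vectors
  \<open>w\<close>.\<close>

lemma cd_tau_normal:
  assumes "x \<in> S" "\<And>a. H (F x) w (Df F x a) = 0"
  shows "H (F x) (cd \<tau> x a) w = 0"
  using parallel[OF assms(1), of a] assms(2) inner_form.sym[OF inner_F[OF assms(1)], of _ w] by metis

text \<open>Minus the shape operator in the direction of \<open>\<tau>\<close>, as a bilinear form.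
  As \<open>cd \<tau>\<close> is tangential, this form determines it.\<close>

definition shape :: "'e \<Rightarrow> 'e \<Rightarrow> 'e \<Rightarrow> real" where
  "shape x a b = H (F x) (cd \<tau> x a) (Df F x b)"

text \<open>Differentiate the orthogonality of \<open>\<tau>\<close> and \<open>Df F y b\<close>. Of
  the derivative of the second factor only the normal part \<open>sff\<close> survives the product
  with \<open>\<tau>\<close>.\<close>

lemma shape_eq:
  assumes x: "x \<in> S"
  shows "shape x a b = - H (F x) (\<tau> x) (sff x a b)"
proof -
  interpret inner_form "H (F x)" by (rule inner_F[OF x])
  have "Df (\<lambda>y. H (F y) (\<tau> y) (Df F y b)) x = Df (\<lambda>y. 0) x"
    by (rule Df_cong_open[OF open_dom x tau_normal])
  then have "H (F x) (cd \<tau> x a) (Df F x b) + H (F x) (\<tau> x) (cd (\<lambda>y. Df F y b) x a) = 0"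
    using cd_metric[OF smooth_tau smooth_on_Df[OF smooth_F] x, of b a] by simp
  then show ?thesis
    by (simp add: shape_def sff_def g_simps tau_normal[OF x])
qed

lemma shape_sym: "x \<in> S \<Longrightarrow> shape x a b = shape x b a"
  by (simp add: shape_eq sff_sym[of x a b])

lemma shape_family: "bilinear_family S shape"
  unfolding bilinear_family_def
proof (intro conjI ballI allI)
  fix x assume x: "x \<in> S"
  interpret inner_form "H (F x)" by (rule inner_F[OF x])
  show "bilinear (shape x)"
    unfolding bilinear_def shape_def
    by (intro conjI allI linearI) (simp_all add: linear_add[OF linear_cd[OF smooth_tau x]]
      linear_scale[OF linear_cd[OF smooth_tau x]] linear_add[OF linear_DF[OF x]]
      linear_scale[OF linear_DF[OF x]] g_simps)
next
  fix a b
  show "smooth_on S (\<lambda>x. shape x a b)"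
    unfolding shape_def
    by (rule smooth_on_bilinear_family[OF open_dom H_family smooth_cd_const[OF smooth_tau] smooth_on_Df[OF smooth_F]])
qed

text \<open>The right-hand side is the covariant derivative of the form \<open>shape\<close>.
  Differentiating its definition also produces the product of \<open>cd \<tau> x b\<close> with
  \<open>sff x a k\<close>, which vanishes because the former is tangential and the latter
  normal.\<close>

lemma cd2_tangential:
  assumes x: "x \<in> S"
  shows "H (F x) (cd2 \<tau> x a b) (Df F x k) =
    Df (\<lambda>y. shape y b k) x a - shape x b (M.chr x a k) - shape x (M.chr x a b) k"
proof -
  interpret inner_form "H (F x)" by (rule inner_F[OF x])
  have "H (F x) (cd \<tau> x b) (sff x a k) = 0"
    by (rule cd_tau_normal[OF x sff_normal[OF x]])
  then show ?thesis
    unfolding shape_def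
    using cd_metric[OF smooth_cd_const[OF smooth_tau] smooth_on_Df[OF smooth_F] x, of b k a]
    by (simp add: cd2_def sff_def g_simps)
qed

text \<open>This is the Codazzi equation: since \<open>\<tau>\<close> is parallel, its second covariant derivative
  has the same tangential part as the covariant derivative of the shape operator.\<close>

lemma cd2_codazzi:
  assumes x: "x \<in> S"
  shows "H (F x) (cd2 \<tau> x a b) (Df F x k) = H (F x) (cd2 \<tau> x a k) (Df F x b)"
proof -
  have "Df (\<lambda>y. shape y b k) x = Df (\<lambda>y. shape y k b) x"
    by (rule Df_cong_open[OF open_dom x shape_sym])
  then show ?thesis
    unfolding cd2_tangential[OF x]
    using shape_sym[OF x, of b "M.chr x a k"] shape_sym[OF x, of k "M.chr x a b"] by simp
qed

text \<open>The sum is the covariant derivative along \<open>k\<close> of the trace of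
  \<open>shape\<close>, and this trace is minus the constant squared length of
  \<open>\<tau>\<close>.\<close>

lemma trace_shape_derivative:
  assumes x: "x \<in> S"
  shows "(\<Sum>i<DIM('e). H (F x) (cd2 \<tau> x k (E i x)) (Df F x (E i x))) = 0"
proof -
  interpret inner_form "G x" by (rule M.inner_form[OF x])
  note o = ortho_E[OF x]
  note sh = bilinear_familyD(1)[OF shape_family x]
  \<comment> \<open>\<open>\<omega> i\<close> is the covariant derivative of the frame field
    \<open>E i\<close> along \<open>k\<close>; the numbers \<open>w i j\<close> are the connection
    coefficients of the frame.\<close>
  define \<omega> where "\<omega> i = Df (E i) x k + M.chr x k (E i x)" for i
  define w where "w i j = G x (\<omega> i) (E j x)" for i j
  define s where "s i j = shape x (E i x) (E j x)" for i j
  have w_skew: "w i j + w j i = 0" if i: "i < DIM('e)" "j < DIM('e)" for i j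
  proof -
    have "Df (\<lambda>y. G y (E i y) (E j y)) x = Df (\<lambda>y. if i = j then 1 else 0) x"
      by (rule Df_cong_open[OF open_dom x]) (rule inner_form.ortho_D[OF M.inner_form ortho_E i])
    then have "M.dG x k (E i x) (E j x) + G x (Df (E i) x k) (E j x) + G x (E i x) (Df (E j) x k) = 0"
      using Df_bilinear_family[OF open_dom M.family smooth_E[OF i(1)] smooth_E[OF i(2)] x, of k]
      by (simp add: M.dG_def)
    then show ?thesis
      using sym[of "E i x" "M.chr x k (E j x)"] sym[of "E i x" "Df (E j) x k"]
      by (simp add: M.chr_metric[OF x] w_def \<omega>_def g_simps)
  qed
  have shape_\<omega>: "shape x (\<omega> i) (E i x) = (\<Sum>j<DIM('e). w i j * s i j)" for i
  proof -
    have "shape x (\<omega> i) (E i x) = shape x (\<Sum>j<DIM('e). w i j *\<^sub>R E j x) (E i x)"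
      using ortho_expand[OF o, of "\<omega> i"] by (simp add: w_def)
    also have "\<dots> = (\<Sum>j<DIM('e). w i j * shape x (E j x) (E i x))"
      by (simp add: linear_sum[OF bilinear_familyD(4)[OF shape_family x]] bilinear_lmul[OF sh])
    finally show ?thesis
      by (simp add: s_def shape_sym[OF x, of "E _ x" "E i x"])
  qed
  \<comment> \<open>\<open>z\<close> collects the contributions of the moving frame. It contracts
    the skew \<open>w\<close> with the symmetric \<open>s\<close>, so exchanging the two summations
    gives \<open>z = - z\<close>.\<close>
  define z where "z = (\<Sum>i<DIM('e). shape x (\<omega> i) (E i x))"
  have "z = (\<Sum>i<DIM('e). \<Sum>j<DIM('e). w i j * s i j)"
    by (simp add: z_def shape_\<omega>)
  moreover have "\<dots> = (\<Sum>j<DIM('e). \<Sum>i<DIM('e). w i j * s i j)"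
    by (rule sum.swap)
  moreover have "\<dots> = (\<Sum>j<DIM('e). \<Sum>i<DIM('e). - (w j i * s j i))"
  proof (intro sum.cong refl)
    fix i j assume "j \<in> {..<DIM('e)}" "i \<in> {..<DIM('e)}"
    then have "w i j = - w j i" using w_skew[of i j] by simp
    moreover have "s i j = s j i" by (simp add: s_def shape_sym[OF x, of "E i x"])
    ultimately show "w i j * s i j = - (w j i * s j i)" by simp
  qed
  moreover have "\<dots> = - (\<Sum>i<DIM('e). \<Sum>j<DIM('e). w i j * s i j)"
    by (simp add: sum_negf)
  ultimately have z0: "z = 0" by linarith
  have trace: "(\<Sum>i<DIM('e). shape y (E i y) (E i y)) = - H (F y) (\<tau> y) (\<tau> y)" if y: "y \<in> S" for y
  proof -
    have "H (F y) (\<tau> y) (\<tau> y) = (\<Sum>i<DIM('e). H (F y) (\<tau> y) (sff y (E i y) (E i y)))"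
      by (subst (2) tau_eq[OF y]) (simp add: inner_form.g_sum_right[OF inner_F[OF y]])
    then show ?thesis by (simp add: shape_eq[OF y] sum_negf)
  qed
  have sm: "smooth_on S (\<lambda>y. shape y (E i y) (E i y))" if "i < DIM('e)" for i
    by (rule smooth_on_bilinear_family[OF open_dom shape_family smooth_E[OF that] smooth_E[OF that]])
  have d: "Df (\<lambda>y. \<Sum>i<DIM('e). shape y (E i y) (E i y)) x = (\<lambda>v. \<Sum>i<DIM('e). Df (\<lambda>y. shape y (E i y) (E i y)) x v)"
    by (rule Df_eq[OF has_derivative_sum]) (rule smooth_on_has_derivative[OF sm x], simp)
  have H0: "H (F x) (cd \<tau> x a) (\<tau> x) = 0" for a
    by (rule cd_tau_normal[OF x tau_normal[OF x]])
  have A: "Df (\<lambda>y. H (F y) (\<tau> y) (\<tau> y)) x k = 0"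
    using cd_metric[OF smooth_tau smooth_tau x, of k] H0[of k]
      inner_form.sym[OF inner_F[OF x], of "\<tau> x" "cd \<tau> x k"] by simp
  have B: "Df (\<lambda>y. \<Sum>i<DIM('e). shape y (E i y) (E i y)) x = Df (\<lambda>y. - H (F y) (\<tau> y) (\<tau> y)) x"
    by (rule Df_cong_open[OF open_dom x trace])
  have C: "Df (\<lambda>y. - H (F y) (\<tau> y) (\<tau> y)) x = (\<lambda>v. - Df (\<lambda>y. H (F y) (\<tau> y) (\<tau> y)) x v)"
    by (rule Df_eq[OF has_derivative_minus[OF smooth_on_has_derivative[OF smooth_on_bilinear_family[OF open_dom H_family smooth_tau smooth_tau] x]]])
  have "(\<Sum>i<DIM('e). Df (\<lambda>y. shape y (E i y) (E i y)) x k) = 0"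
    using fun_cong[OF d, of k] fun_cong[OF B, of k] fun_cong[OF C, of k] A by linarith
  moreover have "Df (\<lambda>y. shape y (E i y) (E i y)) x k =
      H (F x) (cd2 \<tau> x k (E i x)) (Df F x (E i x)) + 2 * shape x (\<omega> i) (E i x)" if "i < DIM('e)" for i
    using Df_bilinear_family[OF open_dom shape_family smooth_E[OF that] smooth_E[OF that] x, of k]
      shape_sym[OF x, of "E i x"]
    by (simp add: cd2_tangential[OF x] \<omega>_def bilinear_ladd[OF sh])
  ultimately have "(\<Sum>i<DIM('e). H (F x) (cd2 \<tau> x k (E i x)) (Df F x (E i x))) + 2 * z = 0"
    by (simp add: z_def sum.distrib sum_distrib_left)
  with z0 show ?thesis by simp
qed

definition bitension_field :: "'e \<Rightarrow> 'f" where
  "bitension_field x = - (\<Sum>i<DIM('e). cd2 \<tau> x (E i x) (E i x))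
    - (\<Sum>i<DIM('e). N.curv (F x) (\<tau> x) (Df F x (E i x)) (Df F x (E i x)))"

definition partial_ricci :: "'e \<Rightarrow> 'f" where
  "partial_ricci x = (\<Sum>i<DIM('e). N.curv (F x) (\<tau> x) (Df F x (E i x)) (Df F x (E i x)))"

text \<open>One copy of \<open>partial_ricci\<close> is the curvature term of the bitension field.
  The other is the commutator, put into this shape by pair symmetry, that arises when Codazzi and
  \<open>cd2_commute\<close> bring the Laplacian into the form whose trace vanishes.\<close>

lemma bitension_tangential:
  assumes x: "x \<in> S"
  shows "H (F x) (bitension_field x) (Df F x k) = - 2 * H (F x) (partial_ricci x) (Df F x k)"
proof -
  interpret inner_form "H (F x)" by (rule inner_F[OF x])
  have "H (F x) (cd2 \<tau> x (E i x) (E i x)) (Df F x k) =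
      H (F x) (cd2 \<tau> x k (E i x)) (Df F x (E i x))
      + H (F x) (N.curv (F x) (\<tau> x) (Df F x (E i x)) (Df F x (E i x))) (Df F x k)" for i
  proof -
    have "H (F x) (cd2 \<tau> x (E i x) (E i x)) (Df F x k) = H (F x) (cd2 \<tau> x (E i x) k) (Df F x (E i x))"
      by (rule cd2_codazzi[OF x])
    also have "\<dots> = H (F x) (cd2 \<tau> x k (E i x)) (Df F x (E i x))
        + H (F x) (N.curv (F x) (Df F x (E i x)) (Df F x k) (\<tau> x)) (Df F x (E i x))"
      unfolding cd2_commute[OF smooth_tau x, symmetric] by (simp add: g_simps)
    finally show ?thesis
      using N.curv_pair_sym[OF F_in[OF x], of "Df F x (E i x)" "Df F x k" "\<tau> x" "Df F x (E i x)"] by simp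
  qed
  then show ?thesis
    using trace_shape_derivative[OF x, of k]
    by (simp add: bitension_field_def partial_ricci_def g_simps g_sum_left sum.distrib)
qed

lemma adapted_frame:
  assumes x: "x \<in> S" and \<tau>: "\<tau> x \<noteq> 0"
  defines "r \<equiv> sqrt (H (F x) (\<tau> x) (\<tau> x))"
  shows "inner_form.ortho (H (F x)) (\<lambda>i. if i < DIM('e) then Df F x (E i x) else (1 / r) *\<^sub>R \<tau> x) DIM('f)"
proof -
  interpret inner_form "H (F x)" by (rule inner_F[OF x])
  have r: "r > 0" "H (F x) (\<tau> x) (\<tau> x) = r * r" using pos[OF \<tau>] by (simp_all add: r_def)
  have e: "H (F x) (Df F x (E i x)) (Df F x (E j x)) = (if i = j then 1 else 0)"
    if "i < DIM('e)" "j < DIM('e)" for i j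
    unfolding isometric[OF x] by (rule inner_form.ortho_D[OF M.inner_form[OF x] ortho_E[OF x] that])
  have n: "H (F x) (Df F x a) (\<tau> x) = 0" for a
    using tau_normal[OF x, of a] sym by metis
  show ?thesis
    unfolding ortho_def
  proof (intro allI impI)
    fix i j assume "i < DIM('f)" "j < DIM('f)"
    \<comment> \<open>Exactly one index, namely \<open>DIM('e)\<close> itself, lies beyond the
      tangent frame.\<close>
    then have "i = j" if "\<not> i < DIM('e)" "\<not> j < DIM('e)" using that codim by simp
    then show "H (F x) (if i < DIM('e) then Df F x (E i x) else (1 / r) *\<^sub>R \<tau> x)
        (if j < DIM('e) then Df F x (E j x) else (1 / r) *\<^sub>R \<tau> x) = (if i = j then 1 else 0)"
      using e[of i j] r by (cases "i < DIM('e)"; cases "j < DIM('e)") (simp_all add: n tau_normal[OF x] g_simps)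
  qed
qed

text \<open>Equality in the Cauchy-Schwarz inequality: for nonzero \<open>\<tau> x\<close> the
  normal space is the line through it, and otherwise both sides vanish. Applied to
  \<open>w = sff x a b\<close>, it trades the shape form for the norm of the second fundamental
  form.\<close>

lemma normal_norm:
  assumes x: "x \<in> S" and w: "\<And>a. H (F x) w (Df F x a) = 0"
  shows "(H (F x) (\<tau> x) w)\<^sup>2 = H (F x) (\<tau> x) (\<tau> x) * H (F x) w w"
proof (cases "\<tau> x = 0")
  case True
  then show ?thesis by (simp add: inner_form.g_simps[OF inner_F[OF x]])
next
  case False
  interpret inner_form "H (F x)" by (rule inner_F[OF x])
  define r where "r = sqrt (H (F x) (\<tau> x) (\<tau> x))"
  have r: "r > 0" "H (F x) (\<tau> x) (\<tau> x) = r * r" using pos[OF False] by (simp_all add: r_def)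
  have "H (F x) w w = (\<Sum>i<DIM('e). 0) + H (F x) w ((1 / r) *\<^sub>R \<tau> x) * H (F x) w ((1 / r) *\<^sub>R \<tau> x)"
    using ortho_norm[OF adapted_frame[OF x False], of w w] unfolding codim by (simp add: w r_def)
  then show ?thesis
    using r by (simp add: g_simps sym[of w "\<tau> x"] power2_eq_square field_simps)
qed

lemma normal_multiple:
  assumes x: "x \<in> S" and \<tau>: "\<tau> x \<noteq> 0" and w: "\<And>a. H (F x) w (Df F x a) = 0"
  shows "w = (H (F x) w (\<tau> x) / H (F x) (\<tau> x) (\<tau> x)) *\<^sub>R \<tau> x"
proof -
  interpret inner_form "H (F x)" by (rule inner_F[OF x])
  have "H (F x) (\<tau> x) (\<tau> x) \<noteq> 0" using \<tau> g_eq_0 by blast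
  then show ?thesis
    by (intro ortho_eqI[OF adapted_frame[OF x \<tau>]]) (auto simp: g_simps w tau_normal[OF x])
qed

definition sff_norm2 :: "'e \<Rightarrow> real" where
  "sff_norm2 x = (\<Sum>j<DIM('e). \<Sum>k<DIM('e). H (F x) (sff x (E j x) (E k x)) (sff x (E j x) (E k x)))"

lemma bitension_normal:
  assumes x: "x \<in> S"
  shows "H (F x) (bitension_field x) (\<tau> x) =
    H (F x) (\<tau> x) (\<tau> x) * sff_norm2 x - H (F x) (partial_ricci x) (\<tau> x)"
proof -
  interpret inner_form "H (F x)" by (rule inner_F[OF x])
  have H0: "y \<in> S \<Longrightarrow> H (F y) (cd \<tau> y a) (\<tau> y) = 0" for y a
    by (rule cd_tau_normal[OF _ tau_normal])
  have "H (F x) (cd2 \<tau> x a a) (\<tau> x) = - (\<Sum>k<DIM('e). (H (F x) (\<tau> x) (\<tau> x)) * H (F x) (sff x a (E k x)) (sff x a (E k x)))" for a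
  proof -
    have "Df (\<lambda>y. H (F y) (cd \<tau> y a) (\<tau> y)) x = Df (\<lambda>y. 0) x"
      by (rule Df_cong_open[OF open_dom x H0])
    then have "H (F x) (cd2 \<tau> x a a) (\<tau> x) = - H (F x) (cd \<tau> x a) (cd \<tau> x a)"
      using cd_metric[OF smooth_cd_const[OF smooth_tau] smooth_tau x, of a a] H0[OF x]
      by (simp add: cd2_def g_simps)
    \<comment> \<open>As the derivative of \<open>\<tau>\<close> is tangential, its squared length
      can be computed in the frame \<open>E\<close>; the coefficients are values of
      \<open>shape\<close>.\<close>
    moreover obtain u where u: "cd \<tau> x a = Df F x u" using parallel[OF x] by blast
    have "H (F x) (cd \<tau> x a) (cd \<tau> x a) = (\<Sum>k<DIM('e). (shape x a (E k x))\<^sup>2)"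
      using inner_form.ortho_norm[OF M.inner_form[OF x] ortho_E[OF x], of u u]
      by (simp add: u shape_def isometric[OF x] power2_eq_square)
    moreover have "(shape x a (E k x))\<^sup>2 = H (F x) (\<tau> x) (\<tau> x) * H (F x) (sff x a (E k x)) (sff x a (E k x))" for k
      using normal_norm[OF x sff_normal[OF x], of a "E k x"] by (simp add: shape_eq[OF x])
    ultimately show ?thesis by simp
  qed
  then show ?thesis
    by (simp add: bitension_field_def partial_ricci_def g_simps g_sum_left sff_norm2_def sum_negf sum_distrib_left)
qed

lemma partial_ricci_eq:
  assumes x: "x \<in> S" and \<tau>: "\<tau> x \<noteq> 0" and b: "inner_form.ortho (H (F x)) b DIM('f)"
  shows "(\<Sum>i<DIM('f). N.curv (F x) (\<tau> x) (b i) (b i)) = partial_ricci x"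
proof -
  interpret inner_form "H (F x)" by (rule inner_F[OF x])
  note lin = N.linear_curv[OF F_in[OF x]]
  have "N.curv (F x) (\<tau> x) (c *\<^sub>R \<tau> x) d = 0" for c d
  proof -
    have "N.curv (F x) (\<tau> x) (\<tau> x) d = 0"
      using N.curv_skew[of "F x" "\<tau> x" "\<tau> x" d] by (metis eq_neg_iff_add_eq_0 scaleR_2 scaleR_eq_0_iff zero_neq_numeral)
    then show ?thesis by (simp add: linear_scale[OF lin(2)])
  qed
  then show ?thesis
    unfolding trace_independent[OF b adapted_frame[OF x \<tau>], where Q="N.curv (F x) (\<tau> x)", OF lin(3,2)]
    by (simp add: codim partial_ricci_def)
qed

text \<open>Tested against the adapted frame, both sides say the same:
  \<open>partial_ricci x\<close> is orthogonal to all tangent directions, and its product with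
  \<open>\<tau> x\<close> is \<open>sff_norm2 x\<close> times the squared length of
  \<open>\<tau> x\<close>.\<close>

theorem bitension_eq_0_iff:
  assumes x: "x \<in> S" and \<tau>: "\<tau> x \<noteq> 0" and b: "inner_form.ortho (H (F x)) b DIM('f)"
  shows "bitension_field x = 0 \<longleftrightarrow>
    (\<Sum>i<DIM('f). N.curv (F x) (\<tau> x) (b i) (b i)) = sff_norm2 x *\<^sub>R \<tau> x"
proof -
  interpret inner_form "H (F x)" by (rule inner_F[OF x])
  note frame = adapted_frame[OF x \<tau>]
  have eq0: "w = v \<longleftrightarrow> (\<forall>i<DIM('e). H (F x) w (Df F x (E i x)) = H (F x) v (Df F x (E i x)))
      \<and> H (F x) w (\<tau> x) = H (F x) v (\<tau> x)" for w v
  proof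
    assume a: "(\<forall>i<DIM('e). H (F x) w (Df F x (E i x)) = H (F x) v (Df F x (E i x)))
      \<and> H (F x) w (\<tau> x) = H (F x) v (\<tau> x)"
    show "w = v"
      by (rule ortho_eqI[OF frame]) (use a in \<open>auto simp: g_simps\<close>)
  qed auto
  have pr: "(\<Sum>i<DIM('f). N.curv (F x) (\<tau> x) (b i) (b i)) = partial_ricci x"
    by (rule partial_ricci_eq[OF x \<tau> b])
  show ?thesis
    unfolding pr eq0[of "bitension_field x"] eq0[of "partial_ricci x"]
    using bitension_tangential[OF x] bitension_normal[OF x] tau_normal[OF x]
    by (auto simp: g_simps mult.commute)
qed

end

subsection \<open>Charts and tangent vectors\<close>

abbreviation transition :: "('a, 'e) chart \<Rightarrow> ('a, 'e) chart \<Rightarrow> 'e \<Rightarrow> 'e" where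
  "transition c d x \<equiv> snd d (chart_inv c x)"

locale riem_mfd =
  fixes M :: "('a, 'e::euclidean_space) riem"
  assumes riem: "riemannian_manifold M"
begin

lemma mfd: "smooth_manifold M"
  using riem by (simp add: riemannian_manifold_def)

lemma chart: "c \<in> ratlas M \<Longrightarrow> is_chart (rtop M) c"
  using mfd by (simp add: smooth_manifold_def)

lemma dom_open: "c \<in> ratlas M \<Longrightarrow> openin (rtop M) (fst c)"
  using chart by (auto simp: is_chart_def)

lemma dom_points: "c \<in> ratlas M \<Longrightarrow> fst c \<subseteq> points M"
  using dom_open openin_subset by blast

lemma charts_atD: "c \<in> charts_at M p \<Longrightarrow> c \<in> ratlas M" "c \<in> charts_at M p \<Longrightarrow> p \<in> fst c"
  by (auto simp: charts_at_def)

lemma charts_atI: "c \<in> ratlas M \<Longrightarrow> p \<in> fst c \<Longrightarrow> c \<in> charts_at M p"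
  by (auto simp: charts_at_def)

lemma charts_at_points: "c \<in> charts_at M p \<Longrightarrow> p \<in> points M"
  using charts_atD dom_points by blast

lemma charts_at_exists: "p \<in> points M \<Longrightarrow> \<exists>c. c \<in> charts_at M p"
proof -
  assume "p \<in> points M"
  moreover have "(\<Union>c\<in>ratlas M. fst c) = points M" using mfd by (simp add: smooth_manifold_def)
  ultimately show ?thesis by (auto simp: charts_at_def simp del: split_paired_Ex)
qed

lemma chart_homeo:
  "c \<in> ratlas M \<Longrightarrow> homeomorphic_map (subtopology (rtop M) (fst c)) (top_of_set (snd c ` fst c)) (snd c)"
  using chart by (auto simp: is_chart_def)

lemma range_open: "c \<in> ratlas M \<Longrightarrow> open (snd c ` fst c)"
  using chart by (auto simp: is_chart_def)

lemma chart_inj: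
  assumes "c \<in> ratlas M"
  shows "inj_on (snd c) (fst c)"
  using homeomorphic_imp_injective_map[OF chart_homeo[OF assms]] dom_points[OF assms]
  by (simp add: Int_absorb1)

lemma chart_inv_left: "c \<in> ratlas M \<Longrightarrow> p \<in> fst c \<Longrightarrow> chart_inv c (snd c p) = p"
  unfolding chart_inv_def by (rule inv_into_f_f[OF chart_inj])

lemma image_open:
  assumes c: "c \<in> ratlas M" and U: "openin (rtop M) U"
  shows "open (snd c ` (U \<inter> fst c))"
proof -
  have "openin (subtopology (rtop M) (fst c)) (U \<inter> fst c)"
    using U by (auto simp: openin_subtopology)
  then have "openin (top_of_set (snd c ` fst c)) (snd c ` (U \<inter> fst c))"
    using homeomorphic_imp_open_map[OF chart_homeo[OF c]] by (auto simp: open_map_def)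
  then show ?thesis
    using range_open[OF c] openin_open_trans by blast
qed

lemma chart_inv_continuous:
  assumes c: "c \<in> ratlas M"
  shows "continuous_map (top_of_set (snd c ` fst c)) (rtop M) (chart_inv c)"
proof -
  obtain g where g: "homeomorphic_maps (subtopology (rtop M) (fst c)) (top_of_set (snd c ` fst c)) (snd c) g"
    using chart_homeo[OF c] homeomorphic_map_maps by blast
  have "continuous_map (top_of_set (snd c ` fst c)) (rtop M) g"
    using g by (auto simp: homeomorphic_maps_def continuous_map_in_subtopology)
  moreover have "g x = chart_inv c x" if "x \<in> snd c ` fst c" for x
    using g that chart_inv_left[OF c] dom_points[OF c] by (auto simp: homeomorphic_maps_def)
  ultimately show ?thesis
    by (metis (no_types, lifting) continuous_map_eq topspace_euclidean_subtopology)
qed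

lemma smooth_transition:
  "c \<in> ratlas M \<Longrightarrow> d \<in> ratlas M \<Longrightarrow> smooth_on (snd c ` (fst c \<inter> fst d)) (transition c d)"
  using mfd by (simp add: smooth_manifold_def)

lemma overlap_open: "c \<in> ratlas M \<Longrightarrow> d \<in> ratlas M \<Longrightarrow> open (snd c ` (fst c \<inter> fst d))"
  using image_open[of c "fst d"] dom_open by (simp add: Int_commute)

text \<open>Cocycle rule from the chain rule on the triple overlap. It is what places
  \<open>of_coords\<close> in the tangent space.\<close>

lemma Df_transition_compose:
  assumes c: "c \<in> charts_at M p" and d: "d \<in> charts_at M p" and e: "e \<in> charts_at M p"
  shows "Df (transition c e) (snd c p) a = Df (transition d e) (snd d p) (Df (transition c d) (snd c p) a)"
proof -
  note C = charts_atD[OF c] and D = charts_atD[OF d] and E = charts_atD[OF e]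
  define S where "S = snd c ` ((fst d \<inter> fst e) \<inter> fst c)"
  have "open S"
    unfolding S_def by (rule image_open[OF C(1)]) (simp add: dom_open C D E openin_Int)
  moreover have p: "snd c p \<in> S" using C D E by (auto simp: S_def)
  ultimately have "Df (transition c e) (snd c p) = Df (\<lambda>x. transition d e (transition c d x)) (snd c p)"
    by (rule Df_cong_open) (auto simp: S_def chart_inv_left C D E)
  also have "\<dots> = (\<lambda>a. Df (transition d e) (transition c d (snd c p)) (Df (transition c d) (snd c p) a))"
    by (rule Df_compose[OF smooth_on_subset[OF smooth_transition[OF C(1) D(1)]]
          smooth_transition[OF D(1) E(1)] _ p]) (auto simp: S_def chart_inv_left C D E)
  finally show ?thesis by (simp add: chart_inv_left[OF C])
qed

lemma Df_transition_self:
  assumes c: "c \<in> charts_at M p"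
  shows "Df (transition c c) (snd c p) a = a"
proof -
  note C = charts_atD[OF c]
  have "Df (transition c c) (snd c p) = Df (\<lambda>x. x) (snd c p)"
    by (rule Df_cong_open[OF range_open[OF C(1)]]) (use C in \<open>auto simp: chart_inv_left\<close>)
  then show ?thesis by simp
qed

lemma linear_Df_transition:
  assumes c: "c \<in> charts_at M p" and d: "d \<in> charts_at M p"
  shows "linear (Df (transition c d) (snd c p))"
  by (rule smooth_on_linear_Df[OF smooth_transition]) (use charts_atD[OF c] charts_atD[OF d] in auto)

lemma tangentD:
  "v \<in> tangent_space M p \<Longrightarrow> c \<in> charts_at M p \<Longrightarrow> d \<in> charts_at M p \<Longrightarrow>
    v d = Df (transition c d) (snd c p) (v c)"
  "v \<in> tangent_space M p \<Longrightarrow> c \<notin> charts_at M p \<Longrightarrow> v c = 0"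
  unfolding tangent_space_def mem_Collect_eq by blast+

lemma tangentI:
  "(\<And>c d. c \<in> charts_at M p \<Longrightarrow> d \<in> charts_at M p \<Longrightarrow> v d = Df (transition c d) (snd c p) (v c)) \<Longrightarrow>
   (\<And>c. c \<notin> charts_at M p \<Longrightarrow> v c = 0) \<Longrightarrow> v \<in> tangent_space M p"
  unfolding tangent_space_def mem_Collect_eq by blast

lemma of_coords_tangent: "c \<in> charts_at M p \<Longrightarrow> of_coords M p c a \<in> tangent_space M p"
  by (rule tangentI) (auto simp: of_coords_def intro: Df_transition_compose)

lemma of_coords_self: "c \<in> charts_at M p \<Longrightarrow> of_coords M p c a c = a"
  by (simp add: of_coords_def Df_transition_self)

lemma tangent_eqI:
  assumes "v \<in> tangent_space M p" "w \<in> tangent_space M p" "c \<in> charts_at M p" "v c = w c"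
  shows "v = w"
proof
  show "v d = w d" for d
    using tangentD(1)[OF assms(1,3), of d] tangentD(1)[OF assms(2,3), of d]
      tangentD(2)[OF assms(1), of d] tangentD(2)[OF assms(2), of d] assms(4)
    by (cases "d \<in> charts_at M p") auto
qed

lemma of_coords_tangent_self:
  "v \<in> tangent_space M p \<Longrightarrow> c \<in> charts_at M p \<Longrightarrow> of_coords M p c (v c) = v"
  by (rule tangent_eqI[OF of_coords_tangent]) (auto simp: of_coords_self)

lemma tangent_add:
  assumes "v \<in> tangent_space M p" "w \<in> tangent_space M p"
  shows "(\<lambda>c. v c + w c) \<in> tangent_space M p"
proof (rule tangentI)
  fix c d assume cd: "c \<in> charts_at M p" "d \<in> charts_at M p"
  show "v d + w d = Df (transition c d) (snd c p) (v c + w c)"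
    using tangentD(1)[OF assms(1) cd] tangentD(1)[OF assms(2) cd]
    by (simp add: linear_add[OF linear_Df_transition[OF cd]])
next
  fix c assume "c \<notin> charts_at M p"
  then show "v c + w c = 0" using tangentD(2)[OF assms(1)] tangentD(2)[OF assms(2)] by simp
qed

lemma tangent_scale:
  assumes "v \<in> tangent_space M p"
  shows "(\<lambda>c. r *\<^sub>R v c) \<in> tangent_space M p"
proof (rule tangentI)
  fix c d assume cd: "c \<in> charts_at M p" "d \<in> charts_at M p"
  show "r *\<^sub>R v d = Df (transition c d) (snd c p) (r *\<^sub>R v c)"
    using tangentD(1)[OF assms(1) cd] by (simp add: linear_scale[OF linear_Df_transition[OF cd]])
next
  fix c assume "c \<notin> charts_at M p"
  then show "r *\<^sub>R v c = 0" using tangentD(2)[OF assms(1)] by simp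
qed

lemma tangent_diff:
  assumes "v \<in> tangent_space M p" "w \<in> tangent_space M p"
  shows "(\<lambda>c. v c - w c) \<in> tangent_space M p"
  using tangent_add[OF assms(1) tangent_scale[OF assms(2), of "-1"]] by simp

lemma tangent_zero: "(\<lambda>c. 0) \<in> tangent_space M p"
proof (rule tangentI)
  fix c d assume cd: "c \<in> charts_at M p" "d \<in> charts_at M p"
  show "0 = Df (transition c d) (snd c p) 0" by (simp add: linear_0[OF linear_Df_transition[OF cd]])
qed auto

lemma tangent_sum:
  assumes "\<And>i. i \<in> I \<Longrightarrow> v i \<in> tangent_space M p"
  shows "(\<lambda>c. \<Sum>i\<in>I. v i c) \<in> tangent_space M p"
  using assms by (induction I rule: infinite_finite_induct) (auto intro: tangent_zero tangent_add)

text \<open>\<open>dirderiv\<close> works in a chart \<open>b\<close> of its own choice. The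
  derivative of the transition from \<open>b\<close> to \<open>c\<close> carries \<open>v b\<close>
  to \<open>v c\<close>, so the chain rule moves the computation to \<open>c\<close>.\<close>

lemma dirderiv_chart:
  assumes v: "v \<in> tangent_space M p" and c: "c \<in> charts_at M p"
    and f: "(\<lambda>x. f (chart_inv c x)) differentiable (at (snd c p))"
  shows "dirderiv M p v f = Df (\<lambda>x. f (chart_inv c x)) (snd c p) (v c)"
proof -
  define b where "b = (SOME b. b \<in> charts_at M p)"
  have b: "b \<in> charts_at M p" unfolding b_def by (rule someI[of _ c]) (rule c)
  note B = charts_atD[OF b] and C = charts_atD[OF c]
  have t: "(transition b c has_derivative Df (transition b c) (snd b p)) (at (snd b p))"
    by (rule smooth_on_has_derivative[OF smooth_transition[OF B(1) C(1)]]) (use B C in auto)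
  have "((\<lambda>x. f (chart_inv c x)) has_derivative Df (\<lambda>x. f (chart_inv c x)) (snd c p)) (at (transition b c (snd b p)))"
    using f by (simp add: chart_inv_left[OF B] frechet_derivative_works)
  from diff_chain_at[OF t this]
  have "((\<lambda>x. f (chart_inv c (transition b c x))) has_derivative
      (\<lambda>a. Df (\<lambda>x. f (chart_inv c x)) (snd c p) (Df (transition b c) (snd b p) a))) (at (snd b p))"
    by (simp add: comp_def)
  then have "((\<lambda>x. f (chart_inv b x)) has_derivative
      (\<lambda>a. Df (\<lambda>x. f (chart_inv c x)) (snd c p) (Df (transition b c) (snd b p) a))) (at (snd b p))"
    by (rule has_derivative_transform_within_open[OF _ overlap_open[OF B(1) C(1)]])
      (use B C in \<open>auto simp: chart_inv_left\<close>)
  from Df_eq[OF this] have "dirderiv M p v f = Df (\<lambda>x. f (chart_inv c x)) (snd c p) (Df (transition b c) (snd b p) (v b))"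
    by (simp add: dirderiv_def b_def[symmetric])
  then show ?thesis using tangentD(1)[OF v b c] by simp
qed

subsection \<open>The metric and the Christoffel symbols in a chart\<close>

definition met :: "('a, 'e) chart \<Rightarrow> 'e \<Rightarrow> 'e \<Rightarrow> 'e \<Rightarrow> real" where
  "met c x = metric_in M c (chart_inv c x)"

lemma met_chart: "c \<in> charts_at M p \<Longrightarrow> met c (snd c p) = metric_in M c p"
  by (simp add: met_def chart_inv_left[OF charts_atD])

lemma rmetric_chart:
  assumes "v \<in> tangent_space M p" "w \<in> tangent_space M p" "c \<in> charts_at M p"
  shows "rmetric M p v w = met c (snd c p) (v c) (w c)"
  using assms by (simp add: met_chart metric_in_def of_coords_tangent_self)

lemma local_metric_met:
  assumes c: "c \<in> ratlas M"
  shows "local_metric (snd c ` fst c) (met c)"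
proof
  have at: "c \<in> charts_at M (chart_inv c x)" "chart_inv c x \<in> points M" if "x \<in> snd c ` fst c" for x
    using that c chart_inv_left[OF c] dom_points[OF c] by (auto simp: charts_at_def)
  show "open (snd c ` fst c)" by (rule range_open[OF c])
  show "bilinear_family (snd c ` fst c) (met c)"
    unfolding bilinear_family_def
  proof (intro conjI ballI allI)
    show "bilinear (met c x)" if "x \<in> snd c ` fst c" for x
      using riem at[OF that] unfolding riemannian_manifold_def met_def by blast
    have "smooth_fun_on M (fst c) (\<lambda>q. metric_in M c q a b)" for a b
      using riem c unfolding riemannian_manifold_def by blast
    then show "smooth_on (snd c ` fst c) (\<lambda>x. met c x a b)" for a b
      using c unfolding smooth_fun_on_def met_def by (metis Int_absorb)
  qed
  fix x assume x: "x \<in> snd c ` fst c"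
  show "met c x a b = met c x b a" for a b
    using riem at[OF x] of_coords_tangent[OF at(1)[OF x]]
    unfolding riemannian_manifold_def met_def metric_in_def by blast
  show "0 < met c x a a" if "a \<noteq> 0" for a
  proof -
    have "of_coords M (chart_inv c x) c a \<noteq> (\<lambda>_. 0)"
      using of_coords_self[OF at(1)[OF x], of a] that by metis
    then show ?thesis
      using riem at[OF x] of_coords_tangent[OF at(1)[OF x]]
      unfolding riemannian_manifold_def met_def metric_in_def by blast
  qed
qed

abbreviation Gam :: "('a, 'e) chart \<Rightarrow> 'e \<Rightarrow> 'e \<Rightarrow> 'e \<Rightarrow> 'e" where
  "Gam c \<equiv> local_metric.chr (met c)"

lemma christoffel_chart:
  assumes c: "c \<in> charts_at M p"
  shows "christoffel M c p = Gam c (snd c p)"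
proof -
  note C = charts_atD[OF c]
  interpret local_metric "snd c ` fst c" "met c" by (rule local_metric_met[OF C(1)])
  have "dirderiv M p (of_coords M p c w) (\<lambda>q. metric_in M c q a b) = dG (snd c p) w a b" for w a b
  proof -
    have "(\<lambda>x. metric_in M c (chart_inv c x) a b) differentiable (at (snd c p))"
      using smooth_on_differentiable[OF bilinear_familyD(2)[OF family], of "snd c p"] C by (auto simp: met_def)
    from dirderiv_chart[where f="\<lambda>q. metric_in M c q a b", OF of_coords_tangent[OF c] c this]
    show ?thesis by (simp add: dG_def met_def of_coords_self[OF c])
  qed
  then show ?thesis
    by (simp add: christoffel_def chr_def is_levi_civita_def met_chart[OF c])
qed

subsection \<open>Smooth vector fields from coordinate expressions\<close>

lemma smooth_fun_onD:
  "smooth_fun_on M W f \<Longrightarrow> c \<in> ratlas M \<Longrightarrow> smooth_on (snd c ` (W \<inter> fst c)) (\<lambda>x. f (chart_inv c x))"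
  by (simp add: smooth_fun_on_def)

text \<open>Smoothness is required of the component in every chart \<open>d\<close>, read in every
  chart \<open>b\<close>. On the triple overlap this component is the derivative of the transition
  from \<open>c\<close> to \<open>d\<close> applied to \<open>A\<close>, all composed with the
  transition from \<open>b\<close> to \<open>c\<close>.\<close>

lemma smooth_coord_field:
  assumes c: "c \<in> ratlas M" and A: "smooth_on (snd c ` fst c) A"
  shows "smooth_vfield_on M (fst c) (\<lambda>q. of_coords M q c (A (snd c q)))"
  unfolding smooth_vfield_on_def smooth_fun_on_def
proof (intro conjI ballI)
  show "of_coords M q c (A (snd c q)) \<in> tangent_space M q" if "q \<in> fst c" for q
    by (rule of_coords_tangent[OF charts_atI[OF c that]])
  fix d b assume d: "d \<in> ratlas M" and b: "b \<in> ratlas M"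
  define S where "S = snd b ` (fst c \<inter> fst d \<inter> fst b)"
  have S: "open S"
    unfolding S_def by (rule image_open[OF b]) (simp add: dom_open c d openin_Int)
  have tr: "smooth_on S (transition b c)"
    by (rule smooth_on_subset[OF smooth_transition[OF b c]]) (auto simp: S_def)
  have into: "transition b c ` S \<subseteq> snd c ` (fst c \<inter> fst d)"
    by (auto simp: S_def chart_inv_left[OF b])
  have lin: "linear (Df (transition c d) (transition b c x))" if "x \<in> S" for x
    by (rule smooth_on_linear_Df[OF smooth_transition[OF c d]]) (use into that in blast)
  have smA: "smooth_on S (\<lambda>x. A (transition b c x))"
    by (rule smooth_on_compose[OF A tr S range_open[OF c]]) (use into in blast)
  have "smooth_on S (\<lambda>x. Df (transition c d) (transition b c x) a)" for a
    by (rule smooth_on_compose[OF smooth_on_Df[OF smooth_transition[OF c d]] tr S overlap_open[OF c d] into])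
  from smooth_on_linear_family[where L="\<lambda>x. Df (transition c d) (transition b c x)", OF S lin this smA]
  have "smooth_on S (\<lambda>x. Df (transition c d) (transition b c x) (A (transition b c x)))" .
  then show "smooth_on (snd b ` (fst c \<inter> fst d \<inter> fst b))
      (\<lambda>x. of_coords M (chart_inv b x) c (A (transition b c x)) d)"
    unfolding S_def[symmetric]
    by (rule smooth_on_cong[OF _ S]) (auto simp: S_def chart_inv_left[OF b] of_coords_def charts_at_def d)
qed

lemma smooth_vfield_onD:
  assumes "smooth_vfield_on M W X"
  shows "p \<in> W \<Longrightarrow> X p \<in> tangent_space M p"
    "c \<in> ratlas M \<Longrightarrow> smooth_on (snd c ` (W \<inter> fst c)) (\<lambda>x. X (chart_inv c x) c)"
proof -
  show "p \<in> W \<Longrightarrow> X p \<in> tangent_space M p" using assms by (simp add: smooth_vfield_on_def)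
  assume c: "c \<in> ratlas M"
  then have "smooth_fun_on M (W \<inter> fst c) (\<lambda>q. X q c)" using assms by (simp add: smooth_vfield_on_def)
  from smooth_fun_onD[OF this c] show "smooth_on (snd c ` (W \<inter> fst c)) (\<lambda>x. X (chart_inv c x) c)"
    by (simp add: Int_assoc)
qed

lemma ortho_chart:
  assumes c: "c \<in> charts_at M p" and b: "\<And>i. i < DIM('e) \<Longrightarrow> b i \<in> tangent_space M p"
  shows "orthonormal_at M p b \<longleftrightarrow> inner_form.ortho (met c (snd c p)) (\<lambda>i. b i c) DIM('e)"
proof -
  have "inner_form (met c (snd c p))"
    by (rule local_metric.inner_form[OF local_metric_met]) (use charts_atD[OF c] in auto)
  then show ?thesis
    using b rmetric_chart[OF b b c] by (simp add: orthonormal_at_def inner_form.ortho_def)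
qed

text \<open>Shows that the choice in \<open>frame\<close> succeeds: a smooth orthonormal frame in
  one chart is a witness.\<close>

lemma frame_exists:
  assumes "p \<in> points M"
  shows "\<exists>W. openin (rtop M) W \<and> p \<in> W \<and> orthonormal_frame_on M W (frame M p)"
proof -
  obtain c where c: "c \<in> charts_at M p" using charts_at_exists[OF assms] by blast
  note C = charts_atD[OF c]
  interpret local_metric "snd c ` fst c" "met c" by (rule local_metric_met[OF C(1)])
  obtain E where E: "\<And>i. i < DIM('e) \<Longrightarrow> smooth_on (snd c ` fst c) (E i)"
    "\<And>x. x \<in> snd c ` fst c \<Longrightarrow> inner_form.ortho (met c x) (\<lambda>i. E i x) DIM('e)"
    by (rule smooth_orthonormal_frame) (rule that)
  define e where "e i q = of_coords M q c (E i (snd c q))" for i q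
  have "orthonormal_frame_on M (fst c) e"
    unfolding orthonormal_frame_on_def
  proof (intro conjI allI impI ballI)
    show "smooth_vfield_on M (fst c) (e i)" if "i < DIM('e)" for i
      unfolding e_def by (rule smooth_coord_field[OF C(1) E(1)[OF that]])
    fix q assume q: "q \<in> fst c"
    have cq: "c \<in> charts_at M q" by (rule charts_atI[OF C(1) q])
    have "(\<lambda>i. e i q c) = (\<lambda>i. E i (snd c q))"
      by (simp add: e_def of_coords_self[OF cq])
    then show "orthonormal_at M q (\<lambda>i. e i q)"
      using E(2)[of "snd c q"] q by (subst ortho_chart[OF cq]) (auto simp: e_def of_coords_tangent[OF cq])
  qed
  then show ?thesis
    unfolding frame_def
    by (intro someI[where P="\<lambda>e. \<exists>W. openin (rtop M) W \<and> p \<in> W \<and> orthonormal_frame_on M W e"])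
      (use dom_open[OF C(1)] C(2) in blast)
qed

end

context riem_mfd
begin

text \<open>A transition map is an isometry of codimension \<open>0\<close>, so its second fundamental form vanishes;
  this is the transformation law of the Christoffel symbols.\<close>

lemma christoffel_transition:
  assumes c: "c \<in> charts_at M p" and d: "d \<in> charts_at M p"
  defines "x \<equiv> snd c p"
  shows "Df (\<lambda>y. Df (transition c d) y b) x a
      + Gam d (snd d p) (Df (transition c d) x a) (Df (transition c d) x b)
    = Df (transition c d) x (Gam c x a b)"
proof -
  note C = charts_atD[OF c] and D = charts_atD[OF d]
  define S where "S = snd c ` (fst c \<inter> fst d)"
  interpret S: local_metric S "met c"
    by (rule local_metric_subset[OF local_metric_met[OF C(1)]]) (auto simp: S_def overlap_open C(1) D(1))
  interpret D: local_metric "snd d ` fst d" "met d" by (rule local_metric_met[OF D(1)])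
  interpret local_immersion "snd d ` fst d" "met d" S "transition c d" "met c"
  proof
    show "open S" unfolding S_def by (rule overlap_open[OF C(1) D(1)])
    show "smooth_on S (transition c d)" unfolding S_def by (rule smooth_transition[OF C(1) D(1)])
    show "transition c d ` S \<subseteq> snd d ` fst d" by (auto simp: S_def chart_inv_left[OF C(1)])
    fix y a b assume "y \<in> S"
    then obtain q where q: "q \<in> fst c" "q \<in> fst d" "y = snd c q" by (auto simp: S_def)
    have at: "c \<in> charts_at M q" "d \<in> charts_at M q" using charts_atI C D q by blast+
    have t: "of_coords M q c a \<in> tangent_space M q" for a by (rule of_coords_tangent[OF at(1)])
    have "of_coords M q c a d = Df (transition c d) y a" for a using at by (simp add: of_coords_def q)
    then show "met d (transition c d y) (Df (transition c d) y a) (Df (transition c d) y b) = met c y a b"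
      using rmetric_chart[OF t t at(1), of a b] rmetric_chart[OF t t at(2), of a b]
      by (simp add: of_coords_self[OF at(1)] q chart_inv_left[OF C(1)])
  qed
  have x: "x \<in> S" using C D by (auto simp: S_def x_def)
  interpret inner_form "met d (transition c d x)" by (rule inner_F[OF x])
  have "sff x a b = 0"
  proof (rule g_eqI)
    fix w
    \<comment> \<open>The inverse transition supplies a preimage, so every \<open>w\<close> is
      tangential, and a vector normal to all of them is 0.\<close>
    have "Df (transition c d) x (Df (transition d c) (snd d p) w) = w"
      using Df_transition_compose[OF d c d, of w] Df_transition_self[OF d, of w] by (simp add: x_def)
    then show "met d (transition c d x) (sff x a b) w = met d (transition c d x) 0 w"
      using sff_normal[OF x, of a b "Df (transition d c) (snd d p) w"] by (simp add: g_simps)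
  qed
  then show ?thesis
    by (simp add: sff_def cd_def) (simp add: x_def chart_inv_left[OF C(1)] C(2))
qed

end

subsection \<open>Sections along a smooth map\<close>

locale riem_map = M: riem_mfd M + N: riem_mfd N
  for M :: "('a, 'e::euclidean_space) riem" and N :: "('b, 'f::euclidean_space) riem" +
  fixes \<phi> :: "'a \<Rightarrow> 'b"
  assumes smooth_phi: "smooth_map M N \<phi>"
begin

abbreviation pre :: "('b, 'f) chart \<Rightarrow> 'a set" where
  "pre d \<equiv> {p \<in> points M. \<phi> p \<in> fst d}"

abbreviation rep :: "('a, 'e) chart \<Rightarrow> ('b, 'f) chart \<Rightarrow> 'e \<Rightarrow> 'f" where
  "rep c d x \<equiv> snd d (\<phi> (chart_inv c x))"

text \<open>All coordinate computations for \<open>\<phi>\<close> take place on such sets; the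
  parameter \<open>U\<close> cuts them down to the domain of a local frame or of a second
  chart.\<close>

definition dm :: "'a set \<Rightarrow> ('a, 'e) chart \<Rightarrow> ('b, 'f) chart \<Rightarrow> 'e set" where
  "dm U c d = snd c ` (U \<inter> pre d \<inter> fst c)"

lemma pre_open: "d \<in> ratlas N \<Longrightarrow> openin (rtop M) (pre d)"
  by (rule openin_continuous_map_preimage[OF _ N.dom_open]) (use smooth_phi in \<open>simp_all add: smooth_map_def\<close>)

lemma dm_open: "openin (rtop M) U \<Longrightarrow> c \<in> ratlas M \<Longrightarrow> d \<in> ratlas N \<Longrightarrow> open (dm U c d)"
  unfolding dm_def by (rule M.image_open) (auto intro: pre_open)

lemma dmI:
  "c \<in> charts_at M p \<Longrightarrow> d \<in> charts_at N (\<phi> p) \<Longrightarrow> p \<in> U \<Longrightarrow> snd c p \<in> dm U c d"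
  using M.charts_at_points[of c p] by (auto simp: dm_def charts_at_def)

lemma dmE:
  assumes "x \<in> dm U c d" "c \<in> ratlas M" "d \<in> ratlas N"
  obtains q where "q \<in> U" "c \<in> charts_at M q" "d \<in> charts_at N (\<phi> q)" "x = snd c q" "chart_inv c x = q"
  using assms M.chart_inv_left[OF assms(2)] by (auto simp: dm_def charts_at_def)

lemma smooth_rep:
  assumes "c \<in> ratlas M" "d \<in> ratlas N"
  shows "smooth_on (dm U c d) (rep c d)"
proof -
  have "smooth_on (snd c ` (pre d \<inter> fst c)) (rep c d)"
    using smooth_phi assms by (simp add: smooth_map_def smooth_fun_on_def)
  then show ?thesis by (rule smooth_on_subset) (auto simp: dm_def)
qed

lemma along:
  assumes "openin (rtop M) U" "c \<in> ratlas M" "d \<in> ratlas N"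
  shows "along_map (snd d ` fst d) (N.met d) (dm U c d) (rep c d)"
proof -
  interpret local_metric "snd d ` fst d" "N.met d" by (rule N.local_metric_met[OF assms(3)])
  show ?thesis
  proof
    show "open (dm U c d)" by (rule dm_open[OF assms])
    show "smooth_on (dm U c d) (rep c d)" by (rule smooth_rep[OF assms(2,3)])
    show "rep c d ` dm U c d \<subseteq> snd d ` fst d"
    proof
      fix y assume "y \<in> rep c d ` dm U c d"
      then obtain x where x: "x \<in> dm U c d" "y = rep c d x" by blast
      obtain q where "d \<in> charts_at N (\<phi> q)" "chart_inv c x = q" using dmE[OF x(1) assms(2,3)] by metis
      then show "y \<in> snd d ` fst d" using x by (auto simp: charts_at_def)
    qed
  qed
qed

lemma phi_points: "p \<in> points M \<Longrightarrow> \<phi> p \<in> points N"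
  using smooth_phi by (auto simp: smooth_map_def continuous_map_def)

lemma open_points: "openin (rtop M) (points M)"
  by simp

lemma differential_chart:
  assumes v: "v \<in> tangent_space M p" and c: "c \<in> charts_at M p" and d: "d \<in> charts_at N (\<phi> p)"
  shows "differential M N \<phi> p v d = Df (rep c d) (snd c p) (v c)"
proof -
  have "rep c d differentiable (at (snd c p))"
    by (rule smooth_on_differentiable[OF smooth_rep dmI[OF c d M.charts_at_points[OF c]]])
      (use M.charts_atD[OF c] N.charts_atD[OF d] in auto)
  from M.dirderiv_chart[where f="\<lambda>q. snd d (\<phi> q)", OF v c this] d
  show ?thesis by (simp add: differential_def)
qed

lemma rep_transition:
  assumes c: "c \<in> charts_at M p" and d: "d \<in> charts_at N (\<phi> p)" and e: "e \<in> charts_at N (\<phi> p)"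
  shows "Df (rep c e) (snd c p) a = Df (transition d e) (snd d (\<phi> p)) (Df (rep c d) (snd c p) a)"
proof -
  note C = M.charts_atD[OF c] and D = N.charts_atD[OF d] and E = N.charts_atD[OF e]
  define S where "S = dm (pre e) c d"
  have S: "open S" unfolding S_def by (rule dm_open[OF pre_open]) (use C D E in auto)
  have x: "snd c p \<in> S"
    unfolding S_def using dmI[OF c d] E M.charts_at_points[OF c] by simp
  have q: "\<exists>q. q \<in> pre e \<and> d \<in> charts_at N (\<phi> q) \<and> chart_inv c y = q" if "y \<in> S" for y
    using dmE[OF that[unfolded S_def] C(1) D(1)] by metis
  have "Df (rep c e) (snd c p) = Df (\<lambda>y. transition d e (rep c d y)) (snd c p)"
  proof (rule Df_cong_open[OF S x])
    fix y assume "y \<in> S"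
    then obtain q where "d \<in> charts_at N (\<phi> q)" "chart_inv c y = q" using q by blast
    then show "rep c e y = transition d e (rep c d y)"
      by (simp add: N.chart_inv_left N.charts_atD)
  qed
  also have "\<dots> = (\<lambda>a. Df (transition d e) (rep c d (snd c p)) (Df (rep c d) (snd c p) a))"
  proof (rule Df_compose[OF _ N.smooth_transition[OF D(1) E(1)] _ x])
    show "smooth_on S (rep c d)" unfolding S_def by (rule smooth_rep[OF C(1) D(1)])
    show "rep c d ` S \<subseteq> snd d ` (fst d \<inter> fst e)"
    proof
      fix z assume "z \<in> rep c d ` S"
      then obtain y where "y \<in> S" "z = rep c d y" by blast
      then show "z \<in> snd d ` (fst d \<inter> fst e)" using q[of y] by (auto simp: charts_at_def)
    qed
  qed
  finally show ?thesis by (simp add: M.chart_inv_left[OF C])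
qed

lemma differential_tangent:
  assumes v: "v \<in> tangent_space M p" and p: "p \<in> points M"
  shows "differential M N \<phi> p v \<in> tangent_space N (\<phi> p)"
proof (rule N.tangentI)
  obtain c where c: "c \<in> charts_at M p" using M.charts_at_exists[OF p] by blast
  fix d e assume d: "d \<in> charts_at N (\<phi> p)" and e: "e \<in> charts_at N (\<phi> p)"
  show "differential M N \<phi> p v e = Df (transition d e) (snd d (\<phi> p)) (differential M N \<phi> p v d)"
    unfolding differential_chart[OF v c d] differential_chart[OF v c e] by (rule rep_transition[OF c d e])
qed (simp add: differential_def)

text \<open>A version of \<open>smooth_section_along\<close> on an open set, since the smoothness of
  \<open>\<tau>\<close> is established on the domains of local frames.\<close>

definition smooth_along :: "'a set \<Rightarrow> ('a, 'b, 'f) section_along \<Rightarrow> bool" where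
  "smooth_along U V \<longleftrightarrow> openin (rtop M) U \<and> (\<forall>p\<in>U. V p \<in> tangent_space N (\<phi> p)) \<and>
    (\<forall>c\<in>ratlas M. \<forall>d\<in>ratlas N. smooth_on (dm U c d) (\<lambda>x. V (chart_inv c x) d))"

lemma smooth_alongD:
  assumes "smooth_along U V"
  shows "openin (rtop M) U" "p \<in> U \<Longrightarrow> V p \<in> tangent_space N (\<phi> p)"
    "c \<in> ratlas M \<Longrightarrow> d \<in> ratlas N \<Longrightarrow> smooth_on (dm U c d) (\<lambda>x. V (chart_inv c x) d)"
  using assms by (simp_all add: smooth_along_def)

lemma pull_cov_chart:
  assumes v: "v \<in> tangent_space M p" and c: "c \<in> charts_at M p" and d: "d \<in> charts_at N (\<phi> p)"
    and V: "smooth_on S (\<lambda>x. V (chart_inv c x) d)" "snd c p \<in> S"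
  shows "pull_cov M N \<phi> v V p d = along_map.cd (N.met d) (rep c d) (\<lambda>x. V (chart_inv c x) d) (snd c p) (v c)"
proof -
  note C = M.charts_atD[OF c] and D = N.charts_atD[OF d]
  interpret along_map "snd d ` fst d" "N.met d" "dm (points M) c d" "rep c d"
    by (rule along[OF open_points C(1) D(1)])
  show ?thesis
    using d M.dirderiv_chart[where f="\<lambda>q. V q d", OF v c smooth_on_differentiable[OF V]]
    by (simp add: pull_cov_def cd_def N.christoffel_chart[OF d] differential_chart[OF v c d] M.chart_inv_left[OF C])
qed

lemma smooth_along_differential:
  assumes U: "openin (rtop M) U" and Y: "smooth_vfield_on M U Y"
  shows "smooth_along U (\<lambda>q. differential M N \<phi> q (Y q))"
  unfolding smooth_along_def
proof (intro conjI ballI U)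
  show "differential M N \<phi> p (Y p) \<in> tangent_space N (\<phi> p)" if "p \<in> U" for p
    by (rule differential_tangent[OF M.smooth_vfield_onD(1)[OF Y that]]) (use U that openin_subset in blast)
  fix c d assume c: "c \<in> ratlas M" and d: "d \<in> ratlas N"
  have "smooth_on (dm U c d) (\<lambda>x. Y (chart_inv c x) c)"
    by (rule smooth_on_subset[OF M.smooth_vfield_onD(2)[OF Y c]]) (auto simp: dm_def)
  from smooth_on_deriv_along[OF dm_open[OF U c d] smooth_rep[OF c d] this]
  show "smooth_on (dm U c d) (\<lambda>x. differential M N \<phi> (chart_inv c x) (Y (chart_inv c x)) d)"
  proof (rule smooth_on_cong[OF _ dm_open[OF U c d]])
    fix x assume "x \<in> dm U c d"
    then obtain q where q: "q \<in> U" "c \<in> charts_at M q" "d \<in> charts_at N (\<phi> q)" "x = snd c q" "chart_inv c x = q"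
      using dmE[OF _ c d] by metis
    show "Df (rep c d) x (Y (chart_inv c x) c) = differential M N \<phi> (chart_inv c x) (Y (chart_inv c x)) d"
      using differential_chart[OF M.smooth_vfield_onD(1)[OF Y q(1)] q(2,3)]
      unfolding q(4)[symmetric] q(5) by simp
  qed
qed

text \<open>Changing the chart of \<open>N\<close> from \<open>d\<close> to \<open>e\<close>, the
  ordinary derivative of the section acquires a term with the second derivative of the transition
  map. The transformation law of the Christoffel symbols compensates exactly this term.\<close>

lemma pull_cov_tangent:
  assumes V: "smooth_along U V" and p: "p \<in> U" and v: "v \<in> tangent_space M p"
  shows "pull_cov M N \<phi> v V p \<in> tangent_space N (\<phi> p)"
proof (rule N.tangentI)
  note U = smooth_alongD(1)[OF V]
  obtain c where c: "c \<in> charts_at M p"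
    using M.charts_at_exists U p openin_subset by blast
  note C = M.charts_atD[OF c]
  fix d e assume d: "d \<in> charts_at N (\<phi> p)" and e: "e \<in> charts_at N (\<phi> p)"
  note D = N.charts_atD[OF d] and E = N.charts_atD[OF e]
  define x where "x = snd c p"
  define S where "S = dm (U \<inter> pre e) c d"
  have Uo: "openin (rtop M) (U \<inter> pre e)" using U pre_open[OF E(1)] by blast
  have S: "open S" unfolding S_def by (rule dm_open[OF Uo C(1) D(1)])
  have x: "x \<in> S"
    unfolding S_def x_def using dmI[OF c d] E p M.charts_at_points[OF c] by simp
  have xd: "x \<in> dm U c d" and xe: "x \<in> dm U c e" unfolding x_def using dmI c d e p by blast+
  interpret D: along_map "snd d ` fst d" "N.met d" "dm U c d" "rep c d" by (rule along[OF U C(1) D(1)])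
  interpret E: along_map "snd e ` fst e" "N.met e" "dm U c e" "rep c e" by (rule along[OF U C(1) E(1)])
  define T where "T = transition d e"
  define Vd where "Vd y = V (chart_inv c y) d" for y
  define Ve where "Ve y = V (chart_inv c y) e" for y
  have q: "\<exists>q. q \<in> U \<and> q \<in> pre e \<and> d \<in> charts_at N (\<phi> q) \<and> e \<in> charts_at N (\<phi> q) \<and> chart_inv c y = q" if "y \<in> S" for y
    using dmE[OF that[unfolded S_def] C(1) D(1)] N.charts_atI[OF E(1)] by blast
  have smVd: "smooth_on (dm U c d) Vd" "smooth_on (dm U c e) Ve"
    unfolding Vd_def Ve_def by (rule smooth_alongD(3)[OF V C(1)]; rule D E)+
  have smVd': "smooth_on S Vd" by (rule smooth_on_subset[OF smVd(1)]) (auto simp: S_def dm_def)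
  have smT: "smooth_on (snd d ` (fst d \<inter> fst e)) T" unfolding T_def by (rule N.smooth_transition[OF D(1) E(1)])
  have smF: "smooth_on S (rep c d)" unfolding S_def by (rule smooth_rep[OF C(1) D(1)])
  have into: "rep c d ` S \<subseteq> snd d ` (fst d \<inter> fst e)"
  proof
    fix z assume "z \<in> rep c d ` S"
    then obtain y where "y \<in> S" "z = rep c d y" by blast
    then show "z \<in> snd d ` (fst d \<inter> fst e)" using q[of y] by (auto simp: charts_at_def)
  qed
  have F: "rep c d x = snd d (\<phi> p)" "rep c e x = snd e (\<phi> p)" by (simp_all add: x_def M.chart_inv_left[OF C])
  have Vx: "Ve y = Df T (rep c d y) (Vd y)" if y: "y \<in> S" for y
  proof -
    obtain r where r: "r \<in> U" "d \<in> charts_at N (\<phi> r)" "e \<in> charts_at N (\<phi> r)" "chart_inv c y = r"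
      using q[OF y] by blast
    show ?thesis
      unfolding Ve_def Vd_def r(4) T_def by (rule N.tangentD(1)[OF smooth_alongD(2)[OF V r(1)] r(2,3)])
  qed
  have lin: "linear (Df T (rep c d y))" if "y \<in> S" for y
    by (rule smooth_on_linear_Df[OF smT]) (use into that in blast)
  have sm: "smooth_on S (\<lambda>y. Df T (rep c d y) b)" for b
    by (rule smooth_on_compose[OF smooth_on_Df[OF smT] smF S _ into])
      (rule N.overlap_open[OF D(1) E(1)])
  have "Df Ve x a = Df (\<lambda>z. Df T z (Vd x)) (rep c d x) (Df (rep c d) x a) + Df T (rep c d x) (Df Vd x a)" for a
  proof -
    have "Df Ve x a = Df (\<lambda>y. Df T (rep c d y) (Vd y)) x a"
      by (rule fun_cong[OF Df_cong_open[OF S x Vx]])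
    also have "\<dots> = Df (\<lambda>y. Df T (rep c d y) (Vd x)) x a + Df T (rep c d x) (Df Vd x a)"
      by (rule Df_linear_family[where L="\<lambda>y. Df T (rep c d y)", OF S lin sm smVd' x])
    also have "Df (\<lambda>y. Df T (rep c d y) (Vd x)) x = (\<lambda>a. Df (\<lambda>z. Df T z (Vd x)) (rep c d x) (Df (rep c d) x a))"
      by (rule Df_compose[OF smF smooth_on_Df[OF smT] into x])
    finally show ?thesis .
  qed
  moreover have "Df (rep c e) x a = Df T (rep c d x) (Df (rep c d) x a)" for a
    using rep_transition[OF c d e, of a] by (simp add: F(1) T_def) (simp add: x_def)
  ultimately have "E.cd Ve x (v c) = Df T (rep c d x) (D.cd Vd x (v c))"
    using N.christoffel_transition[OF d e, of "Vd x" "Df (rep c d) x (v c)"] Vx[OF x]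
    by (simp add: D.cd_def E.cd_def linear_add[OF N.linear_Df_transition[OF d e]] F T_def)
  then show "pull_cov M N \<phi> v V p e = Df (transition d e) (snd d (\<phi> p)) (pull_cov M N \<phi> v V p d)"
    using pull_cov_chart[where V=V, OF v c d smVd(1)[unfolded Vd_def] xd[unfolded x_def]]
      pull_cov_chart[where V=V, OF v c e smVd(2)[unfolded Ve_def] xe[unfolded x_def]]
    by (simp add: Vd_def[abs_def] Ve_def[abs_def] x_def[symmetric] F T_def)
qed (simp add: pull_cov_def)

end

subsection \<open>The Levi-Civita connection and the curvature in a chart\<close>

context riem_mfd
begin

lemma riem_map_id: "riem_map M M (\<lambda>x. x)"
proof
  have "smooth_on (snd c ` ({p \<in> points M. p \<in> fst d} \<inter> fst c)) (transition c d)"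
    if "c \<in> ratlas M" "d \<in> ratlas M" for c d
    by (rule smooth_on_subset[OF smooth_transition[OF that]]) auto
  then show "smooth_map M M (\<lambda>x. x)"
    unfolding smooth_map_def smooth_fun_on_def by (simp add: continuous_map_id[unfolded id_def])
qed

text \<open>Treating the Levi-Civita derivative as the induced derivative along the identity reduces
  the tangency of \<open>cov\<close> to \<open>pull_cov_tangent\<close>.\<close>

lemma cov_eq_pull_cov:
  assumes v: "v \<in> tangent_space M p"
  shows "cov M v Y p = pull_cov M M (\<lambda>x. x) v Y p"
proof
  interpret I: riem_map M M "\<lambda>x. x" by (rule riem_map_id)
  fix d
  show "cov M v Y p d = pull_cov M M (\<lambda>x. x) v Y p d"
  proof (cases "d \<in> charts_at M p")
    case True
    then have "differential M M (\<lambda>x. x) p v d = v d"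
      using I.differential_chart[OF v True True] Df_transition_self[OF True] by simp
    then show ?thesis by (simp add: cov_def pull_cov_def)
  qed (simp add: cov_def pull_cov_def)
qed

lemma cov_tangent:
  assumes U: "openin (rtop M) U" and Y: "smooth_vfield_on M U Y" and p: "p \<in> U" and v: "v \<in> tangent_space M p"
  shows "cov M v Y p \<in> tangent_space M p"
proof -
  interpret I: riem_map M M "\<lambda>x. x" by (rule riem_map_id)
  have "I.smooth_along U Y"
    unfolding I.smooth_along_def
  proof (intro conjI ballI U)
    fix c d assume c: "c \<in> ratlas M" and d: "d \<in> ratlas M"
    then have "smooth_on (snd c ` (U \<inter> fst d \<inter> fst c)) (\<lambda>x. Y (chart_inv c x) d)"
      using Y by (simp add: smooth_vfield_on_def smooth_fun_on_def)
    then show "smooth_on (I.dm U c d) (\<lambda>x. Y (chart_inv c x) d)"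
      by (rule smooth_on_subset) (auto simp: I.dm_def)
  qed (rule smooth_vfield_onD(1)[OF Y])
  from I.pull_cov_tangent[OF this p v] show ?thesis
    by (simp add: cov_eq_pull_cov[OF v])
qed

lemma cov_chart:
  assumes v: "v \<in> tangent_space M p" and c: "c \<in> charts_at M p"
    and Y: "smooth_on S (\<lambda>x. Y (chart_inv c x) c)" "snd c p \<in> S"
  shows "cov M v Y p c = along_map.cd (met c) (\<lambda>x. x) (\<lambda>x. Y (chart_inv c x) c) (snd c p) (v c)"
proof -
  interpret local_metric "snd c ` fst c" "met c" by (rule local_metric_met[OF charts_atD(1)[OF c]])
  show ?thesis
    using c dirderiv_chart[where f="\<lambda>q. Y q c", OF v c smooth_on_differentiable[OF Y]]
    by (simp add: cov_def self.cd_def christoffel_chart[OF c] chart_inv_left[OF charts_atD[OF c]])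
qed

lemma dirderiv_field:
  assumes "openin (rtop M) U" "smooth_vfield_on M U Y" "p \<in> U" "v \<in> tangent_space M p" "c \<in> charts_at M p"
  shows "dirderiv M p v (\<lambda>q. Y q c) = Df (\<lambda>x. Y (chart_inv c x) c) (snd c p) (v c)"
  by (rule dirderiv_chart[OF assms(4,5)], rule smooth_on_differentiable[OF smooth_vfield_onD(2)[OF assms(2)]])
    (use assms(3) charts_atD[OF assms(5)] in auto)

text \<open>Under a change of chart each directional derivative acquires a second derivative of the
  transition map, evaluated on the two fields. These terms are symmetric in the fields and cancel in
  the bracket.\<close>

lemma lie_bracket_tangent:
  assumes U: "openin (rtop M) U" and X: "smooth_vfield_on M U X" and Y: "smooth_vfield_on M U Y" and p: "p \<in> U"
  shows "lie_bracket M X Y p \<in> tangent_space M p"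
proof (rule tangentI)
  fix c d assume c: "c \<in> charts_at M p" and d: "d \<in> charts_at M p"
  note C = charts_atD[OF c] and D = charts_atD[OF d]
  define S where "S = snd c ` (U \<inter> fst d \<inter> fst c)"
  have S: "open S"
    unfolding S_def by (rule image_open[OF C(1) openin_Int[OF U dom_open[OF D(1)]]])
  define x where "x = snd c p"
  have x: "x \<in> S" using p C D by (auto simp: S_def x_def)
  have tr: "smooth_on S (transition c d)"
    by (rule smooth_on_subset[OF smooth_transition[OF C(1) D(1)]]) (auto simp: S_def)
  have *: "dirderiv M p v (\<lambda>q. Y q d) =
      Df (\<lambda>y. Df (transition c d) y (Y p c)) x (v c) + Df (transition c d) x (dirderiv M p v (\<lambda>q. Y q c))"
    if Y: "smooth_vfield_on M U Y" and v: "v \<in> tangent_space M p" for Y v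
  proof -
    have sm: "smooth_on S (\<lambda>y. Y (chart_inv c y) c)"
      by (rule smooth_on_subset[OF smooth_vfield_onD(2)[OF Y C(1)]]) (auto simp: S_def)
    have eq: "Df (transition c d) y (Y (chart_inv c y) c) = Y (chart_inv c y) d" if y: "y \<in> S" for y
    proof -
      obtain q where q: "q \<in> U" "q \<in> fst d" "q \<in> fst c" "y = snd c q" using y by (auto simp: S_def)
      have "Y q d = Df (transition c d) (snd c q) (Y q c)"
        by (rule tangentD(1)[OF smooth_vfield_onD(1)[OF Y q(1)]]) (use q C D charts_atI in auto)
      then show ?thesis by (simp add: q(4) chart_inv_left[OF C(1) q(3)])
    qed
    have "smooth_on S (\<lambda>y. Y (chart_inv c y) d)"
      by (rule smooth_on_cong[OF smooth_on_deriv_along[OF S tr sm] S eq])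
    then have "(\<lambda>y. Y (chart_inv c y) d) differentiable at (snd c p)"
      by (rule smooth_on_differentiable) (use x in \<open>simp add: x_def\<close>)
    then have "dirderiv M p v (\<lambda>q. Y q d) = Df (\<lambda>y. Y (chart_inv c y) d) x (v c)"
      unfolding x_def by (rule dirderiv_chart[where f="\<lambda>q. Y q d", OF v c])
    also have "\<dots> = Df (\<lambda>y. Df (transition c d) y (Y (chart_inv c y) c)) x (v c)"
      by (rule fun_cong[OF Df_cong_open[OF S x]]) (simp add: eq)
    also have "\<dots> = Df (\<lambda>y. Df (transition c d) y (Y (chart_inv c x) c)) x (v c)
        + Df (transition c d) x (Df (\<lambda>y. Y (chart_inv c y) c) x (v c))"
      by (rule Df_deriv_along[OF S tr sm x])
    finally show ?thesis
      by (simp add: dirderiv_field[OF U Y p v c] x_def chart_inv_left[OF C])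
  qed
  have "Df (\<lambda>y. Df (transition c d) y (Y p c)) x (X p c) = Df (\<lambda>y. Df (transition c d) y (X p c)) x (Y p c)"
    by (rule second_derivative_symmetric[OF S tr x])
  then show "lie_bracket M X Y p d = Df (transition c d) (snd c p) (lie_bracket M X Y p c)"
    using *[OF Y smooth_vfield_onD(1)[OF X p]] *[OF X smooth_vfield_onD(1)[OF Y p]] c d
    by (simp add: lie_bracket_def linear_diff[OF linear_Df_transition[OF c d]] x_def)
qed (simp add: lie_bracket_def)

abbreviation Rm :: "('a, 'e) chart \<Rightarrow> 'e \<Rightarrow> 'e \<Rightarrow> 'e \<Rightarrow> 'e \<Rightarrow> 'e" where
  "Rm c \<equiv> local_metric.curv (met c)"

text \<open>The terms with derivatives of \<open>X\<close> and \<open>Y\<close> in the two second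
  covariant derivatives add up to the derivative along the bracket, which is subtracted. What
  remains is the commutator for constant directions, hence an expression in the values at
  \<open>p\<close> alone.\<close>

lemma curvature_fields_chart:
  assumes U: "openin (rtop M) U" and X: "smooth_vfield_on M U X" and Y: "smooth_vfield_on M U Y"
    and Z: "smooth_vfield_on M U Z" and p: "p \<in> U" and c: "c \<in> charts_at M p"
  shows "curvature_fields M X Y Z p c = Rm c (snd c p) (X p c) (Y p c) (Z p c)"
proof -
  note C = charts_atD[OF c]
  define S where "S = snd c ` (U \<inter> fst c)"
  have S: "open S" unfolding S_def by (rule image_open[OF C(1) U])
  interpret L: local_metric "snd c ` fst c" "met c" by (rule local_metric_met[OF C(1)])
  interpret A: along_map "snd c ` fst c" "met c" S "\<lambda>x. x"
    by unfold_locales (use S in \<open>auto simp: S_def intro: smooth_on_ident\<close>)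
  define x where "x = snd c p"
  have x: "x \<in> S" using p C by (auto simp: S_def x_def)
  define loc where "loc X = (\<lambda>x. X (chart_inv c x) c)" for X :: "('a, 'e) vfield"
  have loc_p: "loc X x = X p c" for X by (simp add: loc_def x_def chart_inv_left[OF C])
  have sm: "smooth_on S (loc X)" if "smooth_vfield_on M U X" for X
    unfolding S_def loc_def by (rule smooth_vfield_onD(2)[OF that C(1)])
  have inner: "loc (\<lambda>q. cov M (Y q) Z q) y = A.cd (loc Z) y (loc Y y)"
    if Y: "smooth_vfield_on M U Y" and y: "y \<in> S" for Y y
  proof -
    obtain q where q: "q \<in> U" "q \<in> fst c" "y = snd c q" using y by (auto simp: S_def)
    have "cov M (Y q) Z q c = A.cd (loc Z) (snd c q) (Y q c)"
      unfolding loc_def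
      by (rule cov_chart[where Y=Z, OF smooth_vfield_onD(1)[OF Y q(1)] charts_atI[OF C(1) q(2)] sm[OF Z, unfolded loc_def]])
        (use y q in simp)
    then show ?thesis by (simp add: loc_def[of "\<lambda>q. cov M (Y q) Z q"] loc_def[of Y] q(3) chart_inv_left[OF C(1) q(2)])
  qed
  have outer: "cov M (X p) (\<lambda>q. cov M (Y q) Z q) p c = A.cd (\<lambda>y. A.cd (loc Z) y (loc Y y)) x (loc X x)"
    if X: "smooth_vfield_on M U X" and Y: "smooth_vfield_on M U Y" for X Y
  proof -
    have "smooth_on S (loc (\<lambda>q. cov M (Y q) Z q))"
      by (rule smooth_on_cong[OF A.smooth_cd[OF sm[OF Z] sm[OF Y]] S]) (simp add: inner[OF Y])
    from cov_chart[where Y="\<lambda>q. cov M (Y q) Z q", OF smooth_vfield_onD(1)[OF X p] c this[unfolded loc_def]] x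
    have "cov M (X p) (\<lambda>q. cov M (Y q) Z q) p c = A.cd (loc (\<lambda>q. cov M (Y q) Z q)) x (loc X x)"
      by (simp add: x_def loc_def chart_inv_left[OF C])
    also have "\<dots> = A.cd (\<lambda>y. A.cd (loc Z) y (loc Y y)) x (loc X x)"
      by (rule A.cd_cong[OF x inner[OF Y]])
    finally show ?thesis .
  qed
  have lie: "lie_bracket M X Y p c = Df (loc Y) x (loc X x) - Df (loc X) x (loc Y x)"
    using dirderiv_field[OF U Y p smooth_vfield_onD(1)[OF X p] c] dirderiv_field[OF U X p smooth_vfield_onD(1)[OF Y p] c] c
    by (simp add: lie_bracket_def loc_p) (simp add: loc_def x_def)
  have "cov M (lie_bracket M X Y p) Z p c = A.cd (loc Z) x (lie_bracket M X Y p c)"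
    unfolding x_def loc_def
    by (rule cov_chart[where Y=Z, OF lie_bracket_tangent[OF U X Y p] c sm[OF Z, unfolded loc_def]]) (use x in \<open>simp add: x_def\<close>)
  moreover have "A.cd (\<lambda>y. A.cd (loc Z) y (loc Y y)) x a = A.cd (\<lambda>y. A.cd (loc Z) y (loc Y x)) x a + A.cd (loc Z) x (Df (loc Y) x a)"
    if Y: "smooth_vfield_on M U Y" for Y a
    by (rule A.cd_linear_family[where L="A.cd (loc Z)", OF A.linear_cd[OF sm[OF Z]] A.smooth_cd_const[OF sm[OF Z]] sm[OF Y] x])
  moreover have "A.cd (\<lambda>y. A.cd (loc Z) y (loc Y x)) x (loc X x) - A.cd (\<lambda>y. A.cd (loc Z) y (loc X x)) x (loc Y x)
      = Rm c x (loc X x) (loc Y x) (loc Z x)"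
    using A.cd_commute[OF sm[OF Z] x, of "loc Y x" "loc X x"] by (simp add: L.curv_def)
  ultimately have "curvature_fields M X Y Z p c = Rm c x (loc X x) (loc Y x) (loc Z x)"
    using X Y by (simp add: curvature_fields_def outer lie linear_diff[OF A.linear_cd[OF sm[OF Z] x]])
  then show ?thesis by (simp add: loc_p) (simp add: x_def)
qed

text \<open>The choice in \<open>curvature\<close> ranges over local extensions of the three
  vectors. Fields with constant coordinates in one chart show that extensions exist, and
  \<open>curvature_fields_chart\<close> shows that all of them give the same value.\<close>

lemma curvature_chart:
  assumes u: "u \<in> tangent_space M p" and v: "v \<in> tangent_space M p" and w: "w \<in> tangent_space M p"
    and p: "p \<in> points M"
  shows "curvature M p u v w c = (if c \<in> charts_at M p then Rm c (snd c p) (u c) (v c) (w c) else 0)"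
proof -
  define P where "P r \<longleftrightarrow> (\<exists>S U V W. openin (rtop M) S \<and> p \<in> S \<and>
     smooth_vfield_on M S U \<and> smooth_vfield_on M S V \<and> smooth_vfield_on M S W \<and>
     U p = u \<and> V p = v \<and> W p = w \<and> r = curvature_fields M U V W p)" for r
  obtain b where b: "b \<in> charts_at M p" using charts_at_exists[OF p] by blast
  note B = charts_atD[OF b]
  define ext where "ext u q = of_coords M q b (u b)" for u :: "('a, 'e) tvec" and q
  have sm: "smooth_vfield_on M (fst b) (ext u)" for u
    unfolding ext_def by (rule smooth_coord_field[OF B(1) smooth_on_const])
  have ext: "ext u p = u" if "u \<in> tangent_space M p" for u
    unfolding ext_def by (rule of_coords_tangent_self[OF that b])
  have "P (curvature_fields M (ext u) (ext v) (ext w) p)"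
    unfolding P_def using dom_open[OF B(1)] B(2) sm ext u v w by metis
  then have "P (curvature M p u v w)"
    unfolding curvature_def P_def[symmetric] by (rule someI[of P])
  then obtain S U V W where "openin (rtop M) S" "p \<in> S" "smooth_vfield_on M S U" "smooth_vfield_on M S V"
     "smooth_vfield_on M S W" "U p = u" "V p = v" "W p = w" "curvature M p u v w = curvature_fields M U V W p"
    unfolding P_def by blast
  then show ?thesis
    using curvature_fields_chart[of S U V W p c] by (simp add: curvature_fields_def cov_def)
qed

subsection \<open>Global vector fields\<close>

lemma smooth_vfield_on_cong:
  assumes X: "smooth_vfield_on M U X" and U: "openin (rtop M) U" and eq: "\<And>q. q \<in> U \<Longrightarrow> X q = Y q"
  shows "smooth_vfield_on M U Y"
  unfolding smooth_vfield_on_def smooth_fun_on_def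
proof (intro conjI ballI)
  show "Y q \<in> tangent_space M q" if "q \<in> U" for q using smooth_vfield_onD(1)[OF X that] eq[OF that] by simp
  fix c d assume c: "c \<in> ratlas M" and d: "d \<in> ratlas M"
  have "smooth_on (snd d ` (U \<inter> fst c \<inter> fst d)) (\<lambda>x. X (chart_inv d x) c)"
    using X c d by (simp add: smooth_vfield_on_def smooth_fun_on_def)
  then show "smooth_on (snd d ` (U \<inter> fst c \<inter> fst d)) (\<lambda>x. Y (chart_inv d x) c)"
    by (rule smooth_on_cong[OF _ image_open[OF d openin_Int[OF U dom_open[OF c]]]])
      (auto simp: chart_inv_left[OF d] eq)
qed

lemma smooth_vfield_on_Un:
  assumes X1: "smooth_vfield_on M U1 X" and U1: "openin (rtop M) U1"
    and X2: "smooth_vfield_on M U2 X" and U2: "openin (rtop M) U2"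
  shows "smooth_vfield_on M (U1 \<union> U2) X"
  unfolding smooth_vfield_on_def smooth_fun_on_def
proof (intro conjI ballI)
  show "X q \<in> tangent_space M q" if "q \<in> U1 \<union> U2" for q
    using smooth_vfield_onD(1)[OF X1] smooth_vfield_onD(1)[OF X2] that by blast
  fix c d assume c: "c \<in> ratlas M" and d: "d \<in> ratlas M"
  show "smooth_on (snd d ` ((U1 \<union> U2) \<inter> fst c \<inter> fst d)) (\<lambda>x. X (chart_inv d x) c)"
  proof (rule smooth_on_local)
    fix x assume "x \<in> snd d ` ((U1 \<union> U2) \<inter> fst c \<inter> fst d)"
    then obtain U where U: "U \<in> {U1, U2}" "x \<in> snd d ` (U \<inter> fst c \<inter> fst d)" by blast
    have "smooth_on (snd d ` (U \<inter> fst c \<inter> fst d)) (\<lambda>x. X (chart_inv d x) c)"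
      using X1 X2 U(1) c d by (auto simp: smooth_vfield_on_def smooth_fun_on_def)
    moreover have "open (snd d ` (U \<inter> fst c \<inter> fst d))"
      by (rule image_open[OF d openin_Int[OF _ dom_open[OF c]]]) (use U1 U2 U in blast)
    ultimately show "\<exists>T. open T \<and> x \<in> T \<and> smooth_on T (\<lambda>x. X (chart_inv d x) c)"
      using U(2) by blast
  qed
qed

lemma smooth_vfield_on_zero:
  assumes "openin (rtop M) U"
  shows "smooth_vfield_on M U (\<lambda>_ _. 0)"
  unfolding smooth_vfield_on_def smooth_fun_on_def by (simp add: tangent_zero smooth_on_const)

text \<open>A field with constant coordinates is multiplied by a bump function and extended by zero;
  smoothness is checked on two open sets that cover the manifold.\<close>

lemma global_field:
  assumes p: "p \<in> points M" and v: "v \<in> tangent_space M p"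
  obtains X where "smooth_vfield_on M (points M) X" "X p = v"
proof -
  obtain c where c: "c \<in> charts_at M p" using charts_at_exists[OF p] by blast
  note C = charts_atD[OF c]
  obtain r where r: "r > 0" "cball (snd c p) r \<subseteq> snd c ` fst c"
    using range_open[OF C(1)] C(2) open_contains_cball by blast
  obtain \<beta> :: "'e \<Rightarrow> real" where \<beta>: "smooth_on UNIV \<beta>" "\<beta> (snd c p) = 1" "\<And>x. r \<le> norm (x - snd c p) \<Longrightarrow> \<beta> x = 0"
    using smooth_bump[OF r(1)] by metis
  \<comment> \<open>The field vanishes off \<open>K\<close>. As a compact subset of a Hausdorff
    space \<open>K\<close> is closed, so its complement is the second open set; closedness of the
    ball in coordinates alone would not suffice for that.\<close>
  define K where "K = chart_inv c ` cball (snd c p) r"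
  define X where "X q = (if q \<in> fst c then of_coords M q c (\<beta> (snd c q) *\<^sub>R v c) else (\<lambda>_. 0))" for q
  have "compactin (top_of_set (snd c ` fst c)) (cball (snd c p) r)"
    using r(2) by (simp add: compactin_subtopology)
  then have "compactin (rtop M) K"
    unfolding K_def by (rule image_compactin[OF _ chart_inv_continuous[OF C(1)]])
  moreover have "Hausdorff_space (rtop M)" using mfd by (simp add: smooth_manifold_def)
  ultimately have "closedin (rtop M) K" by (metis compactin_imp_closedin)
  then have U: "openin (rtop M) (points M - K)" by (rule openin_diff[OF openin_topspace])
  have K: "K \<subseteq> fst c" using r(2) by (auto simp: K_def chart_inv_left[OF C(1)] dest!: subsetD)
  have zero: "X q = (\<lambda>_. 0)" if "q \<in> points M - K" for q
  proof (cases "q \<in> fst c")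
    case True
    have "snd c q \<notin> cball (snd c p) r"
    proof
      assume "snd c q \<in> cball (snd c p) r"
      then have "chart_inv c (snd c q) \<in> K" unfolding K_def by (rule imageI)
      then show False using that chart_inv_left[OF C(1) True] by simp
    qed
    then have "\<beta> (snd c q) = 0" by (intro \<beta>(3)) (simp add: dist_norm norm_minus_commute)
    then have "X q = of_coords M q c 0" using True by (simp add: X_def)
    also have "\<dots> = (\<lambda>_. 0)"
    proof -
      have cq: "c \<in> charts_at M q" by (rule charts_atI[OF C(1) True])
      show ?thesis
        using tangent_eqI[OF of_coords_tangent[OF cq] tangent_zero cq, of 0] of_coords_self[OF cq, of 0] by simp
    qed
    finally show ?thesis .
  qed (simp add: X_def)
  have "smooth_vfield_on M (fst c) (\<lambda>q. of_coords M q c (\<beta> (snd c q) *\<^sub>R v c))"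
    by (rule smooth_coord_field[OF C(1), where A="\<lambda>x. \<beta> x *\<^sub>R v c"])
      (rule smooth_on_scaleR[OF smooth_on_subset[OF \<beta>(1)] smooth_on_const range_open[OF C(1)]], simp)
  then have "smooth_vfield_on M (fst c) X"
    by (rule smooth_vfield_on_cong[OF _ dom_open[OF C(1)]]) (simp add: X_def)
  moreover have "smooth_vfield_on M (points M - K) X"
    by (rule smooth_vfield_on_cong[OF smooth_vfield_on_zero[OF U] U]) (simp add: zero)
  ultimately have "smooth_vfield_on M (fst c \<union> (points M - K)) X"
    using smooth_vfield_on_Un dom_open[OF C(1)] U by blast
  moreover have "fst c \<union> (points M - K) = points M" using K dom_points[OF C(1)] by blast
  ultimately have "smooth_vfield_on M (points M) X" by simp
  moreover have "X p = v"
    using C of_coords_tangent_self[OF v c] by (simp add: X_def \<beta>(2))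
  ultimately show thesis by (rule that)
qed

end

section \<open>The Ricci transform in a chart\<close>

context riem_mfd
begin

lemma preimage_open:
  assumes c: "c \<in> ratlas M" and B: "open B"
  shows "openin (rtop M) {q \<in> fst c. snd c q \<in> B}"
proof -
  have "continuous_map (subtopology (rtop M) (fst c)) (top_of_set (snd c ` fst c)) (snd c)"
    by (rule homeomorphic_imp_continuous_map[OF chart_homeo[OF c]])
  then have "continuous_map (subtopology (rtop M) (fst c)) euclidean (snd c)"
    by (simp add: continuous_map_in_subtopology)
  from openin_continuous_map_preimage[OF this, of B]
  have "openin (subtopology (rtop M) (fst c)) {q \<in> fst c. snd c q \<in> B}"
    using B dom_points[OF c] by (simp add: Int_absorb1)
  then show ?thesis using dom_open[OF c] openin_trans_full by blast
qed

text \<open>One basis \<open>b\<close> serves all vectors \<open>u\<close> and all charts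
  \<open>c\<close>, so linearity in \<open>u\<close> can be read off; \<open>ricci_scale\<close>
  relies on it.\<close>

lemma ricci_chart:
  assumes p: "p \<in> points M"
  obtains b where "orthonormal_at M p b"
    "\<And>u c. u \<in> tangent_space M p \<Longrightarrow> ricci_transform M p u c =
      (if c \<in> charts_at M p then \<Sum>i<DIM('e). Rm c (snd c p) (u c) (b i c) (b i c) else 0)"
proof -
  define b where "b = (SOME b. orthonormal_at M p b)"
  have "\<exists>b. orthonormal_at M p b"
    using frame_exists[OF p] unfolding orthonormal_frame_on_def by blast
  then have b: "orthonormal_at M p b" unfolding b_def by (rule someI_ex)
  have bt: "b i \<in> tangent_space M p" if "i < DIM('e)" for i
    using b that by (simp add: orthonormal_at_def)
  have "ricci_transform M p u c =
      (if c \<in> charts_at M p then \<Sum>i<DIM('e). Rm c (snd c p) (u c) (b i c) (b i c) else 0)"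
    if u: "u \<in> tangent_space M p" for u c
    unfolding ricci_transform_def Let_def b_def[symmetric]
    by (simp add: curvature_chart[OF u bt bt p])
  with b show thesis by (rule that)
qed

lemma tangent_nonzero:
  assumes "v \<in> tangent_space M p" "c \<in> charts_at M p"
  shows "v = (\<lambda>_. 0) \<longleftrightarrow> v c = 0"
  using tangent_eqI[OF assms(1) tangent_zero assms(2)] by auto

end

subsection \<open>Isometric immersions in charts\<close>

locale riem_immersion = riem_map M N \<phi>
  for M :: "('a, 'e::euclidean_space) riem" and N :: "('b, 'f::euclidean_space) riem" and \<phi> +
  assumes immersion: "isometric_immersion M N \<phi>"
begin

lemma local_imm:
  assumes U: "openin (rtop M) U" and c: "c \<in> ratlas M" and d: "d \<in> ratlas N"
  shows "local_immersion (snd d ` fst d) (N.met d) (dm U c d) (rep c d) (M.met c)"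
proof -
  interpret A: along_map "snd d ` fst d" "N.met d" "dm U c d" "rep c d" by (rule along[OF U c d])
  interpret L: local_metric "dm U c d" "M.met c"
    by (rule local_metric_subset[OF M.local_metric_met[OF c] dm_open[OF U c d]]) (auto simp: dm_def)
  show ?thesis
  proof
    fix x a b assume "x \<in> dm U c d"
    then obtain q where q: "q \<in> U" "c \<in> charts_at M q" "d \<in> charts_at N (\<phi> q)" "x = snd c q" "chart_inv c x = q"
      using dmE[OF _ c d] by metis
    have qM: "q \<in> points M" by (rule M.charts_at_points[OF q(2)])
    define v where "v a = of_coords M q c a" for a
    have v: "v a \<in> tangent_space M q" for a unfolding v_def by (rule M.of_coords_tangent[OF q(2)])
    have dv: "differential M N \<phi> q (v a) d = Df (rep c d) x a" for a
      using differential_chart[OF v q(2,3)] by (simp add: v_def M.of_coords_self[OF q(2)] q(4))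
    have "rmetric N (\<phi> q) (differential M N \<phi> q (v a)) (differential M N \<phi> q (v b)) = rmetric M q (v a) (v b)"
      using immersion qM v unfolding isometric_immersion_def by blast
    then show "N.met d (rep c d x) (Df (rep c d) x a) (Df (rep c d) x b) = M.met c x a b"
      using N.rmetric_chart[OF differential_tangent[OF v qM] differential_tangent[OF v qM] q(3), of a b]
        M.rmetric_chart[OF v v q(2), of a b]
      by (simp add: dv q(5)) (simp add: v_def M.of_coords_self[OF q(2)] q(4))
  qed
qed

abbreviation lsff :: "('a, 'e) chart \<Rightarrow> ('b, 'f) chart \<Rightarrow> 'e \<Rightarrow> 'e \<Rightarrow> 'e \<Rightarrow> 'f" where
  "lsff c d \<equiv> local_immersion.sff (N.met d) (rep c d) (M.met c)"

text \<open>In coordinates the section of images of \<open>Y\<close> is \<open>Df\<close> of the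
  representation applied to the components of \<open>Y\<close>, so the claim reduces to
  \<open>sff_along\<close>.\<close>

lemma sff_chart:
  assumes U: "openin (rtop M) U" and Y: "smooth_vfield_on M U Y" and p: "p \<in> U"
    and X: "X p \<in> tangent_space M p" and c: "c \<in> charts_at M p" and d: "d \<in> charts_at N (\<phi> p)"
  shows "second_fund_form M N \<phi> X Y p d = lsff c d (snd c p) (X p c) (Y p c)"
proof -
  note C = M.charts_atD[OF c] and D = N.charts_atD[OF d]
  interpret L: local_immersion "snd d ` fst d" "N.met d" "dm U c d" "rep c d" "M.met c"
    by (rule local_imm[OF U C(1) D(1)])
  define x where "x = snd c p"
  have x: "x \<in> dm U c d" unfolding x_def by (rule dmI[OF c d p])
  define Yl where "Yl = (\<lambda>x. Y (chart_inv c x) c)"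
  have smY: "smooth_on (dm U c d) Yl"
    unfolding Yl_def by (rule smooth_on_subset[OF M.smooth_vfield_onD(2)[OF Y C(1)]]) (auto simp: dm_def)
  have Yp: "Yl x = Y p c" by (simp add: Yl_def x_def M.chart_inv_left[OF C])
  have "pull_cov M N \<phi> (X p) (\<lambda>q. differential M N \<phi> q (Y q)) p d
      = L.cd (\<lambda>x. differential M N \<phi> (chart_inv c x) (Y (chart_inv c x)) d) x (X p c)"
    unfolding x_def
    by (rule pull_cov_chart[where V="\<lambda>q. differential M N \<phi> q (Y q)", OF X c d
          smooth_alongD(3)[OF smooth_along_differential[OF U Y] C(1) D(1)] x[unfolded x_def]])
  also have "\<dots> = L.cd (\<lambda>x. Df (rep c d) x (Yl x)) x (X p c)"
  proof (rule L.cd_cong[OF x])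
    fix y assume "y \<in> dm U c d"
    then obtain q where q: "q \<in> U" "c \<in> charts_at M q" "d \<in> charts_at N (\<phi> q)" "y = snd c q" "chart_inv c y = q"
      using dmE[OF _ C(1) D(1)] by metis
    show "differential M N \<phi> (chart_inv c y) (Y (chart_inv c y)) d = Df (rep c d) y (Yl y)"
      using differential_chart[OF M.smooth_vfield_onD(1)[OF Y q(1)] q(2,3)]
      unfolding q(4)[symmetric] Yl_def q(5) .
  qed
  finally have 1: "pull_cov M N \<phi> (X p) (\<lambda>q. differential M N \<phi> q (Y q)) p d = L.cd (\<lambda>x. Df (rep c d) x (Yl x)) x (X p c)" .
  have "cov M (X p) Y p c = L.M.self.cd Yl x (X p c)"
    unfolding x_def Yl_def
    by (rule M.cov_chart[where Y=Y, OF X c smY[unfolded Yl_def] x[unfolded x_def]])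
  then have 2: "differential M N \<phi> p (cov M (X p) Y p) d = Df (rep c d) x (L.M.self.cd Yl x (X p c))"
    using differential_chart[OF M.cov_tangent[OF U Y p X] c d] by (simp add: x_def)
  show ?thesis
    unfolding second_fund_form_def 1 2 L.sff_along[OF smY x] Yp by (simp add: x_def)
qed

lemma sff_tangent:
  assumes U: "openin (rtop M) U" and Y: "smooth_vfield_on M U Y" and p: "p \<in> U"
    and X: "X p \<in> tangent_space M p"
  shows "second_fund_form M N \<phi> X Y p \<in> tangent_space N (\<phi> p)"
  unfolding second_fund_form_def
  by (rule N.tangent_diff[OF pull_cov_tangent[OF smooth_along_differential[OF U Y] p X]
      differential_tangent[OF M.cov_tangent[OF U Y p X]]]) (use U p openin_subset in blast)

lemma orthonormal_frame_onD:
  assumes "orthonormal_frame_on M W e"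
  shows "i < DIM('e) \<Longrightarrow> smooth_vfield_on M W (e i)" "q \<in> W \<Longrightarrow> orthonormal_at M q (\<lambda>i. e i q)"
    "i < DIM('e) \<Longrightarrow> q \<in> W \<Longrightarrow> e i q \<in> tangent_space M q"
  using assms by (auto simp: orthonormal_frame_on_def smooth_vfield_on_def)

lemma frame_ortho:
  assumes e: "orthonormal_frame_on M W e" and q: "q \<in> W" and c: "c \<in> charts_at M q"
  shows "inner_form.ortho (M.met c (snd c q)) (\<lambda>i. e i q c) DIM('e)"
  using M.ortho_chart[OF c orthonormal_frame_onD(3)[OF e _ q]] orthonormal_frame_onD(2)[OF e q] by simp

text \<open>\<open>tension\<close> selects a frame anew at each point \<open>q\<close>, without any
  smooth dependence on \<open>q\<close>. Since a trace is the same in all orthonormal bases, one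
  frame \<open>e\<close> on \<open>W\<close> can replace these selections, and smoothness of the
  tension field follows.\<close>

lemma tension_chart:
  assumes W: "openin (rtop M) W" and e: "orthonormal_frame_on M W e" and q: "q \<in> W"
    and c: "c \<in> charts_at M q" and d: "d \<in> charts_at N (\<phi> q)"
  shows "tension M N \<phi> q d = (\<Sum>i<DIM('e). lsff c d (snd c q) (e i q c) (e i q c))"
proof -
  note C = M.charts_atD[OF c] and D = N.charts_atD[OF d]
  obtain W' where W': "openin (rtop M) W'" "q \<in> W'" "orthonormal_frame_on M W' (frame M q)"
    using M.frame_exists[OF M.charts_at_points[OF c]] by blast
  interpret L: local_immersion "snd d ` fst d" "N.met d" "dm W' c d" "rep c d" "M.met c"
    by (rule local_imm[OF W'(1) C(1) D(1)])
  have x: "snd c q \<in> dm W' c d" by (rule dmI[OF c d W'(2)])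
  have "tension M N \<phi> q d = (\<Sum>i<DIM('e). second_fund_form M N \<phi> (frame M q i) (frame M q i) q d)"
    by (simp add: tension_def Let_def)
  also have "\<dots> = (\<Sum>i<DIM('e). lsff c d (snd c q) (frame M q i q c) (frame M q i q c))"
  proof (rule sum.cong[OF refl])
    fix i assume "i \<in> {..<DIM('e)}"
    then have i: "i < DIM('e)" by simp
    show "second_fund_form M N \<phi> (frame M q i) (frame M q i) q d = lsff c d (snd c q) (frame M q i q c) (frame M q i q c)"
      by (rule sff_chart[where X="frame M q i", OF W'(1) orthonormal_frame_onD(1)[OF W'(3) i] W'(2)
            orthonormal_frame_onD(3)[OF W'(3) i W'(2)] c d])
  qed
  also have "\<dots> = (\<Sum>i<DIM('e). lsff c d (snd c q) (e i q c) (e i q c))"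
    by (rule inner_form.trace_independent[OF L.M.inner_form[OF x] frame_ortho[OF W'(3,2) c] frame_ortho[OF e q c],
          where Q="lsff c d (snd c q)", OF bilinear_familyD(3,4)[OF L.sff_family x]])
  finally show ?thesis .
qed

lemma tension_tangent:
  assumes p: "p \<in> points M"
  shows "tension M N \<phi> p \<in> tangent_space N (\<phi> p)"
proof -
  obtain W where W: "openin (rtop M) W" "p \<in> W" "orthonormal_frame_on M W (frame M p)"
    using M.frame_exists[OF p] by blast
  have "second_fund_form M N \<phi> (frame M p i) (frame M p i) p \<in> tangent_space N (\<phi> p)" if "i \<in> {..<DIM('e)}" for i
  proof -
    have i: "i < DIM('e)" using that by simp
    show ?thesis
      by (rule sff_tangent[where X="frame M p i", OF W(1) orthonormal_frame_onD(1)[OF W(3) i] W(2)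
            orthonormal_frame_onD(3)[OF W(3) i W(2)]])
  qed
  then show ?thesis
    unfolding tension_def Let_def by (rule N.tangent_sum)
qed

lemma smooth_tension:
  assumes W: "openin (rtop M) W" and e: "orthonormal_frame_on M W e"
  shows "smooth_along W (tension M N \<phi>)"
  unfolding smooth_along_def
proof (intro conjI ballI W)
  show "tension M N \<phi> p \<in> tangent_space N (\<phi> p)" if "p \<in> W" for p
    by (rule tension_tangent) (use W that openin_subset in blast)
  fix c d assume c: "c \<in> ratlas M" and d: "d \<in> ratlas N"
  interpret L: local_immersion "snd d ` fst d" "N.met d" "dm W c d" "rep c d" "M.met c"
    by (rule local_imm[OF W c d])
  have sm: "smooth_on (dm W c d) (\<lambda>x. e i (chart_inv c x) c)" if "i < DIM('e)" for i
    by (rule smooth_on_subset[OF M.smooth_vfield_onD(2)[OF orthonormal_frame_onD(1)[OF e that] c]]) (auto simp: dm_def)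
  have "smooth_on (dm W c d) (\<lambda>x. \<Sum>i<DIM('e). lsff c d x (e i (chart_inv c x) c) (e i (chart_inv c x) c))"
    by (rule smooth_on_sum[OF smooth_on_bilinear_family[OF L.open_dom L.sff_family sm sm] L.open_dom]) auto
  then show "smooth_on (dm W c d) (\<lambda>x. tension M N \<phi> (chart_inv c x) d)"
  proof (rule smooth_on_cong[OF _ L.open_dom])
    fix x assume "x \<in> dm W c d"
    then obtain q where q: "q \<in> W" "c \<in> charts_at M q" "d \<in> charts_at N (\<phi> q)" "x = snd c q" "chart_inv c x = q"
      using dmE[OF _ c d] by metis
    show "(\<Sum>i<DIM('e). lsff c d x (e i (chart_inv c x) c) (e i (chart_inv c x) c)) = tension M N \<phi> (chart_inv c x) d"
      using tension_chart[OF W e q(1-3)] unfolding q(4)[symmetric] q(5) by simp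
  qed
qed

lemma normal_space_chart:
  assumes v: "v \<in> normal_space M N \<phi> p" and c: "c \<in> charts_at M p" and d: "d \<in> charts_at N (\<phi> p)"
  shows "N.met d (snd d (\<phi> p)) (v d) (Df (rep c d) (snd c p) a) = 0"
proof -
  have t: "of_coords M p c a \<in> tangent_space M p" by (rule M.of_coords_tangent[OF c])
  have "rmetric N (\<phi> p) v (differential M N \<phi> p (of_coords M p c a)) = 0" "v \<in> tangent_space N (\<phi> p)"
    using v t by (auto simp: normal_space_def)
  then show ?thesis
    using N.rmetric_chart[OF _ differential_tangent[OF t M.charts_at_points[OF c]] d, of v]
    by (simp add: differential_chart[OF t c d] M.of_coords_self[OF c])
qed

text \<open>\<open>normal_part\<close> is a definite description and says nothing until this is
  known. For uniqueness, the difference of two candidates is both tangential and normal, hence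
  orthogonal to itself.\<close>

lemma normal_part_ex1:
  assumes p: "p \<in> points M" and w: "w \<in> tangent_space N (\<phi> p)"
  shows "\<exists>!v. v \<in> normal_space M N \<phi> p \<and>
    (\<exists>u\<in>tangent_space M p. w = (\<lambda>d. differential M N \<phi> p u d + v d))"
proof -
  obtain c where c: "c \<in> charts_at M p" using M.charts_at_exists[OF p] by blast
  obtain d where d: "d \<in> charts_at N (\<phi> p)" using N.charts_at_exists[OF phi_points[OF p]] by blast
  note C = M.charts_atD[OF c] and D = N.charts_atD[OF d]
  interpret L: local_immersion "snd d ` fst d" "N.met d" "dm (points M) c d" "rep c d" "M.met c"
    by (rule local_imm[OF open_points C(1) D(1)])
  define x where "x = snd c p"
  have x: "x \<in> dm (points M) c d" unfolding x_def by (rule dmI[OF c d p])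
  have F: "rep c d x = snd d (\<phi> p)" by (simp add: x_def M.chart_inv_left[OF C])
  define h where "h = N.met d (snd d (\<phi> p))"
  interpret H: inner_form h unfolding h_def F[symmetric] by (rule L.inner_F[OF x])
  interpret G: inner_form "M.met c x" by (rule L.M.inner_form[OF x])
  note lin = L.linear_DF[OF x]
  have iso: "h (Df (rep c d) x a) (Df (rep c d) x b) = M.met c x a b" for a b
    using L.isometric[OF x] by (simp add: h_def F)
  obtain b where b: "G.ortho b DIM('e)"
    using L.M.smooth_orthonormal_frame x by metis
  \<comment> \<open>Coordinates of the tangential projection of \<open>w\<close>: the images of an
    orthonormal basis are orthonormal, so the coefficients are the products of \<open>w\<close> with
    them.\<close>
  define a where "a = (\<Sum>i<DIM('e). h (w d) (Df (rep c d) x (b i)) *\<^sub>R b i)"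
  define u where "u = of_coords M p c a"
  have u: "u \<in> tangent_space M p" unfolding u_def by (rule M.of_coords_tangent[OF c])
  have du: "differential M N \<phi> p u d = Df (rep c d) x a"
    using differential_chart[OF u c d] by (simp add: u_def M.of_coords_self[OF c] x_def)
  have ha: "h (w d) (Df (rep c d) x k) = M.met c x a k" for k
  proof -
    have "h (w d) (Df (rep c d) x k) = h (w d) (Df (rep c d) x (\<Sum>i<DIM('e). M.met c x k (b i) *\<^sub>R b i))"
      using G.ortho_expand[OF b, of k] by simp
    also have "\<dots> = M.met c x a k"
      by (simp add: a_def linear_sum[OF lin] linear_scale[OF lin] H.g_sum_right H.g_simps G.g_sum_left G.g_simps
          G.sym[of k] mult.commute)
    finally show ?thesis .
  qed
  define v where "v d = w d - differential M N \<phi> p u d" for d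
  have vt: "v \<in> tangent_space N (\<phi> p)"
    unfolding v_def by (rule N.tangent_diff[OF w differential_tangent[OF u p]])
  have "v \<in> normal_space M N \<phi> p"
    unfolding normal_space_def
  proof (intro CollectI conjI ballI vt)
    fix k assume k: "k \<in> tangent_space M p"
    have "rmetric N (\<phi> p) v (differential M N \<phi> p k) = h (v d) (Df (rep c d) x (k c))"
      using N.rmetric_chart[OF vt differential_tangent[OF k p] d] differential_chart[OF k c d]
      by (simp add: h_def x_def)
    also have "\<dots> = 0" by (simp add: v_def du H.g_simps ha iso)
    finally show "rmetric N (\<phi> p) v (differential M N \<phi> p k) = 0" .
  qed
  moreover have "w = (\<lambda>d. differential M N \<phi> p u d + v d)" by (simp add: v_def)
  moreover have "v1 = v2"
    if v: "v1 \<in> normal_space M N \<phi> p" "v2 \<in> normal_space M N \<phi> p"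
      and u: "u1 \<in> tangent_space M p" "u2 \<in> tangent_space M p"
      and w: "w = (\<lambda>d. differential M N \<phi> p u1 d + v1 d)" "w = (\<lambda>d. differential M N \<phi> p u2 d + v2 d)"
    for v1 v2 u1 u2
  proof -
    have "differential M N \<phi> p u1 d + v1 d = differential M N \<phi> p u2 d + v2 d"
      using w by metis
    then have z: "v1 d - v2 d = Df (rep c d) x (u2 c - u1 c)"
      using differential_chart[OF u(1) c d] differential_chart[OF u(2) c d]
      by (simp add: linear_diff[OF lin] x_def[symmetric] algebra_simps)
    have "h (v1 d - v2 d) (Df (rep c d) x k) = 0" for k
      using normal_space_chart[OF v(1) c d, of k] normal_space_chart[OF v(2) c d, of k]
      by (simp add: H.g_simps) (simp add: h_def x_def)
    then have "h (v1 d - v2 d) (v1 d - v2 d) = 0" using z by metis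
    then have "v1 d = v2 d" by (simp add: H.g_eq_0)
    then show "v1 = v2"
      using N.tangent_eqI[of v1 "\<phi> p" v2 d] v d by (simp add: normal_space_def)
  qed
  ultimately show ?thesis using u by blast
qed

lemma normal_part_zero:
  assumes p: "p \<in> points M" and w: "w \<in> tangent_space N (\<phi> p)" and 0: "normal_part M N \<phi> p w = (\<lambda>_. 0)"
  shows "\<exists>u\<in>tangent_space M p. w = differential M N \<phi> p u"
  using theI'[OF normal_part_ex1[OF p w]] unfolding normal_part_def[symmetric] 0 by simp

end

subsection \<open>Hypersurfaces with parallel tension field\<close>

locale parallel_tension_hypersurface = riem_immersion M N \<phi>
  for M :: "('a, 'e::euclidean_space) riem" and N :: "('b, 'f::euclidean_space) riem" and \<phi> +
  assumes codim: "DIM('f) = DIM('e) + 1"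
    and parallel: "smooth_vfield_on M (points M) X \<Longrightarrow> p \<in> points M \<Longrightarrow>
           normal_cov M N \<phi> (X p) (tension M N \<phi>) p = (\<lambda>_. 0)"
begin

abbreviation \<tau> :: "('a, 'b, 'f) section_along" where
  "\<tau> \<equiv> tension M N \<phi>"

text \<open>\<open>normal_cov\<close> receives only the value \<open>X p\<close> of the field, so a
  global extension of \<open>v\<close> transfers the hypothesis to every single tangent
  vector.\<close>

lemma pull_cov_tension:
  assumes p: "p \<in> points M" and v: "v \<in> tangent_space M p"
  shows "\<exists>u\<in>tangent_space M p. pull_cov M N \<phi> v \<tau> p = differential M N \<phi> p u"
proof -
  obtain X where X: "smooth_vfield_on M (points M) X" "X p = v" using M.global_field[OF p v] by blast
  obtain W where W: "openin (rtop M) W" "p \<in> W" "orthonormal_frame_on M W (frame M p)"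
    using M.frame_exists[OF p] by blast
  have "normal_part M N \<phi> p (pull_cov M N \<phi> v \<tau> p) = (\<lambda>_. 0)"
    using parallel[OF X(1) p] by (simp add: normal_cov_def X(2))
  then show ?thesis
    by (rule normal_part_zero[OF p pull_cov_tangent[OF smooth_tension[OF W(1,3)] W(2) v]])
qed

abbreviation loc :: "('a, 'e) chart \<Rightarrow> ('b, 'f) chart \<Rightarrow> 'e \<Rightarrow> 'f" where
  "loc c d x \<equiv> \<tau> (chart_inv c x) d"

text \<open>The bridge to the coordinate computation. The frame is a fixed \<open>e\<close> on all
  of \<open>W\<close>, as the coordinate argument differentiates both the frame and
  \<open>\<tau>\<close>.\<close>

lemma local_hyp:
  assumes W: "openin (rtop M) W" and e: "orthonormal_frame_on M W e"
    and c: "c \<in> ratlas M" and d: "d \<in> ratlas N"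
  shows "parallel_hypersurface (snd d ` fst d) (N.met d) (dm W c d) (rep c d) (M.met c)
    (\<lambda>i x. e i (chart_inv c x) c) (loc c d)"
proof -
  interpret L: local_immersion "snd d ` fst d" "N.met d" "dm W c d" "rep c d" "M.met c"
    by (rule local_imm[OF W c d])
  show ?thesis
  proof
    show "DIM('f) = DIM('e) + 1" by (rule codim)
    show "smooth_on (dm W c d) (\<lambda>x. e i (chart_inv c x) c)" if "i < DIM('e)" for i
      by (rule smooth_on_subset[OF M.smooth_vfield_onD(2)[OF orthonormal_frame_onD(1)[OF e that] c]]) (auto simp: dm_def)
    fix x assume x: "x \<in> dm W c d"
    then obtain q where q: "q \<in> W" "c \<in> charts_at M q" "d \<in> charts_at N (\<phi> q)" "x = snd c q" "chart_inv c x = q"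
      using dmE[OF _ c d] by metis
    show "inner_form.ortho (M.met c x) (\<lambda>i. e i (chart_inv c x) c) DIM('e)"
      using frame_ortho[OF e q(1,2)] unfolding q(4)[symmetric] q(5) .
    show "loc c d x = (\<Sum>i<DIM('e). L.sff x (e i (chart_inv c x) c) (e i (chart_inv c x) c))"
      using tension_chart[OF W e q(1-3)] unfolding q(4)[symmetric] q(5) .
    fix a
    define v where "v = of_coords M q c a"
    have v: "v \<in> tangent_space M q" unfolding v_def by (rule M.of_coords_tangent[OF q(2)])
    obtain u where u: "u \<in> tangent_space M q" "pull_cov M N \<phi> v \<tau> q = differential M N \<phi> q u"
      using pull_cov_tension[OF M.charts_at_points[OF q(2)] v] by blast
    have "pull_cov M N \<phi> v \<tau> q d = L.cd (loc c d) x a"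
      using pull_cov_chart[where V=\<tau>, OF v q(2,3) smooth_alongD(3)[OF smooth_tension[OF W e] c d]] x
      by (simp add: q(4) v_def M.of_coords_self[OF q(2)])
    moreover have "differential M N \<phi> q u d = Df (rep c d) x (u c)"
      using differential_chart[OF u(1) q(2,3)] by (simp add: q(4))
    ultimately show "\<exists>u. L.cd (loc c d) x a = Df (rep c d) x u"
      using u(2) by metis
  qed
qed

section \<open>Constancy of the length of the tension field\<close>

definition len2 :: "'a \<Rightarrow> real" where
  "len2 q = rmetric N (\<phi> q) (\<tau> q) (\<tau> q)"

lemma len2_locally_constant:
  assumes p: "p \<in> points M"
  shows "\<exists>U. openin (rtop M) U \<and> p \<in> U \<and> (\<forall>q\<in>U. len2 q = len2 p)"
proof -
  obtain c where c: "c \<in> charts_at M p" using M.charts_at_exists[OF p] by blast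
  obtain d where d: "d \<in> charts_at N (\<phi> p)" using N.charts_at_exists[OF phi_points[OF p]] by blast
  note C = M.charts_atD[OF c] and D = N.charts_atD[OF d]
  obtain W where W: "openin (rtop M) W" "p \<in> W" "orthonormal_frame_on M W (frame M p)"
    using M.frame_exists[OF p] by blast
  interpret L: parallel_hypersurface "snd d ` fst d" "N.met d" "dm W c d" "rep c d" "M.met c"
    "\<lambda>i x. frame M p i (chart_inv c x) c" "loc c d"
    by (rule local_hyp[OF W(1,3) C(1) D(1)])
  define g where "g x = N.met d (rep c d x) (loc c d x) (loc c d x)" for x
  have g: "(g has_derivative (\<lambda>_. 0)) (at x)" if x: "x \<in> dm W c d" for x
  proof -
    have "smooth_on (dm W c d) g"
      unfolding g_def by (rule smooth_on_bilinear_family[OF L.open_dom L.H_family L.smooth_tau L.smooth_tau])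
    moreover have "Df g x = (\<lambda>_. 0)"
    proof
      fix a
      have "N.met d (rep c d x) (L.cd (loc c d) x a) (loc c d x) = 0"
        by (rule L.cd_tau_normal[OF x L.tau_normal[OF x]])
      then show "Df g x a = 0"
        unfolding g_def[abs_def]
        using L.cd_metric[OF L.smooth_tau L.smooth_tau x, of a]
          inner_form.sym[OF L.inner_F[OF x], of "loc c d x"] by simp
    qed
    ultimately show ?thesis using smooth_on_has_derivative[of "dm W c d" g x] x by simp
  qed
  have x: "snd c p \<in> dm W c d" by (rule dmI[OF c d W(2)])
  \<comment> \<open>The set \<open>dm W c d\<close> may be disconnected; on a ball a vanishing
    derivative does give constancy.\<close>
  then obtain r where r: "r > 0" "ball (snd c p) r \<subseteq> dm W c d"
    using L.open_dom openE by blast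
  have len: "len2 q = g (snd c q)" if q: "q \<in> fst c" "snd c q \<in> ball (snd c p) r" for q
  proof -
    have "snd c q \<in> dm W c d" using q(2) r(2) by blast
    then obtain q' where q': "d \<in> charts_at N (\<phi> q')" "chart_inv c (snd c q) = q'" "c \<in> charts_at M q'"
      using dmE[OF _ C(1) D(1)] by metis
    then have "q' = q" using M.chart_inv_left[OF C(1) q(1)] by simp
    then show ?thesis
      using N.rmetric_chart[OF tension_tangent tension_tangent, of q] q' M.charts_at_points
      by (simp add: len2_def g_def)
  qed
  have g_const: "g y = g (snd c p)" if y: "y \<in> ball (snd c p) r" for y
  proof (rule has_derivative_zero_unique_connected[where f=g, OF open_ball connected_ball _ y])
    show "(g has_derivative (\<lambda>_. 0)) (at z)" if "z \<in> ball (snd c p) r" for z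
      using g r(2) that by blast
    show "snd c p \<in> ball (snd c p) r" using r(1) by simp
  qed
  have const: "len2 q = len2 p" if "q \<in> fst c" "snd c q \<in> ball (snd c p) r" for q
    using len[OF that] len[OF C(2)] r(1) g_const[OF that(2)] by simp
  show ?thesis
  proof (intro exI[of _ "{q \<in> fst c. snd c q \<in> ball (snd c p) r}"] conjI)
    show "openin (rtop M) {q \<in> fst c. snd c q \<in> ball (snd c p) r}"
      by (rule M.preimage_open[OF C(1) open_ball])
    show "p \<in> {q \<in> fst c. snd c q \<in> ball (snd c p) r}" using C(2) r(1) by simp
    show "\<forall>q\<in>{q \<in> fst c. snd c q \<in> ball (snd c p) r}. len2 q = len2 p" using const by blast
  qed
qed

text \<open>A level set of a locally constant function is open and closed, hence the whole space,
  since \<open>M\<close> is connected.\<close>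

lemma len2_constant:
  assumes "p \<in> points M" "q \<in> points M"
  shows "len2 q = len2 p"
proof -
  define A where "A = {q \<in> points M. len2 q = len2 p}"
  have "\<exists>U. openin (rtop M) U \<and> q \<in> U \<and> U \<subseteq> (if q \<in> A then A else points M - A)" if q: "q \<in> points M" for q
  proof -
    obtain U where U: "openin (rtop M) U" "q \<in> U" "\<forall>r\<in>U. len2 r = len2 q"
      using len2_locally_constant[OF q] by blast
    have "U \<subseteq> (if q \<in> A then A else points M - A)"
    proof
      fix r assume r: "r \<in> U"
      then have "r \<in> points M" using openin_subset[OF U(1)] by blast
      then show "r \<in> (if q \<in> A then A else points M - A)"
        using bspec[OF U(3) r] q by (simp add: A_def)
    qed
    then show ?thesis using U(1,2) by blast
  qed
  note nbhd = this
  have "openin (rtop M) A"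
  proof (subst openin_subopen, intro ballI)
    fix q assume q: "q \<in> A"
    then have "q \<in> points M" by (simp add: A_def)
    from nbhd[OF this] show "\<exists>T. openin (rtop M) T \<and> q \<in> T \<and> T \<subseteq> A"
      unfolding if_P[OF q] .
  qed
  moreover have "openin (rtop M) (points M - A)"
  proof (subst openin_subopen, intro ballI)
    fix q assume "q \<in> points M - A"
    then have q: "q \<in> points M" "q \<notin> A" by simp_all
    from nbhd[OF q(1)] show "\<exists>T. openin (rtop M) T \<and> q \<in> T \<and> T \<subseteq> points M - A"
      unfolding if_not_P[OF q(2)] .
  qed
  then have "closedin (rtop M) A" by (auto simp: closedin_def A_def)
  moreover have "connected_space (rtop M)" using M.mfd by (simp add: smooth_manifold_def)
  ultimately have "A = {} \<or> A = points M" by (simp add: connected_space_clopen_in)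
  then show ?thesis using assms by (auto simp: A_def)
qed

lemma tension_zero_iff:
  assumes p: "p \<in> points M"
  shows "\<tau> p = (\<lambda>_. 0) \<longleftrightarrow> len2 p = 0"
proof -
  obtain d where d: "d \<in> charts_at N (\<phi> p)" using N.charts_at_exists[OF phi_points[OF p]] by blast
  have "inner_form (N.met d (snd d (\<phi> p)))"
    by (rule local_metric.inner_form[OF N.local_metric_met]) (use N.charts_atD[OF d] in auto)
  from inner_form.g_eq_0[OF this] show ?thesis
    unfolding N.tangent_nonzero[OF tension_tangent[OF p] d] len2_def
      N.rmetric_chart[OF tension_tangent[OF p] tension_tangent[OF p] d] by simp
qed

lemma tension_nonzero:
  assumes "\<not> harmonic M N \<phi>" "p \<in> points M"
  shows "\<tau> p \<noteq> (\<lambda>_. 0)"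
proof -
  obtain q where q: "q \<in> points M" "\<tau> q \<noteq> (\<lambda>_. 0)" using assms(1) by (auto simp: harmonic_def)
  then show ?thesis
    using tension_zero_iff[OF q(1)] tension_zero_iff[OF assms(2)] len2_constant[OF q(1) assms(2)] by simp
qed

section \<open>The bitension field and the norm of the second fundamental form in charts\<close>

lemma bitension_off_chart: "d \<notin> charts_at N (\<phi> p) \<Longrightarrow> p \<in> points M \<Longrightarrow> bitension M N \<phi> p d = 0"
proof -
  assume d: "d \<notin> charts_at N (\<phi> p)" and p: "p \<in> points M"
  obtain W where W: "openin (rtop M) W" "p \<in> W" "orthonormal_frame_on M W (frame M p)"
    using M.frame_exists[OF p] by blast
  have "differential M N \<phi> p (frame M p i p) \<in> tangent_space N (\<phi> p)" if "i < DIM('e)" for i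
    by (rule differential_tangent[OF orthonormal_frame_onD(3)[OF W(3) that W(2)] p])
  then show ?thesis
    using d
    by (simp add: bitension_def Let_def rough_laplacian_def pull_cov_def
        N.curvature_chart[OF tension_tangent[OF p] _ _ phi_points[OF p]])
qed

lemma bitension_chart:
  assumes p: "p \<in> points M" and c: "c \<in> charts_at M p" and d: "d \<in> charts_at N (\<phi> p)"
    and W: "openin (rtop M) W" "p \<in> W" "orthonormal_frame_on M W (frame M p)"
  shows "bitension M N \<phi> p d =
    parallel_hypersurface.bitension_field (N.met d) (rep c d) (M.met c)
      (\<lambda>i x. frame M p i (chart_inv c x) c) (loc c d) (snd c p)"
proof -
  note C = M.charts_atD[OF c] and D = N.charts_atD[OF d]
  define e where "e = frame M p"
  note e = W(3)[folded e_def]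
  interpret L: parallel_hypersurface "snd d ` fst d" "N.met d" "dm W c d" "rep c d" "M.met c"
    "\<lambda>i x. e i (chart_inv c x) c" "loc c d"
    by (rule local_hyp[OF W(1) e C(1) D(1)])
  define x where "x = snd c p"
  have x: "x \<in> dm W c d" unfolding x_def by (rule dmI[OF c d W(2)])
  have cx: "chart_inv c x = p" by (simp add: x_def M.chart_inv_left[OF C])
  have t: "e i p \<in> tangent_space M p" if "i < DIM('e)" for i
    by (rule orthonormal_frame_onD(3)[OF e that W(2)])
  have hess: "pull_cov M N \<phi> (e i p) (\<lambda>q. pull_cov M N \<phi> (e i q) \<tau> q) p d
      - pull_cov M N \<phi> (cov M (e i p) (e i) p) \<tau> p d = L.cd2 (loc c d) x (e i p c) (e i p c)"
    if i: "i < DIM('e)" for i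
  proof -
    note sme = L.smooth_E[OF i]
    \<comment> \<open>The outer derivative sees the inner one at all points near \<open>p\<close>,
      so its coordinate formula is needed on the whole open set and not only at
      \<open>p\<close>.\<close>
    have inner: "pull_cov M N \<phi> (e i (chart_inv c y)) \<tau> (chart_inv c y) d = L.cd (loc c d) y (e i (chart_inv c y) c)"
      if y: "y \<in> dm W c d" for y
    proof -
      obtain q where q: "q \<in> W" "c \<in> charts_at M q" "d \<in> charts_at N (\<phi> q)" "y = snd c q" "chart_inv c y = q"
        using dmE[OF y C(1) D(1)] by metis
      show ?thesis
        using pull_cov_chart[where V=\<tau>, OF orthonormal_frame_onD(3)[OF e i q(1)] q(2,3) L.smooth_tau] y
        by (simp add: q(5)) (simp add: q(4))
    qed
    have "smooth_on (dm W c d) (\<lambda>y. pull_cov M N \<phi> (e i (chart_inv c y)) \<tau> (chart_inv c y) d)"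
      by (rule smooth_on_cong[OF L.smooth_cd[OF L.smooth_tau sme] L.open_dom]) (simp add: inner)
    from pull_cov_chart[where V="\<lambda>q. pull_cov M N \<phi> (e i q) \<tau> q", OF t[OF i] c d this x[unfolded x_def]]
    have "pull_cov M N \<phi> (e i p) (\<lambda>q. pull_cov M N \<phi> (e i q) \<tau> q) p d
        = L.cd (\<lambda>y. pull_cov M N \<phi> (e i (chart_inv c y)) \<tau> (chart_inv c y) d) x (e i p c)"
      by (simp add: x_def)
    also have "\<dots> = L.cd (\<lambda>y. L.cd (loc c d) y (e i (chart_inv c y) c)) x (e i p c)"
      by (rule L.cd_cong[OF x inner])
    finally have 1: "pull_cov M N \<phi> (e i p) (\<lambda>q. pull_cov M N \<phi> (e i q) \<tau> q) p d
      = L.cd (\<lambda>y. L.cd (loc c d) y (e i (chart_inv c y) c)) x (e i p c)" .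
    have "cov M (e i p) (e i) p c = L.M.self.cd (\<lambda>x. e i (chart_inv c x) c) x (e i p c)"
      unfolding x_def by (rule M.cov_chart[where Y="e i", OF t[OF i] c sme x[unfolded x_def]])
    then have 2: "pull_cov M N \<phi> (cov M (e i p) (e i) p) \<tau> p d
        = L.cd (loc c d) x (L.M.self.cd (\<lambda>x. e i (chart_inv c x) c) x (e i p c))"
      using pull_cov_chart[where V=\<tau>, OF M.cov_tangent[OF W(1) orthonormal_frame_onD(1)[OF e i] W(2) t[OF i]] c d
          L.smooth_tau x[unfolded x_def]] by (simp add: x_def)
    show ?thesis
      using L.cd2_along[OF L.smooth_tau sme x] unfolding 1 2 cx .
  qed
  have curv: "curvature N (\<phi> p) (\<tau> p) (differential M N \<phi> p (e i p)) (differential M N \<phi> p (e i p)) d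
      = N.Rm d (rep c d x) (loc c d x) (Df (rep c d) x (e i p c)) (Df (rep c d) x (e i p c))"
    if i: "i < DIM('e)" for i
    using N.curvature_chart[OF tension_tangent[OF p] differential_tangent[OF t[OF i] p] differential_tangent[OF t[OF i] p] phi_points[OF p], of d]
      d differential_chart[OF t[OF i] c d] by (simp add: cx) (simp add: x_def)
  show ?thesis
    unfolding bitension_def rough_laplacian_def Let_def e_def[symmetric] x_def[symmetric] L.bitension_field_def
    by (simp add: hess curv cx)
qed

lemma sff_norm2_chart:
  assumes p: "p \<in> points M" and c: "c \<in> charts_at M p" and d: "d \<in> charts_at N (\<phi> p)"
    and W: "openin (rtop M) W" "p \<in> W" "orthonormal_frame_on M W (frame M p)"
  shows "second_fund_form_norm2 M N \<phi> p =
    parallel_hypersurface.sff_norm2 (N.met d) (rep c d) (M.met c)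
      (\<lambda>i x. frame M p i (chart_inv c x) c) (snd c p)"
proof -
  note C = M.charts_atD[OF c] and D = N.charts_atD[OF d]
  define e where "e = frame M p"
  note e = W(3)[folded e_def]
  interpret L: parallel_hypersurface "snd d ` fst d" "N.met d" "dm W c d" "rep c d" "M.met c"
    "\<lambda>i x. e i (chart_inv c x) c" "loc c d"
    by (rule local_hyp[OF W(1) e C(1) D(1)])
  have cx: "chart_inv c (snd c p) = p" by (rule M.chart_inv_left[OF C])
  have "rmetric N (\<phi> p) (second_fund_form M N \<phi> (e j) (e k) p) (second_fund_form M N \<phi> (e j) (e k) p)
      = N.met d (rep c d (snd c p)) (L.sff (snd c p) (e j p c) (e k p c)) (L.sff (snd c p) (e j p c) (e k p c))"
    if j: "j < DIM('e)" and k: "k < DIM('e)" for j k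
  proof -
    note Y = orthonormal_frame_onD(1)[OF e k] and X = orthonormal_frame_onD(3)[OF e j W(2)]
    have s: "second_fund_form M N \<phi> (e j) (e k) p \<in> tangent_space N (\<phi> p)"
      by (rule sff_tangent[where X="e j", OF W(1) Y W(2) X])
    show ?thesis
      using N.rmetric_chart[OF s s d] sff_chart[where X="e j", OF W(1) Y W(2) X c d] by (simp add: cx)
  qed
  then show ?thesis
    unfolding second_fund_form_norm2_def Let_def e_def[symmetric] L.sff_norm2_def cx by simp
qed

lemma bitension_zero_iff:
  assumes p: "p \<in> points M" and nz: "\<tau> p \<noteq> (\<lambda>_. 0)"
  shows "bitension M N \<phi> p = (\<lambda>_. 0) \<longleftrightarrow>
    ricci_transform N (\<phi> p) (\<tau> p) = (\<lambda>d. second_fund_form_norm2 M N \<phi> p *\<^sub>R \<tau> p d)"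
proof -
  obtain b where b: "orthonormal_at N (\<phi> p) b"
    "\<And>u d. u \<in> tangent_space N (\<phi> p) \<Longrightarrow> ricci_transform N (\<phi> p) u d =
      (if d \<in> charts_at N (\<phi> p) then \<Sum>i<DIM('f). N.Rm d (snd d (\<phi> p)) (u d) (b i d) (b i d) else 0)"
    by (rule N.ricci_chart[OF phi_points[OF p]]) (rule that)
  obtain c where c: "c \<in> charts_at M p" using M.charts_at_exists[OF p] by blast
  note C = M.charts_atD[OF c]
  obtain W where W: "openin (rtop M) W" "p \<in> W" "orthonormal_frame_on M W (frame M p)"
    using M.frame_exists[OF p] by blast
  have "bitension M N \<phi> p d = 0 \<longleftrightarrow>
      ricci_transform N (\<phi> p) (\<tau> p) d = second_fund_form_norm2 M N \<phi> p *\<^sub>R \<tau> p d" for d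
  proof (cases "d \<in> charts_at N (\<phi> p)")
    case d: True
    note D = N.charts_atD[OF d]
    interpret L: parallel_hypersurface "snd d ` fst d" "N.met d" "dm W c d" "rep c d" "M.met c"
      "\<lambda>i x. frame M p i (chart_inv c x) c" "loc c d"
      by (rule local_hyp[OF W(1,3) C(1) D(1)])
    have x: "snd c p \<in> dm W c d" by (rule dmI[OF c d W(2)])
    have cx: "chart_inv c (snd c p) = p" by (rule M.chart_inv_left[OF C])
    have bt: "b i \<in> tangent_space N (\<phi> p)" if "i < DIM('f)" for i
      using b(1) that by (simp add: orthonormal_at_def)
    have "inner_form.ortho (N.met d (rep c d (snd c p))) (\<lambda>i. b i d) DIM('f)"
      using N.ortho_chart[OF d bt] b(1) by (simp add: cx)
    moreover have "loc c d (snd c p) \<noteq> 0"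
      using nz N.tangent_nonzero[OF tension_tangent[OF p] d] by (simp add: cx)
    ultimately show ?thesis
      using L.bitension_eq_0_iff[OF x] b(2)[OF tension_tangent[OF p], of d] d
      by (simp add: bitension_chart[OF p c d W] sff_norm2_chart[OF p c d W] cx)
  next
    \<comment> \<open>Equality of tangent vectors is equality of whole families. At a chart that is
      not around \<open>\<phi> p\<close> every entry is 0 by convention, so both equations hold
      there.\<close>
    case False
    then show ?thesis
      using b(2)[OF tension_tangent[OF p], of d] N.tangentD(2)[OF tension_tangent[OF p] False]
        bitension_off_chart[OF False p] by simp
  qed
  then show ?thesis by (simp add: fun_eq_iff)
qed

text \<open>In codimension one the nonzero normal vector \<open>\<tau> p\<close> spans the normal
  space; unit length of \<open>\<xi> p\<close> excludes the factor 0.\<close>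

lemma unit_normal_multiple:
  assumes p: "p \<in> points M" and nz: "\<tau> p \<noteq> (\<lambda>_. 0)" and \<xi>: "unit_normal_field M N \<phi> \<xi>"
  shows "\<exists>k. k \<noteq> 0 \<and> \<xi> p = (\<lambda>d. k *\<^sub>R \<tau> p d)"
proof -
  obtain c where c: "c \<in> charts_at M p" using M.charts_at_exists[OF p] by blast
  obtain d where d: "d \<in> charts_at N (\<phi> p)" using N.charts_at_exists[OF phi_points[OF p]] by blast
  note C = M.charts_atD[OF c] and D = N.charts_atD[OF d]
  obtain W where W: "openin (rtop M) W" "p \<in> W" "orthonormal_frame_on M W (frame M p)"
    using M.frame_exists[OF p] by blast
  interpret L: parallel_hypersurface "snd d ` fst d" "N.met d" "dm W c d" "rep c d" "M.met c"
    "\<lambda>i x. frame M p i (chart_inv c x) c" "loc c d"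
    by (rule local_hyp[OF W(1,3) C(1) D(1)])
  have x: "snd c p \<in> dm W c d" by (rule dmI[OF c d W(2)])
  have cx: "chart_inv c (snd c p) = p" by (rule M.chart_inv_left[OF C])
  have n: "\<xi> p \<in> normal_space M N \<phi> p" and unit: "rmetric N (\<phi> p) (\<xi> p) (\<xi> p) = 1"
    using \<xi> p by (auto simp: unit_normal_field_def)
  have t: "\<xi> p \<in> tangent_space N (\<phi> p)" using n by (simp add: normal_space_def)
  have "loc c d (snd c p) \<noteq> 0"
    using nz N.tangent_nonzero[OF tension_tangent[OF p] d] by (simp add: cx)
  then obtain k where k: "\<xi> p d = k *\<^sub>R \<tau> p d"
    using L.normal_multiple[OF x, of "\<xi> p d"] normal_space_chart[OF n c d] by (auto simp: cx)
  have eq: "\<xi> p = (\<lambda>d. k *\<^sub>R \<tau> p d)"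
    by (rule N.tangent_eqI[OF t N.tangent_scale[OF tension_tangent[OF p]] d k])
  moreover have "k \<noteq> 0"
    using unit N.rmetric_chart[OF t t d] k inner_form.g_simps(9)[OF L.inner_F[OF x]] by (auto simp: cx)
  ultimately show ?thesis by blast
qed

lemma ricci_scale:
  assumes p: "p \<in> points M" and u: "u \<in> tangent_space N (\<phi> p)"
  shows "ricci_transform N (\<phi> p) (\<lambda>d. k *\<^sub>R u d) = (\<lambda>d. k *\<^sub>R ricci_transform N (\<phi> p) u d)"
proof
  fix d
  obtain b where b: "orthonormal_at N (\<phi> p) b"
    "\<And>u d. u \<in> tangent_space N (\<phi> p) \<Longrightarrow> ricci_transform N (\<phi> p) u d =
      (if d \<in> charts_at N (\<phi> p) then \<Sum>i<DIM('f). N.Rm d (snd d (\<phi> p)) (u d) (b i d) (b i d) else 0)"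
    by (rule N.ricci_chart[OF phi_points[OF p]]) (rule that)
  show "ricci_transform N (\<phi> p) (\<lambda>d. k *\<^sub>R u d) d = k *\<^sub>R ricci_transform N (\<phi> p) u d"
  proof (cases "d \<in> charts_at N (\<phi> p)")
    case True
    have lin: "linear (\<lambda>a. N.Rm d (snd d (\<phi> p)) a v w)" for v w
      by (rule local_metric.linear_curv(1)[OF N.local_metric_met]) (use N.charts_atD[OF True] in auto)
    then show ?thesis
      using True by (simp add: b(2)[OF u] b(2)[OF N.tangent_scale[OF u]] linear_scale[OF lin] scaleR_sum_right)
  qed (simp add: b(2)[OF u] b(2)[OF N.tangent_scale[OF u]])
qed

lemma biharmonic_iff:
  assumes "\<not> harmonic M N \<phi>"
  shows "biharmonic M N \<phi> \<longleftrightarrow> (\<forall>p\<in>points M.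
    ricci_transform N (\<phi> p) (\<tau> p) = (\<lambda>d. second_fund_form_norm2 M N \<phi> p *\<^sub>R \<tau> p d))"
  unfolding biharmonic_def using bitension_zero_iff tension_nonzero[OF assms] by simp

text \<open>The equation is homogeneous in the normal vector, so at each point it passes from
  \<open>\<tau>\<close> to \<open>\<xi>\<close> by cancelling the factor \<open>k\<close>. This
  factor may depend on the point.\<close>

lemma biharmonic_iff_unit_normal:
  assumes nh: "\<not> harmonic M N \<phi>" and \<xi>: "unit_normal_field M N \<phi> \<xi>"
  shows "biharmonic M N \<phi> \<longleftrightarrow> (\<forall>p\<in>points M.
    ricci_transform N (\<phi> p) (\<xi> p) = (\<lambda>d. second_fund_form_norm2 M N \<phi> p *\<^sub>R \<xi> p d))"
  unfolding biharmonic_iff[OF nh]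
proof (rule ball_cong[OF refl])
  fix p assume p: "p \<in> points M"
  obtain k where k: "k \<noteq> 0" "\<xi> p = (\<lambda>d. k *\<^sub>R \<tau> p d)"
    using unit_normal_multiple[OF p tension_nonzero[OF nh p] \<xi>] by blast
  have cancel: "k *\<^sub>R a = r *\<^sub>R k *\<^sub>R b \<longleftrightarrow> a = r *\<^sub>R b" for a b :: 'f and r
    unfolding scaleR_left_commute[of r k b] scaleR_cancel_left using k(1) by simp
  show "ricci_transform N (\<phi> p) (\<tau> p) = (\<lambda>d. second_fund_form_norm2 M N \<phi> p *\<^sub>R \<tau> p d) \<longleftrightarrow>
      ricci_transform N (\<phi> p) (\<xi> p) = (\<lambda>d. second_fund_form_norm2 M N \<phi> p *\<^sub>R \<xi> p d)"
    unfolding k(2) ricci_scale[OF p tension_tangent[OF p]] fun_eq_iff cancel ..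
qed

lemma biharmonic_iff_einstein:
  assumes nh: "\<not> harmonic M N \<phi>" and c: "einstein_with N c"
  shows "biharmonic M N \<phi> \<longleftrightarrow> (\<forall>p\<in>points M. second_fund_form_norm2 M N \<phi> p = c)"
  unfolding biharmonic_iff[OF nh]
proof (rule ball_cong[OF refl])
  fix p assume p: "p \<in> points M"
  have ric: "ricci_transform N (\<phi> p) (\<tau> p) = (\<lambda>d. c *\<^sub>R \<tau> p d)"
    using c phi_points[OF p] tension_tangent[OF p] by (simp add: einstein_with_def)
  \<comment> \<open>Comparing the two multiples of \<open>\<tau> p\<close> at one nonzero entry
    identifies the scalars.\<close>
  obtain d where d: "\<tau> p d \<noteq> 0" using tension_nonzero[OF nh p] by (metis ext)
  show "ricci_transform N (\<phi> p) (\<tau> p) = (\<lambda>d. second_fund_form_norm2 M N \<phi> p *\<^sub>R \<tau> p d) \<longleftrightarrow>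
      second_fund_form_norm2 M N \<phi> p = c"
    unfolding ric
  proof
    assume "(\<lambda>d. c *\<^sub>R \<tau> p d) = (\<lambda>d. second_fund_form_norm2 M N \<phi> p *\<^sub>R \<tau> p d)"
    from fun_cong[OF this, of d] show "second_fund_form_norm2 M N \<phi> p = c" using d by simp
  qed simp
qed

end

theorem theorem3p6:
  fixes M :: "('a, 'e::euclidean_space) riem"
    and N :: "('b, 'f::euclidean_space) riem"
    and \<phi> :: "'a \<Rightarrow> 'b"
  assumes "riemannian_manifold M"
    and "riemannian_manifold N"
    and "isometric_immersion M N \<phi>"
    and "DIM('f) = DIM('e) + 1"
    and "\<And>X p. smooth_vfield_on M (points M) X \<Longrightarrow> p \<in> points M \<Longrightarrow>
           normal_cov M N \<phi> (X p) (tension M N \<phi>) p = (\<lambda>_. 0)"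
  shows "(\<not> harmonic M N \<phi> \<longrightarrow>
           (\<forall>\<xi>. unit_normal_field M N \<phi> \<xi> \<longrightarrow>
             (biharmonic M N \<phi> \<longleftrightarrow>
               (\<forall>p\<in>points M. ricci_transform N (\<phi> p) (\<xi> p)
                  = (\<lambda>d. second_fund_form_norm2 M N \<phi> p *\<^sub>R \<xi> p d)))))
       \<and> (\<forall>c. einstein_with N c \<and> \<not> harmonic M N \<phi> \<longrightarrow>
             (biharmonic M N \<phi> \<longleftrightarrow> (\<forall>p\<in>points M. second_fund_form_norm2 M N \<phi> p = c)))"
proof -
  interpret parallel_tension_hypersurface M N \<phi>
  proof
    show "smooth_map M N \<phi>" using assms(3) by (simp add: isometric_immersion_def)
  qed (rule assms | assumption)+
  show ?thesis
    using biharmonic_iff_unit_normal biharmonic_iff_einstein by blast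
qed

end
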